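(* Let $p,q$ be coprime nonzero integers. The cut locus $K_{[\mathrm{Id}]}$ from $[\mathrm{Id}]$ for the sub-Riemannian structure on the lens space $L(p,q)$ induced by the $\mathbf{k}\oplus\mathbf{p}$ structure of $SU(2)$ is a stratification $$K_{[\mathrm{Id}]}=K_{[\mathrm{Id}]}^{sym}\cup K_{[\mathrm{Id}]}^{loc},$$ with $$K_{[\mathrm{Id}]}^{sym}=[\partial E_p]=\left\{\left[\begin{pmatrix}\alpha\\\beta\end{pmatrix}\right]\ \Big|\ \alpha,\beta\in\mathbb{C},\ |\alpha|^2+|\beta|^2=1,\ \mathrm{Re}(\alpha)\ge0,\ \frac{\mathrm{Im}(\alpha)^2}{\sin(\pi/p)^2}+|\beta|^2=1\right\},$$ $$K_{[\mathrm{Id}]}^{loc}=[e^{\mathbf{k}}]\setminus[\mathrm{Id}]=\left\{\left[\begin{pmatrix}\alpha\\0\end{pmatrix}\right]\ \Big|\ \alpha\in\mathbb{C},\ |\alpha|=1,\ \alpha^p\neq1\right\}.$$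
   Context: $SU(2)$ is identified with $S^3=\{(\alpha,\beta)^T\in\mathbb{C}^2:|\alpha|^2+|\beta|^2=1\}$ via $\begin{pmatrix}\alpha&\beta\\-\bar\beta&\bar\alpha\end{pmatrix}\mapsto\begin{pmatrix}\alpha\\\beta\end{pmatrix}$. In $su(2)$ let $p_1=\frac12\begin{pmatrix}0&1\\-1&0\end{pmatrix}$, $p_2=\frac12\begin{pmatrix}0&i\\i&0\end{pmatrix}$, $k=\frac12\begin{pmatrix}i&0\\0&-i\end{pmatrix}$, $\mathbf{k}=\mathrm{span}\{k\}$, $\mathbf{p}=\mathrm{span}\{p_1,p_2\}$; $e^{\mathbf{k}}$ is the image of $\mathbf{k}$ under the matrix exponential. The $\mathbf{k}\oplus\mathbf{p}$ sub-Riemannian structure on $SU(2)$ has distribution $\Delta(g)=g\mathbf{p}$ and metric $\langle v,w\rangle_g=\langle g^{-1}v,g^{-1}w\rangle$ on $\Delta(g)$, where $\langle\cdot,\cdot\rangle$ on $\mathbf{p}$ has $\{p_1,p_2\}$ orthonormal. The lens space $L(p,q)$ is the quotient of $SU(2)$ by the relation $(\alpha_1,\beta_1)^T\sim(\alpha_2,\beta_2)^T$ iff $(\alpha_2,\beta_2)^T=(\omega\alpha_1,\omega^q\beta_1)^T$ for some $p$-th root of unity $\omega$; $[\cdot]$ denotes classes (and, for a subset of $SU(2)$, its image), and the projection $\Pi:SU(2)\to L(p,q)$ is a local diffeomorphism. $E_p=\{(\alpha,\beta)^T\in SU(2):\mathrm{Re}(\alpha)>0,\ \frac{\mathrm{Im}(\alpha)^2}{\sin(\pi/p)^2}+|\beta|^2<1\}$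 and $\partial E_p$ is its boundary in $SU(2)$. The induced sub-Riemannian structure on $L(p,q)$ is $\widetilde\Delta([g])=\Pi_*(\Delta(h))$ for any $h\in[g]$, with metric $\langle v_*,w_*\rangle_{[g]}=\langle v,w\rangle_h$ whenever $v,w\in\Delta(h)$, $\Pi_*v=v_*$, $\Pi_*w=w_*$ (well defined). Horizontal curves are Lipschitz curves a.e. tangent to the distribution, length is the integral of the norm of the velocity, and the distance $d$ is the infimum of lengths of horizontal curves joining two points. The arclength-parametrized geodesics of $L(p,q)$ from $[\mathrm{Id}]$ are $t\mapsto[\mathrm{Exp}(\theta,c,t)]$, where $\mathrm{Exp}(\theta,c,t)=e^{(\cos\theta\,p_1+\sin\theta\,p_2+ck)t}e^{-ckt}\in SU(2)$, $\theta\in\mathbb{R}/2\pi$, $c\in\mathbb{R}$. Such a geodesic is optimal on $[0,t]$ if $d([\mathrm{Id}],[\mathrm{Exp}(\theta,c,t)])=t$. The cut locus $K_{[\mathrm{Id}]}$ is the set of points $x$ for which there exist $(\theta_1,c_1)\neq(\theta_2,c_2)$ and $t>0$ with $x=[\mathrm{Exp}(\theta_1,c_1,t)]=[\mathrm{Exp}(\theta_2,c_2,t)]$, both geodesics being optimal on $[0,t]$.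
   Formalization: For p = ±1 the quotient Im(α)²/sin(π/p)² has denominator zero and is undefined; there the conditions defining E_p and K^sym are taken to fail, so K^sym is empty and the cut locus is e^k without Id; nothing changes for |p| ≥ 2. *)

theory Defs
  imports
    "HOL-Analysis.Analysis"
    "HOL-Library.Real_Mod"
    "HOL-Library.Disjoint_Sets"
begin

section \<open>The group SU(2) as the unit sphere of \<open>\<complex>\<^sup>2\<close>\<close>

text \<open>
  Points of \<open>SU(2)\<close> and tangent vectors are pairs \<open>(\<alpha>, \<beta>)\<close>. The identification with matrices is
  real-linear, so the same map \<open>su2_mat\<close> also turns a tangent vector in \<open>\<complex>\<^sup>2\<close> into a matrix.
\<close>

definition su2_mat :: "complex \<times> complex \<Rightarrow> complex^2^2" where
  "su2_mat g = vector [vector [fst g, snd g], vector [- cnj (snd g), cnj (fst g)]]"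

definition su2_coords :: "complex^2^2 \<Rightarrow> complex \<times> complex" where
  "su2_coords A = (A $ 1 $ 1, A $ 1 $ 2)"

definition SU2 :: "(complex \<times> complex) set" where
  "SU2 = {(\<alpha>, \<beta>). (cmod \<alpha>)\<^sup>2 + (cmod \<beta>)\<^sup>2 = 1}"

definition p1 :: "complex^2^2" where
  "p1 = (1/2) *\<^sub>R vector [vector [0, 1], vector [-1, 0]]"

definition p2 :: "complex^2^2" where
  "p2 = (1/2) *\<^sub>R vector [vector [0, \<i>], vector [\<i>, 0]]"

definition kk :: "complex^2^2" where
  "kk = (1/2) *\<^sub>R vector [vector [\<i>, 0], vector [0, - \<i>]]"

definition p_space :: "(complex^2^2) set" where
  "p_space = span {p1, p2}"

definition k_space :: "(complex^2^2) set" where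
  "k_space = span {kk}"

text \<open>
  Class multiplication \<open>*\<close> on the vector type is componentwise, so the library function \<open>exp\<close>
  does not provide the matrix exponential.
\<close>

definition mat_exp :: "complex^2^2 \<Rightarrow> complex^2^2" where
  "mat_exp A = (\<Sum>n. (1 / fact n) *\<^sub>R (((**) A ^^ n) (mat 1)))"

definition p_inner :: "complex^2^2 \<Rightarrow> complex^2^2 \<Rightarrow> real" where
  "p_inner X Y = (\<Sum>b\<in>{p1, p2}. representation {p1, p2} X b * representation {p1, p2} Y b)"

definition Distr :: "complex \<times> complex \<Rightarrow> (complex \<times> complex) set" where
  "Distr g = {v. su2_mat v \<in> (\<lambda>X. su2_mat g ** X) ` p_space}"

definition sr_inner :: "complex \<times> complex \<Rightarrow> complex \<times> complex \<Rightarrow> complex \<times> complex \<Rightarrow> real" where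
  "sr_inner g v w =
     p_inner (matrix_inv (su2_mat g) ** su2_mat v) (matrix_inv (su2_mat g) ** su2_mat w)"

definition Exp_su2 :: "real \<Rightarrow> real \<Rightarrow> real \<Rightarrow> complex \<times> complex" where
  "Exp_su2 \<theta> c t = su2_coords
     (mat_exp (t *\<^sub>R (cos \<theta> *\<^sub>R p1 + sin \<theta> *\<^sub>R p2 + c *\<^sub>R kk)) ** mat_exp (- ((c * t) *\<^sub>R kk)))"

definition exp_k :: "(complex \<times> complex) set" where
  "exp_k = su2_coords ` mat_exp ` k_space"


section \<open>Lens spaces\<close>

definition act :: "int \<Rightarrow> complex \<Rightarrow> complex \<times> complex \<Rightarrow> complex \<times> complex" where
  "act q \<omega> g = (\<omega> * fst g, (\<omega> powi q) * snd g)"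

definition lens_rel :: "int \<Rightarrow> int \<Rightarrow> ((complex \<times> complex) \<times> (complex \<times> complex)) set" where
  "lens_rel p q = {(g, h). g \<in> SU2 \<and> h \<in> SU2 \<and> (\<exists>\<omega>. \<omega> powi p = 1 \<and> h = act q \<omega> g)}"

definition lens :: "int \<Rightarrow> int \<Rightarrow> (complex \<times> complex) set set" where
  "lens p q = SU2 // lens_rel p q"

definition proj :: "int \<Rightarrow> int \<Rightarrow> complex \<times> complex \<Rightarrow> (complex \<times> complex) set" where
  "proj p q g = lens_rel p q `` {g}"

definition lens_topology :: "int \<Rightarrow> int \<Rightarrow> (complex \<times> complex) set topology" where
  "lens_topology p q =
     topology (\<lambda>U. U \<subseteq> lens p q \<and> openin (top_of_set SU2) {g \<in> SU2. proj p q g \<in> U})"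

text \<open>
  \<open>push p q h v\<close> is the tangent vector \<open>\<Pi>\<^sub>* v\<close> at \<open>[h]\<close>, for \<open>v\<close> tangent to \<open>SU(2)\<close> at \<open>h\<close>.
  Since \<open>\<Pi>\<close> is a local diffeomorphism and \<open>\<Pi> \<circ> act q \<omega> = \<Pi>\<close> with \<open>act q \<omega>\<close> real-linear, the
  tangent bundle of \<open>L(p,q)\<close> is the tangent bundle of \<open>SU(2)\<close> modulo
  \<open>(h, v) \<sim> (act q \<omega> h, act q \<omega> v)\<close>; a tangent vector is an equivalence class of such pairs.
\<close>

definition push :: "int \<Rightarrow> int \<Rightarrow> complex \<times> complex \<Rightarrow> complex \<times> complex
    \<Rightarrow> ((complex \<times> complex) \<times> (complex \<times> complex)) set" where
  "push p q h v = {(act q \<omega> h, act q \<omega> v) | \<omega>. \<omega> powi p = 1}"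

definition lens_Distr :: "int \<Rightarrow> int \<Rightarrow> (complex \<times> complex) set
    \<Rightarrow> ((complex \<times> complex) \<times> (complex \<times> complex)) set set" where
  "lens_Distr p q x = {push p q h v | h v. h \<in> x \<and> v \<in> Distr h}"

definition lens_inner :: "int \<Rightarrow> int
    \<Rightarrow> ((complex \<times> complex) \<times> (complex \<times> complex)) set
    \<Rightarrow> ((complex \<times> complex) \<times> (complex \<times> complex)) set \<Rightarrow> real" where
  "lens_inner p q V W = (THE r. \<exists>h v w. h \<in> SU2 \<and> v \<in> Distr h \<and> w \<in> Distr h \<and>
     V = push p q h v \<and> W = push p q h w \<and> r = sr_inner h v w)"


section \<open>Sub-Riemannian distance on lens spaces\<close>

text \<open>
  Local inverses of \<open>\<Pi>\<close> serve as charts of \<open>L(p,q)\<close>: a curve is Lipschitz if it is so in charts,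
  and its velocity is the image under \<open>\<Pi>\<^sub>*\<close> of the velocity of a local lift.
\<close>

definition local_lift :: "int \<Rightarrow> int \<Rightarrow> (real \<Rightarrow> (complex \<times> complex) set) \<Rightarrow> real set
    \<Rightarrow> (real \<Rightarrow> complex \<times> complex) \<Rightarrow> bool" where
  "local_lift p q \<gamma> J g \<longleftrightarrow> (\<forall>s\<in>J. g s \<in> SU2 \<and> \<gamma> s = proj p q (g s))"

definition lens_lipschitz :: "int \<Rightarrow> int \<Rightarrow> real \<Rightarrow> (real \<Rightarrow> (complex \<times> complex) set) \<Rightarrow> bool" where
  "lens_lipschitz p q T \<gamma> \<longleftrightarrow> (\<forall>t\<in>{0..T}. \<exists>\<epsilon>>0. \<exists>g C.
     local_lift p q \<gamma> ({0..T} \<inter> ball t \<epsilon>) g \<and> C-lipschitz_on ({0..T} \<inter> ball t \<epsilon>) g)"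

definition has_velocity :: "int \<Rightarrow> int \<Rightarrow> real \<Rightarrow> (real \<Rightarrow> (complex \<times> complex) set) \<Rightarrow> real
    \<Rightarrow> ((complex \<times> complex) \<times> (complex \<times> complex)) set \<Rightarrow> bool" where
  "has_velocity p q T \<gamma> t V \<longleftrightarrow> (\<exists>\<epsilon>>0. \<exists>g v.
     local_lift p q \<gamma> ({0..T} \<inter> ball t \<epsilon>) g \<and>
     (g has_vector_derivative v) (at t within {0..T}) \<and> V = push p q (g t) v)"

definition horizontal :: "int \<Rightarrow> int \<Rightarrow> real \<Rightarrow> (real \<Rightarrow> (complex \<times> complex) set) \<Rightarrow> bool" where
  "horizontal p q T \<gamma> \<longleftrightarrow> lens_lipschitz p q T \<gamma> \<and>
     (AE t in lebesgue. t \<in> {0..T} \<longrightarrow> (\<exists>V \<in> lens_Distr p q (\<gamma> t). has_velocity p q T \<gamma> t V))"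

definition speed :: "int \<Rightarrow> int \<Rightarrow> real \<Rightarrow> (real \<Rightarrow> (complex \<times> complex) set) \<Rightarrow> real \<Rightarrow> real" where
  "speed p q T \<gamma> t = (let V = (THE V. has_velocity p q T \<gamma> t V) in sqrt (lens_inner p q V V))"

definition curve_length :: "int \<Rightarrow> int \<Rightarrow> real \<Rightarrow> (real \<Rightarrow> (complex \<times> complex) set) \<Rightarrow> real" where
  "curve_length p q T \<gamma> = integral {0..T} (speed p q T \<gamma>)"

definition lens_dist :: "int \<Rightarrow> int \<Rightarrow> (complex \<times> complex) set \<Rightarrow> (complex \<times> complex) set \<Rightarrow> ereal" where
  "lens_dist p q x y = Inf {ereal (curve_length p q T \<gamma>) | T \<gamma>.
     T > 0 \<and> horizontal p q T \<gamma> \<and> \<gamma> 0 = x \<and> \<gamma> T = y}"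

definition lens_geodesic :: "int \<Rightarrow> int \<Rightarrow> real \<Rightarrow> real \<Rightarrow> real \<Rightarrow> (complex \<times> complex) set" where
  "lens_geodesic p q \<theta> c t = proj p q (Exp_su2 \<theta> c t)"

definition lens_Id :: "int \<Rightarrow> int \<Rightarrow> (complex \<times> complex) set" where
  "lens_Id p q = proj p q (su2_coords (mat 1))"

definition optimal_upto :: "int \<Rightarrow> int \<Rightarrow> real \<Rightarrow> real \<Rightarrow> real \<Rightarrow> bool" where
  "optimal_upto p q \<theta> c t \<longleftrightarrow> lens_dist p q (lens_Id p q) (lens_geodesic p q \<theta> c t) = ereal t"

definition cut_locus :: "int \<Rightarrow> int \<Rightarrow> (complex \<times> complex) set set" where
  "cut_locus p q = {x. \<exists>\<theta>1 c1 \<theta>2 c2 t. \<not> ([\<theta>1 = \<theta>2] (rmod (2 * pi)) \<and> c1 = c2) \<and> t > 0 \<and>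
     x = lens_geodesic p q \<theta>1 c1 t \<and> x = lens_geodesic p q \<theta>2 c2 t \<and>
     optimal_upto p q \<theta>1 c1 t \<and> optimal_upto p q \<theta>2 c2 t}"


section \<open>The two parts of the cut locus\<close>

text \<open>
  For \<open>p = 1\<close> and \<open>p = -1\<close> the quotient in the defining inequality has denominator \<open>0\<close>. The
  conjunct \<open>sin (pi / p) \<noteq> 0\<close> makes the inequality false there (so that \<open>E_dom p\<close> is empty),
  instead of letting \<open>x / 0 = 0\<close> decide. For all other nonzero \<open>p\<close> it is vacuous.
\<close>

definition E_dom :: "int \<Rightarrow> (complex \<times> complex) set" where
  "E_dom p = {(\<alpha>, \<beta>) \<in> SU2. Re \<alpha> > 0 \<and> sin (pi / of_int p) \<noteq> 0 \<and>
     (Im \<alpha>)\<^sup>2 / (sin (pi / of_int p))\<^sup>2 + (cmod \<beta>)\<^sup>2 < 1}"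

definition K_sym :: "int \<Rightarrow> int \<Rightarrow> (complex \<times> complex) set set" where
  "K_sym p q = proj p q ` (top_of_set SU2 frontier_of E_dom p)"

definition K_loc :: "int \<Rightarrow> int \<Rightarrow> (complex \<times> complex) set set" where
  "K_loc p q = proj p q ` exp_k - {lens_Id p q}"


section \<open>Stratifications\<close>

primrec k_smooth_on :: "nat \<Rightarrow> 'a::real_normed_vector set \<Rightarrow> ('a \<Rightarrow> real) \<Rightarrow> bool" where
  "k_smooth_on 0 U f \<longleftrightarrow> continuous_on U f"
| "k_smooth_on (Suc n) U f \<longleftrightarrow> (\<forall>x\<in>U. f differentiable (at x)) \<and>
     (\<forall>v. k_smooth_on n U (\<lambda>x. frechet_derivative f (at x) v))"

definition smooth_on :: "'a::real_normed_vector set \<Rightarrow> ('a \<Rightarrow> real) \<Rightarrow> bool" where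
  "smooth_on U f \<longleftrightarrow> (\<forall>n. k_smooth_on n U f)"

text \<open>
  Embedded submanifolds of dimension \<open>d\<close> of a Euclidean space: locally the regular zero set of a
  smooth map to \<open>\<real>\<^sup>m\<close>, \<open>m = DIM('a) - d\<close>, with components \<open>f i\<close>, \<open>i < m\<close>. The last condition says
  that the differential is onto.
\<close>

definition submanifold :: "nat \<Rightarrow> 'a::euclidean_space set \<Rightarrow> bool" where
  "submanifold d S \<longleftrightarrow> (\<exists>m. d + m = DIM('a) \<and> (\<forall>x\<in>S. \<exists>U. \<exists>f :: nat \<Rightarrow> 'a \<Rightarrow> real.
     open U \<and> x \<in> U \<and> (\<forall>i<m. smooth_on U (f i)) \<and>
     S \<inter> U = {y \<in> U. \<forall>i<m. f i y = 0} \<and>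
     (\<forall>y \<in> S \<inter> U. \<forall>c :: nat \<Rightarrow> real. \<exists>v. \<forall>i<m. frechet_derivative (f i) (at y) v = c i)))"

text \<open>
  As \<open>\<Pi>\<close> is a surjective local diffeomorphism and \<open>SU2\<close> is embedded in \<open>\<complex>\<^sup>2\<close>, a subset of \<open>L(p,q)\<close>
  is an embedded submanifold iff its preimage is one.
\<close>

definition lens_submanifold :: "int \<Rightarrow> int \<Rightarrow> nat \<Rightarrow> (complex \<times> complex) set set \<Rightarrow> bool" where
  "lens_submanifold p q d S \<longleftrightarrow> S \<subseteq> lens p q \<and> submanifold d {g \<in> SU2. proj p q g \<in> S}"

text \<open>
  A finite partition into embedded submanifolds (of various dimensions) that satisfies the
  frontier condition.
\<close>

definition stratification :: "int \<Rightarrow> int \<Rightarrow> (complex \<times> complex) set set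
    \<Rightarrow> (complex \<times> complex) set set set \<Rightarrow> bool" where
  "stratification p q K \<S> \<longleftrightarrow> finite \<S> \<and> partition_on K \<S> \<and>
     (\<forall>S\<in>\<S>. \<exists>d. lens_submanifold p q d S) \<and>
     (\<forall>S\<in>\<S>. \<forall>R\<in>\<S>. S \<inter> (lens_topology p q closure_of R) \<noteq> {} \<longrightarrow>
        S \<subseteq> lens_topology p q closure_of R)"


section \<open>Consistency of the definitions\<close>

lemma su2_mat_nth [simp]:
  "su2_mat g $ 1 $ 1 = fst g" "su2_mat g $ 1 $ 2 = snd g"
  "su2_mat g $ 2 $ 1 = - cnj (snd g)" "su2_mat g $ 2 $ 2 = cnj (fst g)"
  by (simp_all add: su2_mat_def)

lemma p1_nth [simp]: "p1 $ 1 $ 1 = 0" "p1 $ 1 $ 2 = 1/2" "p1 $ 2 $ 1 = -1/2" "p1 $ 2 $ 2 = 0"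
  by (simp_all add: p1_def scaleR_conv_of_real[where 'a=complex])

lemma p2_nth [simp]: "p2 $ 1 $ 1 = 0" "p2 $ 1 $ 2 = \<i>/2" "p2 $ 2 $ 1 = \<i>/2" "p2 $ 2 $ 2 = 0"
  by (simp_all add: p2_def scaleR_conv_of_real[where 'a=complex])

lemma kk_nth [simp]: "kk $ 1 $ 1 = \<i>/2" "kk $ 1 $ 2 = 0" "kk $ 2 $ 1 = 0" "kk $ 2 $ 2 = -\<i>/2"
  by (simp_all add: kk_def scaleR_conv_of_real[where 'a=complex])

lemma mat2_eq_iff:
  "(A :: complex^2^2) = B \<longleftrightarrow> A$1$1 = B$1$1 \<and> A$1$2 = B$1$2 \<and> A$2$1 = B$2$1 \<and> A$2$2 = B$2$2"
  by (auto simp: vec_eq_iff forall_2)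

lemma mat2_mult_nth:
  "((A :: complex^2^2) ** B) $ i $ j = A$i$1 * B$1$j + A$i$2 * B$2$j"
  by (simp add: matrix_matrix_mult_def sum_2)

lemma mat_1_nth [simp]: "(mat 1 :: complex^2^2) $ i $ j = (if i = j then 1 else 0)"
  by (simp add: mat_def)

lemma su2_coords_su2_mat [simp]: "su2_coords (su2_mat g) = g"
  by (simp add: su2_coords_def)

lemma su2_mat_eq_iff: "su2_mat g = su2_mat h \<longleftrightarrow> g = h"
  by (metis su2_coords_su2_mat)

lemma mem_SU2_iff: "g \<in> SU2 \<longleftrightarrow> fst g * cnj (fst g) + snd g * cnj (snd g) = 1"
proof -
  have "fst g * cnj (fst g) + snd g * cnj (snd g) = of_real ((cmod (fst g))\<^sup>2 + (cmod (snd g))\<^sup>2)"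
    by (simp only: of_real_add complex_norm_square)
  then show ?thesis
    by (simp only: SU2_def case_prod_beta mem_Collect_eq of_real_eq_1_iff)
qed

lemma su2_mat_image_SU2:
  "su2_mat ` SU2 = {A. A ** (\<chi> i j. cnj (A $ j $ i)) = mat 1 \<and> det A = 1}"
proof (intro set_eqI iffI)
  fix A assume "A \<in> su2_mat ` SU2"
  then show "A \<in> {A. A ** (\<chi> i j. cnj (A $ j $ i)) = mat 1 \<and> det A = 1}"
    by (auto simp: mem_SU2_iff mat2_eq_iff mat2_mult_nth det_2 algebra_simps)
next
  fix A :: "complex^2^2"
  assume "A \<in> {A. A ** (\<chi> i j. cnj (A $ j $ i)) = mat 1 \<and> det A = 1}"
  then have a: "A$1$1 * cnj (A$1$1) + A$1$2 * cnj (A$1$2) = 1"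
    and b: "A$2$1 * cnj (A$1$1) + A$2$2 * cnj (A$1$2) = 0"
    and d: "A$1$1 * A$2$2 - A$1$2 * A$2$1 = 1"
    by (auto simp: mat2_eq_iff mat2_mult_nth det_2)
  have "A$2$1 = A$2$1 * (A$1$1 * cnj (A$1$1) + A$1$2 * cnj (A$1$2))"
    by (simp only: a mult_1_right)
  also have "\<dots> = A$1$1 * (A$2$1 * cnj (A$1$1) + A$2$2 * cnj (A$1$2))
      - cnj (A$1$2) * (A$1$1 * A$2$2 - A$1$2 * A$2$1)"
    by (simp only: algebra_simps)
  finally have c: "A$2$1 = - cnj (A$1$2)"
    by (simp only: b d) simp
  have "A$2$2 = A$2$2 * (A$1$1 * cnj (A$1$1) + A$1$2 * cnj (A$1$2))"
    by (simp only: a mult_1_right)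
  also have "\<dots> = A$1$2 * (A$2$1 * cnj (A$1$1) + A$2$2 * cnj (A$1$2))
      + cnj (A$1$1) * (A$1$1 * A$2$2 - A$1$2 * A$2$1)"
    by (simp only: algebra_simps)
  finally have e: "A$2$2 = cnj (A$1$1)"
    by (simp only: b d) simp
  have "A = su2_mat (A$1$1, A$1$2)"
    using c e by (simp add: mat2_eq_iff)
  moreover have "(A$1$1, A$1$2) \<in> SU2"
    using a by (simp add: mem_SU2_iff)
  ultimately show "A \<in> su2_mat ` SU2"
    by blast
qed

lemma p1_neq_p2: "p1 \<noteq> p2"
  by (simp add: mat2_eq_iff complex_eq_iff)

lemma independent_p: "independent {p1, p2}"
proof -
  have "p1 \<notin> span {p2}"
    by (auto simp: span_singleton mat2_eq_iff complex_eq_iff)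
  moreover have "p2 \<noteq> 0"
    by (simp add: mat2_eq_iff)
  ultimately show ?thesis
    by (simp add: independent_insert p1_neq_p2)
qed

lemma p_inner_coords:
  "p_inner (a *\<^sub>R p1 + b *\<^sub>R p2) (c *\<^sub>R p1 + d *\<^sub>R p2) = a * c + b * d"
proof -
  have r1: "representation {p1, p2} p1 = (\<lambda>v. if v = p1 then 1 else 0)"
    by (rule representation_basis[OF independent_p]) simp
  have r2: "representation {p1, p2} p2 = (\<lambda>v. if v = p2 then 1 else 0)"
    by (rule representation_basis[OF independent_p]) simp
  have "representation {p1, p2} (x *\<^sub>R p1 + y *\<^sub>R p2) v =
      (if v = p1 then x else 0) + (if v = p2 then y else 0)" for x y v
    by (simp add: representation_add[OF independent_p] representation_scale[OF independent_p]
        span_scale span_base r1 r2)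
  then show ?thesis
    using p1_neq_p2 by (simp add: p_inner_def)
qed

lemma su2_mat_mult:
  "su2_mat g ** su2_mat h =
     su2_mat (fst g * fst h - snd g * cnj (snd h), fst g * snd h + snd g * cnj (fst h))"
  by (simp add: mat2_eq_iff mat2_mult_nth)

lemma matrix_inv_su2_mat:
  assumes "g \<in> SU2"
  shows "matrix_inv (su2_mat g) = su2_mat (cnj (fst g), - snd g)"
proof -
  have "su2_mat g ** su2_mat (cnj (fst g), - snd g) = mat 1"
       "su2_mat (cnj (fst g), - snd g) ** su2_mat g = mat 1"
    using assms by (simp_all add: su2_mat_mult mem_SU2_iff mat2_eq_iff mult.commute)
  note inv = this
  have "su2_mat g ** matrix_inv (su2_mat g) = mat 1 \<and> matrix_inv (su2_mat g) ** su2_mat g = mat 1"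
    unfolding matrix_inv_def by (rule someI) (use inv in blast)
  then show ?thesis
    using inv by (metis matrix_mul_assoc matrix_mul_lid matrix_mul_rid)
qed

lemma p_comb_eq: "x *\<^sub>R p1 + y *\<^sub>R p2 = su2_mat (0, Complex x y / 2)"
  by (simp add: mat2_eq_iff complex_eq_iff)

lemma p_space_eq: "p_space = range (\<lambda>z. su2_mat (0, z))"
proof -
  have "p_space = range (\<lambda>(x, y). x *\<^sub>R p1 + y *\<^sub>R p2)"
  proof (intro equalityI subsetI)
    fix X assume "X \<in> p_space"
    then obtain x y where "X - x *\<^sub>R p1 = y *\<^sub>R p2"
      by (auto simp: p_space_def span_insert span_singleton)
    then have "X = x *\<^sub>R p1 + y *\<^sub>R p2"
      by (simp add: algebra_simps)
    then show "X \<in> range (\<lambda>(x, y). x *\<^sub>R p1 + y *\<^sub>R p2)" by auto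
  qed (auto simp: p_space_def intro: span_add span_scale span_base)
  also have "\<dots> = range (\<lambda>z. su2_mat (0, z))"
  proof (intro equalityI subsetI)
    fix X assume "X \<in> range (\<lambda>z. su2_mat (0, z))"
    then obtain z where "X = su2_mat (0, z)" by blast
    then have "X = (2 * Re z) *\<^sub>R p1 + (2 * Im z) *\<^sub>R p2"
      by (simp add: p_comb_eq complex_eq_iff mat2_eq_iff)
    then show "X \<in> range (\<lambda>(x, y). x *\<^sub>R p1 + y *\<^sub>R p2)" by auto
  qed (auto simp: p_comb_eq)
  finally show ?thesis .
qed

lemma p_inner_su2_mat: "p_inner (su2_mat (0, z)) (su2_mat (0, w)) = 4 * Re (z * cnj w)"
proof -
  have "su2_mat (0, u) = (2 * Re u) *\<^sub>R p1 + (2 * Im u) *\<^sub>R p2" for u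
    by (simp add: p_comb_eq mat2_eq_iff complex_eq_iff)
  then show ?thesis
    by (simp add: p_inner_coords)
qed

lemma matrix_inv_mult_su2_mat:
  assumes "g \<in> SU2"
  shows "matrix_inv (su2_mat g) ** su2_mat v =
    su2_mat (cnj (fst g) * fst v + snd g * cnj (snd v), cnj (fst g) * snd v - snd g * cnj (fst v))"
  by (simp add: matrix_inv_su2_mat[OF assms] su2_mat_mult)

lemma Distr_iff:
  assumes "g \<in> SU2"
  shows "v \<in> Distr g \<longleftrightarrow> cnj (fst g) * fst v + snd g * cnj (snd v) = 0"
proof -
  have inv: "su2_mat g ** matrix_inv (su2_mat g) = mat 1" "matrix_inv (su2_mat g) ** su2_mat g = mat 1"
    using assms by (simp_all add: matrix_inv_su2_mat su2_mat_mult mem_SU2_iff mat2_eq_iff mult.commute)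
  have "su2_mat v = su2_mat g ** X \<longleftrightarrow> matrix_inv (su2_mat g) ** su2_mat v = X" for X
    by (metis inv matrix_mul_assoc matrix_mul_lid)
  then have "v \<in> Distr g \<longleftrightarrow> matrix_inv (su2_mat g) ** su2_mat v \<in> p_space"
    unfolding Distr_def image_iff mem_Collect_eq by simp
  then show ?thesis
    by (auto simp: matrix_inv_mult_su2_mat[OF assms] p_space_eq image_iff su2_mat_eq_iff)
qed

lemma sr_inner_eq:
  assumes "g \<in> SU2" "v \<in> Distr g" "w \<in> Distr g"
  shows "sr_inner g v w = 4 * Re ((cnj (fst g) * snd v - snd g * cnj (fst v)) *
    cnj (cnj (fst g) * snd w - snd g * cnj (fst w)))"
  unfolding sr_inner_def matrix_inv_mult_su2_mat[OF assms(1)]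
    assms(2)[unfolded Distr_iff[OF assms(1)]] assms(3)[unfolded Distr_iff[OF assms(1)]]
  by (rule p_inner_su2_mat)

lemma root_of_unity_cnj:
  assumes "\<omega> powi p = 1" "p \<noteq> 0"
  shows "\<omega> * cnj \<omega> = 1"
proof -
  have "cmod \<omega> powi p = 1"
    using assms(1) by (metis norm_one norm_power_int)
  then have "cmod \<omega> ^ nat \<bar>p\<bar> = 1"
    by (auto simp: power_int_def power_inverse split: if_splits)
  then have "cmod \<omega> = 1"
    using assms(2) power_eq_1_iff[of "cmod \<omega>" "nat \<bar>p\<bar>"]
    by auto
  then show ?thesis
    by (metis complex_norm_square of_real_1 power_one)
qed

lemma root_of_unity_powi_cnj:
  assumes "\<omega> powi p = 1" "p \<noteq> 0"
  shows "\<omega> powi q * cnj (\<omega> powi q) = 1"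
proof -
  have "(\<omega> powi q) powi p = (\<omega> powi p) powi q"
    by (metis power_int_mult mult.commute)
  then show ?thesis
    using assms by (intro root_of_unity_cnj) simp_all
qed

lemma act_in_SU2:
  assumes "\<omega> powi p = 1" "p \<noteq> 0" "g \<in> SU2"
  shows "act q \<omega> g \<in> SU2"
proof -
  note u = root_of_unity_cnj[OF assms(1,2)] root_of_unity_powi_cnj[OF assms(1,2), of q]
  have "fst (act q \<omega> g) * cnj (fst (act q \<omega> g)) + snd (act q \<omega> g) * cnj (snd (act q \<omega> g)) =
    (\<omega> * cnj \<omega>) * (fst g * cnj (fst g)) + (\<omega> powi q * cnj (\<omega> powi q)) * (snd g * cnj (snd g))"
    by (simp add: act_def algebra_simps)
  then show ?thesis
    using assms(3) by (simp only: u mem_SU2_iff mult_1_left)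
qed

lemma act_act: "act q \<omega> (act q \<eta> g) = act q (\<omega> * \<eta>) g"
  by (simp add: act_def power_int_mult_distrib)

lemma act_1 [simp]: "act q 1 g = g"
  by (simp add: act_def)

lemma equiv_lens_rel:
  assumes "p \<noteq> 0"
  shows "equiv SU2 (lens_rel p q)"
proof (rule equivI)
  show "lens_rel p q \<subseteq> SU2 \<times> SU2"
    by (auto simp: lens_rel_def)
  show "refl_on SU2 (lens_rel p q)"
    by (auto simp: refl_on_def lens_rel_def intro!: exI[of _ 1])
  show "sym (lens_rel p q)"
  proof (rule symI)
    fix g h assume "(g, h) \<in> lens_rel p q"
    then obtain \<omega> where w: "g \<in> SU2" "h \<in> SU2" "\<omega> powi p = 1" "h = act q \<omega> g"
      by (auto simp: lens_rel_def)
    have "\<omega> \<noteq> 0" using root_of_unity_cnj[OF w(3) assms] by auto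
    then have "g = act q (inverse \<omega>) h"
      by (simp add: w(4) act_act)
    moreover have "inverse \<omega> powi p = 1"
      using w(3) by (simp add: power_int_inverse)
    ultimately show "(h, g) \<in> lens_rel p q"
      using w by (auto simp: lens_rel_def)
  qed
  show "trans (lens_rel p q)"
  proof (rule transI)
    fix g h l assume "(g, h) \<in> lens_rel p q" "(h, l) \<in> lens_rel p q"
    then obtain \<omega> \<eta> where w: "g \<in> SU2" "l \<in> SU2" "\<omega> powi p = 1" "\<eta> powi p = 1"
        "l = act q \<eta> (act q \<omega> g)"
      by (auto simp: lens_rel_def)
    then have "l = act q (\<eta> * \<omega>) g" "(\<eta> * \<omega>) powi p = 1"
      by (simp_all add: act_act power_int_mult_distrib)
    then show "(g, l) \<in> lens_rel p q"
      using w by (auto simp: lens_rel_def)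
  qed
qed

lemma act_Distr:
  assumes "\<omega> powi p = 1" "p \<noteq> 0" "g \<in> SU2" "v \<in> Distr g"
  shows "act q \<omega> v \<in> Distr (act q \<omega> g)"
proof -
  note u = root_of_unity_cnj[OF assms(1,2)] root_of_unity_powi_cnj[OF assms(1,2), of q]
  have "cnj (fst (act q \<omega> g)) * fst (act q \<omega> v) + snd (act q \<omega> g) * cnj (snd (act q \<omega> v)) =
    (\<omega> * cnj \<omega>) * (cnj (fst g) * fst v) + (\<omega> powi q * cnj (\<omega> powi q)) * (snd g * cnj (snd v))"
    by (simp add: act_def algebra_simps)
  then show ?thesis
    using assms(4) by (simp only: u Distr_iff[OF assms(3)] Distr_iff[OF act_in_SU2[OF assms(1-3)]] mult_1_left)
qed

lemma sr_inner_act: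
  assumes "\<omega> powi p = 1" "p \<noteq> 0" "g \<in> SU2" "v \<in> Distr g" "w \<in> Distr g"
  shows "sr_inner (act q \<omega> g) (act q \<omega> v) (act q \<omega> w) = sr_inner g v w"
proof -
  note u = root_of_unity_cnj[OF assms(1,2)] root_of_unity_powi_cnj[OF assms(1,2), of q]
  define f where "f h x = cnj (fst h) * snd x - snd h * cnj (fst x)" for h x :: "complex \<times> complex"
  have f: "f (act q \<omega> g) (act q \<omega> x) = (cnj \<omega> * \<omega> powi q) * f g x" for x
    by (simp add: f_def act_def algebra_simps)
  have "f (act q \<omega> g) (act q \<omega> v) * cnj (f (act q \<omega> g) (act q \<omega> w)) =
      (\<omega> * cnj \<omega>) * (\<omega> powi q * cnj (\<omega> powi q)) * (f g v * cnj (f g w))"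
    unfolding f by (simp add: algebra_simps)
  also have "\<dots> = f g v * cnj (f g w)"
    by (simp only: u mult_1_left)
  finally show ?thesis
    using assms by (simp add: sr_inner_eq act_in_SU2 act_Distr f_def)
qed

lemma push_act:
  assumes "\<omega> powi p = 1" "p \<noteq> 0"
  shows "push p q (act q \<omega> h) (act q \<omega> v) = push p q h v"
proof -
  have w: "\<omega> \<noteq> 0" using root_of_unity_cnj[OF assms] by auto
  have "\<exists>\<zeta>. act q \<eta> h = act q (\<zeta> * \<omega>) h \<and> act q \<eta> v = act q (\<zeta> * \<omega>) v \<and> \<zeta> powi p = 1"
    if "\<eta> powi p = 1" for \<eta>
    using w assms that
    by (intro exI[of _ "\<eta> / \<omega>"]) (simp add: power_int_divide_distrib)
  moreover have "(\<eta> * \<omega>) powi p = 1" if "\<eta> powi p = 1" for \<eta>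
    using assms that by (simp add: power_int_mult_distrib)
  ultimately show ?thesis
    unfolding push_def act_act by (auto; metis)
qed

lemma act_inj_root:
  assumes "g \<in> SU2" "coprime p q" "\<omega> powi p = 1" "p \<noteq> 0" "act q \<omega> g = g"
  shows "\<omega> = 1"
proof (cases "fst g = 0")
  case False
  then show ?thesis using assms(5) by (auto simp: act_def prod_eq_iff)
next
  case True
  then have "snd g \<noteq> 0" using assms(1) by (auto simp: mem_SU2_iff)
  then have q: "\<omega> powi q = 1" using assms(5) by (auto simp: act_def prod_eq_iff)
  have w: "\<omega> \<noteq> 0" using root_of_unity_cnj[OF assms(3,4)] by auto
  obtain a b where ab: "a * p + b * q = 1"
    using bezout_int[of p q] assms(2) by auto
  have "\<omega> = \<omega> powi (a * p + b * q)" by (simp add: ab)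
  also have "\<dots> = (\<omega> powi p) powi a * (\<omega> powi q) powi b"
    using w by (simp add: power_int_add mult.commute flip: power_int_mult)
  finally show ?thesis by (simp add: assms(3) q)
qed

lemma lens_inner_push:
  assumes "p \<noteq> 0" "coprime p q" "h \<in> SU2" "v \<in> Distr h" "w \<in> Distr h"
  shows "lens_inner p q (push p q h v) (push p q h w) = sr_inner h v w"
  unfolding lens_inner_def
proof (rule the_equality)
  fix r
  assume "\<exists>h' v' w'. h' \<in> SU2 \<and> v' \<in> Distr h' \<and> w' \<in> Distr h' \<and>
     push p q h v = push p q h' v' \<and> push p q h w = push p q h' w' \<and> r = sr_inner h' v' w'"
  then obtain h' v' w' where *: "h' \<in> SU2" "push p q h v = push p q h' v'"
      "push p q h w = push p q h' w'" "r = sr_inner h' v' w'"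
    by blast
  have "(h', v') \<in> push p q h v" "(h', w') \<in> push p q h w"
    unfolding * by (auto simp: push_def intro!: exI[of _ 1])
  then obtain \<omega> \<eta> where r: "\<omega> powi p = 1" "\<eta> powi p = 1" "h' = act q \<omega> h" "v' = act q \<omega> v"
      "h' = act q \<eta> h" "w' = act q \<eta> w"
    by (auto simp: push_def)
  have nz: "\<omega> \<noteq> 0" "\<eta> \<noteq> 0"
    using root_of_unity_cnj[OF r(1) assms(1)] root_of_unity_cnj[OF r(2) assms(1)] by auto
  have "act q (inverse \<eta> * \<omega>) h = act q (inverse \<eta>) (act q \<eta> h)"
    using r(3,5) by (simp flip: act_act)
  also have "\<dots> = h"
    using nz by (simp add: act_act)
  finally have fixed: "act q (inverse \<eta> * \<omega>) h = h" .
  have "(inverse \<eta> * \<omega>) powi p = 1"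
    by (simp only: power_int_mult_distrib power_int_inverse r(1,2)) simp
  then have "inverse \<eta> * \<omega> = 1"
    by (rule act_inj_root[OF assms(3,2) _ assms(1) fixed])
  then have "\<omega> = \<eta>"
    using nz by (simp add: field_simps)
  then show "r = sr_inner h v w"
    unfolding *(4) r(3,4,6) by (simp only: sr_inner_act[OF r(2) assms(1,3-5)])
qed (use assms in blast)

lemma openin_lens_topology:
  "openin (lens_topology p q) U \<longleftrightarrow>
     U \<subseteq> lens p q \<and> openin (top_of_set SU2) {g \<in> SU2. proj p q g \<in> U}"
proof -
  have "istopology (\<lambda>U. U \<subseteq> lens p q \<and> openin (top_of_set SU2) {g \<in> SU2. proj p q g \<in> U})"
    unfolding istopology_def
  proof (intro conjI allI impI; (elim conjE)?)
    fix S T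
    assume "openin (top_of_set SU2) {g \<in> SU2. proj p q g \<in> S}"
      "openin (top_of_set SU2) {g \<in> SU2. proj p q g \<in> T}"
    then have "openin (top_of_set SU2) ({g \<in> SU2. proj p q g \<in> S} \<inter> {g \<in> SU2. proj p q g \<in> T})"
      by (rule openin_Int)
    then show "openin (top_of_set SU2) {g \<in> SU2. proj p q g \<in> S \<inter> T}"
      by (rule back_subst) blast
  next
    fix \<K>
    assume "\<forall>K\<in>\<K>. K \<subseteq> lens p q \<and> openin (top_of_set SU2) {g \<in> SU2. proj p q g \<in> K}"
    then have "openin (top_of_set SU2) (\<Union>K\<in>\<K>. {g \<in> SU2. proj p q g \<in> K})"
      by (intro openin_Union) auto
    then show "openin (top_of_set SU2) {g \<in> SU2. proj p q g \<in> \<Union>\<K>}"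
      by (rule back_subst) blast
  qed blast+
  then show ?thesis
    by (simp add: lens_topology_def topology_inverse')
qed

end

(*
Let g be a horizontal curve in SU(2) from the identity to (\<alpha>, \<beta>), of length 2 b. Twisting it by
one-parameter subgroups, g cis (a s k), where s runs from 0 to 1 proportionally to arclength, gives a
curve of length sqrt (a^2 + b^2) on the unit 3-sphere, so that Re (\<alpha> cis a) \<ge> cos (sqrt (a^2 + b^2))
whenever a^2 + b^2 \<le> pi^2. For a = c t / 2 this is an equality along Exp (\<theta>, c, t), because the
twisted curve is a great circle; hence these geodesics are optimal as long as the great circle
arc is not longer than pi. Every point is reached by such a geodesic (intermediate value theorem), and for fixed
|\<alpha>| the certificates a show that the distance strictly increases with |arg \<alpha>|. So the distance in
L(p,q) is attained exactly at the representatives with largest Re \<alpha>, and equality in the inequality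
determines c from \<alpha>. A point other than [Id] is therefore a cut point iff either \<beta> = 0 (\<theta> is free), or two
representatives have the same largest Re \<alpha>, which means \<alpha> = 0 or arg \<alpha> = \<plusminus> pi / p.
*)

theory Submission
  imports Defs
begin

section \<open>Explicit geodesics\<close>

text \<open>The factor in "length 2 b" comes from the normalisation of the metric: p1 and p2 are
  unit vectors, but have norm 1/2 in C^2. The curve inequality is only available for horizontal
  curves strictly shorter than 2 b, and their speed is merely measurable; this is why approximations
  and limits accompany it. Let n = |p|. Roots of unity turn arg \<alpha> by multiples of 2 pi / n,
  so a tie for the largest Re \<alpha> means \<alpha>^n = -|\<alpha>|^n. This equation covers
  \<alpha> = 0 as well and is invariant under the action, so cut points can be recognised at any
  representative in SU(2). The two parts of the cut locus overlap, namely where \<beta> = 0 and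
  \<alpha>^n = -1, and the sheets arg \<alpha> = const in the preimage of the symmetric part all
  meet along the circle \<alpha> = 0. Hence four strata for n at least 2: the open sheets, the
  circle \<alpha> = 0, the overlap, and the rest of the local part. For n = 1 no tie is possible:
  the symmetric part is empty and the local part is a single stratum.\<close>

lemma mat_exp_su2_mat:
  fixes y :: real and z :: complex
  defines "s \<equiv> sqrt (y\<^sup>2 + (cmod z)\<^sup>2)"
  shows "mat_exp (su2_mat (\<i> * of_real y, z)) =
    su2_mat (of_real (cos s) + \<i> * of_real (y * (sin s / s)), of_real (sin s / s) * z)"
proof -
  let ?A = "su2_mat (\<i> * of_real y, z)"
  let ?f = "\<lambda>n. (cos_coeff n * s ^ n) *\<^sub>R mat 1 + (sin_coeff n * s ^ n / s) *\<^sub>R ?A"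
  have s2: "s\<^sup>2 = y\<^sup>2 + (cmod z)\<^sup>2"
    unfolding s_def by simp
  \<comment> \<open>At \<open>s = 0\<close> the quotient \<open>sin s / s\<close> is 0 instead of 1;
    this is harmless because it only multiplies entries of \<open>?A = 0\<close>.\<close>
  have A0: "?A = 0" if "s = 0"
    using that s2 by (simp add: mat2_eq_iff sum_power2_eq_zero_iff)
  \<comment> \<open>As \<open>?A\<close> squares to a negative scalar, its even and odd powers give
    the cosine and the sine series.\<close>
  have A2: "?A ** ?A = - (s\<^sup>2) *\<^sub>R mat 1"
    unfolding s2
    by (simp add: mat2_eq_iff mat2_mult_nth complex_eq_iff cmod_power2)
       (simp add: power2_eq_square algebra_simps)
  have pow: "((**) ?A ^^ n) (mat 1) = fact n *\<^sub>R ?f n" for n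
  proof (induction n)
    case 0
    then show ?case by (simp add: mat2_eq_iff)
  next
    case (Suc n)
    have c: "fact (Suc n) * (cos_coeff (Suc n) * s ^ Suc n) = - (fact n * sin_coeff n * s ^ n / s) * s\<^sup>2"
      by (simp add: cos_coeff_Suc power2_eq_square field_simps)
    have d: "(fact (Suc n) * (sin_coeff (Suc n) * s ^ Suc n / s)) *\<^sub>R ?A = (fact n * cos_coeff n * s ^ n) *\<^sub>R ?A"
    proof (cases "s = 0")
      case False
      then have "fact (Suc n) * (sin_coeff (Suc n) * s ^ Suc n / s) = fact n * cos_coeff n * s ^ n"
        by (simp add: sin_coeff_Suc)
      then show ?thesis by simp
    qed (use A0 in simp)
    have lin: "A ** (x *\<^sub>R (u *\<^sub>R mat 1 + v *\<^sub>R A)) = (x * u) *\<^sub>R A + (x * v) *\<^sub>R (A ** A)"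
      for A :: "complex^2^2" and x u v :: real
      by (simp add: mat2_eq_iff mat2_mult_nth scaleR_conv_of_real[where 'a=complex] algebra_simps)
    have "((**) ?A ^^ Suc n) (mat 1) = ?A ** (fact n *\<^sub>R ?f n)"
      by (simp only: funpow.simps comp_def Suc.IH)
    also have "\<dots> = (fact n * cos_coeff n * s ^ n) *\<^sub>R ?A + (fact n * sin_coeff n * s ^ n / s) *\<^sub>R (?A ** ?A)"
      unfolding lin by (simp add: mult.assoc)
    also have "\<dots> = fact (Suc n) *\<^sub>R ?f (Suc n)"
      unfolding A2 scaleR_add_right scaleR_scaleR c d by (simp add: add.commute)
    finally show ?case .
  qed
  have "(\<lambda>n. cos_coeff n * s ^ n) sums cos s" "(\<lambda>n. sin_coeff n * s ^ n) sums sin s"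
    using cos_converges[of s] sin_converges[of s] by simp_all
  then have "?f sums (cos s *\<^sub>R mat 1 + (sin s / s) *\<^sub>R ?A)"
    by (intro sums_add sums_scaleR_left sums_divide)
  then have "mat_exp ?A = cos s *\<^sub>R mat 1 + (sin s / s) *\<^sub>R ?A"
    unfolding mat_exp_def pow by (simp add: sums_iff)
  then show ?thesis
    by (simp add: mat2_eq_iff scaleR_conv_of_real[where 'a=complex])
qed

lemma mat_exp_kk: "mat_exp (x *\<^sub>R kk) = su2_mat (cis (x / 2), 0)"
proof -
  have "x *\<^sub>R kk = su2_mat (\<i> * of_real (x / 2), 0)"
    by (simp add: mat2_eq_iff scaleR_conv_of_real[where 'a=complex])
  then have "mat_exp (x *\<^sub>R kk) = su2_mat (of_real (cos \<bar>x / 2\<bar>) + \<i> * of_real (x / 2 * (sin \<bar>x / 2\<bar> / \<bar>x / 2\<bar>)), 0)"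
    using mat_exp_su2_mat[of "x / 2" 0] by simp
  also have "\<dots> = su2_mat (cis (x / 2), 0)"
    by (simp add: su2_mat_eq_iff complex_eq_iff abs_if)
  finally show ?thesis .
qed

text \<open>The first exponential is a great circle with real part \<open>cos (w * t / 2)\<close>;
  the second one twists it by \<open>cis (- (c * t / 2))\<close>. With frame angle c t / 2 and
  half-length t / 2 the arc is w t / 2 = sqrt ((c t / 2)^2 + (t / 2)^2), which is the equality case
  of the curve inequality.\<close>

lemma Exp_su2_eq:
  fixes \<theta> c t :: real
  defines "w \<equiv> sqrt (1 + c\<^sup>2)"
  shows "Exp_su2 \<theta> c t =
    (cis (- (c * t / 2)) * Complex (cos (w * t / 2)) (c / w * sin (w * t / 2)),
     cis (\<theta> + c * t / 2) * of_real (sin (w * t / 2) / w))"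
proof -
  have w: "w > 0" unfolding w_def by (simp add: add_pos_nonneg)
  let ?s = "sqrt ((c * t / 2)\<^sup>2 + (cmod (of_real (t / 2) * cis \<theta>))\<^sup>2)"
  have "(w * t / 2)\<^sup>2 = (c * t / 2)\<^sup>2 + (cmod (of_real (t / 2) * cis \<theta>))\<^sup>2"
    unfolding w_def by (simp add: power_mult_distrib norm_mult power_divide algebra_simps)
  then have s: "?s = \<bar>w * t / 2\<bar>"
    by (metis real_sqrt_abs)
  \<comment> \<open>The square root only yields the absolute value of \<open>w * t / 2\<close>;
    since cos and sin x / x are even, this does not matter.\<close>
  have sincs: "sin \<bar>x\<bar> / \<bar>x\<bar> = sin x / x" for x :: real by (simp add: abs_if)
  have "t *\<^sub>R (cos \<theta> *\<^sub>R p1 + sin \<theta> *\<^sub>R p2 + c *\<^sub>R kk) =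
      su2_mat (\<i> * of_real (c * t / 2), of_real (t / 2) * cis \<theta>)"
    by (simp add: mat2_eq_iff scaleR_conv_of_real[where 'a=complex] complex_eq_iff algebra_simps)
  then have "mat_exp (t *\<^sub>R (cos \<theta> *\<^sub>R p1 + sin \<theta> *\<^sub>R p2 + c *\<^sub>R kk)) =
      su2_mat (of_real (cos (w * t / 2)) + \<i> * of_real (c * t / 2 * (sin (w * t / 2) / (w * t / 2))),
         of_real (sin (w * t / 2) / (w * t / 2)) * (of_real (t / 2) * cis \<theta>))"
    by (simp only: mat_exp_su2_mat s sincs cos_abs_real)
  also have "\<dots> = su2_mat (Complex (cos (w * t / 2)) (c / w * sin (w * t / 2)), of_real (sin (w * t / 2) / w) * cis \<theta>)"
    using w by (cases "t = 0") (simp_all add: su2_mat_eq_iff complex_eq_iff)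
  finally have 1: "mat_exp (t *\<^sub>R (cos \<theta> *\<^sub>R p1 + sin \<theta> *\<^sub>R p2 + c *\<^sub>R kk)) = \<dots>" .
  have 2: "mat_exp (- ((c * t) *\<^sub>R kk)) = su2_mat (cis (- (c * t / 2)), 0)"
    using mat_exp_kk[of "- (c * t)"] by simp
  show ?thesis
    unfolding Exp_su2_def 1 2 su2_mat_mult su2_coords_su2_mat
    by (simp add: cis_cnj cis_mult mult.commute mult.left_commute)
qed

lemma exp_k_eq: "exp_k = {(\<alpha>, 0) | \<alpha>. cmod \<alpha> = 1}"
proof -
  have "exp_k = range (\<lambda>x. (cis (x / 2), 0))"
    by (auto simp: exp_k_def k_space_def span_singleton image_image mat_exp_kk)
  also have "\<dots> = {(\<alpha>, 0) | \<alpha>. cmod \<alpha> = 1}"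
  proof safe
    fix \<alpha> :: complex assume "cmod \<alpha> = 1"
    then have "\<alpha> = cis (2 * Arg \<alpha> / 2)"
      using cis_Arg[of \<alpha>] by (cases "\<alpha> = 0") (simp_all add: sgn_eq)
    then show "(\<alpha>, 0) \<in> range (\<lambda>x. (cis (x / 2), 0))" by blast
  qed simp
  finally show ?thesis .
qed

lemma Exp_su2_in_SU2: "Exp_su2 \<theta> c t \<in> SU2"
proof -
  define w where "w = sqrt (1 + c\<^sup>2)"
  have w: "w > 0" "w\<^sup>2 = 1 + c\<^sup>2" unfolding w_def by (simp_all add: add_pos_nonneg)
  have "(cos x)\<^sup>2 + (c / w * sin x)\<^sup>2 + (sin x / w)\<^sup>2 = 1" for x
  proof -
    have "(c / w * sin x)\<^sup>2 + (sin x / w)\<^sup>2 = (sin x)\<^sup>2 * ((1 + c\<^sup>2) / w\<^sup>2)"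
      using w(1) by (simp add: power_mult_distrib power_divide field_simps)
    also have "(1 + c\<^sup>2) / w\<^sup>2 = 1"
      using w by (metis divide_self less_irrefl zero_less_power)
    finally show ?thesis by (simp add: add.assoc)
  qed
  from this[of "w * t / 2"] show ?thesis
    unfolding Exp_su2_eq SU2_def w_def[symmetric]
    by (simp add: norm_mult power_mult_distrib complex_norm power_divide norm_divide)
qed

text \<open>The velocity is the left translate of the element of p with coordinate
  \<open>cis (\<theta> + c * s) / 2\<close>: a control of constant norm that rotates at rate
  \<open>c\<close>.\<close>

lemma Exp_su2_has_vector_derivative:
  "(Exp_su2 \<theta> c has_vector_derivative
      (- snd (Exp_su2 \<theta> c s) * cnj (cis (\<theta> + c * s) / 2), fst (Exp_su2 \<theta> c s) * (cis (\<theta> + c * s) / 2)))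
    (at s within S)"
proof -
  define w where "w = sqrt (1 + c\<^sup>2)"
  have w: "w > 0" "w\<^sup>2 = 1 + c\<^sup>2" unfolding w_def by (simp_all add: add_pos_nonneg)
  define W :: complex where "W = of_real w"
  have "W * W = of_real (w\<^sup>2)" by (simp add: W_def power2_eq_square)
  then have W: "W \<noteq> 0" "W * W = 1 + of_real c * of_real c"
    using w(1) unfolding w(2) by (simp_all add: W_def power2_eq_square)
  \<comment> \<open>Both components extend to entire functions of complex time, so they can be
    differentiated by the rules for field derivatives and then restricted to the real line.\<close>
  define f where "f z = exp (- (\<i> * of_real c / 2) * z) * (cos (W / 2 * z) + \<i> * (of_real c / W) * sin (W / 2 * z))" for z
  define h where "h z = exp (\<i> * of_real \<theta> + (\<i> * of_real c / 2) * z) * (sin (W / 2 * z) / W)" for z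
  have Ws: "W / 2 * of_real s = of_real (w * s / 2)" for s by (simp add: W_def)
  have Cx: "Complex a b = of_real a + \<i> * of_real b" for a b by (simp add: complex_eq_iff)
  have "exp (- (\<i> * of_real c / 2) * of_real s) = cis (- (c * s / 2))"
      "exp (\<i> * of_real \<theta> + (\<i> * of_real c / 2) * of_real s) = cis (\<theta> + c * s / 2)" for s
    unfolding cis_conv_exp by (simp_all add: distrib_left mult.assoc)
  note ex = this
  have fe: "f (of_real s) = fst (Exp_su2 \<theta> c s)" for s
    unfolding Exp_su2_eq w_def[symmetric] fst_conv f_def Ws ex Cx cos_of_real sin_of_real
    by (simp add: W_def)
  have he: "h (of_real s) = snd (Exp_su2 \<theta> c s)" for s
    unfolding Exp_su2_eq w_def[symmetric] snd_conv h_def Ws ex sin_of_real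
    by (simp add: W_def)
  let ?x = "complex_of_real s"
  have z: "cnj (cis (\<theta> + c * s)) = exp (- (\<i> * of_real \<theta>) - \<i> * of_real c * ?x)"
      "cis (\<theta> + c * s) = exp (\<i> * of_real \<theta> + \<i> * of_real c * ?x)"
    unfolding cis_cnj unfolding cis_conv_exp by (simp_all add: algebra_simps)
  have fd: "(f has_field_derivative - h ?x * (cnj (cis (\<theta> + c * s)) / 2)) (at ?x)"
  proof -
    let ?C = "cos (W / 2 * ?x)" and ?S = "sin (W / 2 * ?x)" and ?E = "exp (- (\<i> * of_real c / 2) * ?x)"
    have "- h ?x * (cnj (cis (\<theta> + c * s)) / 2) = - (?E * (?S / W) / 2)"
    proof -
      have "exp (\<i> * of_real \<theta> + (\<i> * of_real c / 2) * ?x) * cnj (cis (\<theta> + c * s)) = ?E"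
        unfolding z(1) exp_add[symmetric] by (rule arg_cong[of _ _ exp]) (simp add: field_simps)
      moreover have "- (X * (?S / W)) * (Y / 2) = - ((X * Y) * (?S / W) / 2)" for X Y by simp
      ultimately show ?thesis unfolding h_def by (simp only:)
    qed
    also have "\<dots> = ?E * (- (\<i> * of_real c / 2)) * (?C + \<i> * (of_real c / W) * ?S)
        + ?E * (- ?S * (W / 2) + \<i> * (of_real c / W) * (?C * (W / 2)))"
    proof -
      \<comment> \<open>\<open>W * W = 1 + c * c\<close> replaces the coefficient -1 by c^2 - W^2,
        the form in which it arises from the product rule.\<close>
      have "- (?S / W) / 2 = ?S * (of_real c * of_real c - W * W) / (2 * W)" by (simp add: W(2))
      also have "\<dots> = (- (\<i> * of_real c / 2)) * (?C + \<i> * (of_real c / W) * ?S)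
        + (- ?S * (W / 2) + \<i> * (of_real c / W) * (?C * (W / 2)))"
        using W(1) by (simp add: field_simps)
      finally have eq: "- (?S / W) / 2 = \<dots>" .
      have "- (E * (A / W) / 2) = E * P * Q + E * R" if "- (A / W) / 2 = P * Q + R" for E A P Q R :: complex
      proof -
        have "- (E * (A / W) / 2) = E * (- (A / W) / 2)" by simp
        then show ?thesis unfolding that by (simp only: distrib_left mult.assoc)
      qed
      from this[OF eq] show ?thesis .
    qed
    finally have eq: "- h ?x * (cnj (cis (\<theta> + c * s)) / 2) = \<dots>" .
    show ?thesis
      unfolding eq unfolding f_def by (rule derivative_eq_intros refl | simp)+
  qed
  have hd: "(h has_field_derivative f ?x * (cis (\<theta> + c * s) / 2)) (at ?x)"
  proof -
    let ?C = "cos (W / 2 * ?x)" and ?S = "sin (W / 2 * ?x)" and ?E = "exp (\<i> * of_real \<theta> + (\<i> * of_real c / 2) * ?x)"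
    have "f ?x * (cis (\<theta> + c * s) / 2) = ?E * (?C + \<i> * (of_real c / W) * ?S) / 2"
    proof -
      have "exp (- (\<i> * of_real c / 2) * ?x) * cis (\<theta> + c * s) = ?E"
        unfolding z(2) exp_add[symmetric] by (rule arg_cong[of _ _ exp]) (simp add: field_simps)
      moreover have "(X * Z) * (Y / 2) = (X * Y) * Z / 2" for X Y Z :: complex by simp
      ultimately show ?thesis unfolding f_def by (simp only:)
    qed
    then show ?thesis
      unfolding h_def using W(1) by (auto intro!: derivative_eq_intros simp: field_simps)
  qed
  have "((\<lambda>s. (f (of_real s), h (of_real s))) has_vector_derivative
      (- h ?x * (cnj (cis (\<theta> + c * s)) / 2), f ?x * (cis (\<theta> + c * s) / 2))) (at s within S)"
    by (intro has_vector_derivative_Pair has_vector_derivative_real_field fd hd)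
  then show ?thesis by (simp add: fe he)
qed

text \<open>The vector is the left translate of (0, z), and left translation by a unit element is an
  isometry.\<close>

lemma Exp_su2_deriv_Distr:
  assumes "g \<in> SU2"
  shows "(- snd g * cnj z, fst g * z) \<in> Distr g"
    and "norm (- snd g * cnj z, fst g * z) = cmod z"
proof -
  show "(- snd g * cnj z, fst g * z) \<in> Distr g"
    unfolding Distr_iff[OF assms] by (simp add: algebra_simps)
  have "(norm (- snd g * cnj z, fst g * z))\<^sup>2 = ((cmod (fst g))\<^sup>2 + (cmod (snd g))\<^sup>2) * (cmod z)\<^sup>2"
    by (simp add: norm_Pair norm_mult power_mult_distrib algebra_simps)
  also have "\<dots> = (cmod z)\<^sup>2" using assms by (simp add: SU2_def case_prod_beta)
  finally show "norm (- snd g * cnj z, fst g * z) = cmod z" by simp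
qed

lemma Exp_su2_cong: "cis \<theta>\<^sub>1 = cis \<theta>\<^sub>2 \<Longrightarrow> Exp_su2 \<theta>\<^sub>1 c t = Exp_su2 \<theta>\<^sub>2 c t"
  by (simp add: Exp_su2_eq flip: cis_mult)

section \<open>Horizontal curves in SU(2)\<close>

text \<open>Forward difference quotients are bounded by the Lipschitz constant and converge to the
  derivative almost everywhere, while their integrals telescope; dominated convergence gives the
  first claim. The second one keeps the quotients as continuous approximations of the
  derivative.\<close>

lemma lipschitz_on_ftc_ae:
  fixes F :: "real \<Rightarrow> 'a::euclidean_space"
  assumes T: "T > 0" and lip: "C-lipschitz_on {0..T} F" and N: "negligible N"
    and D: "\<And>t. t \<in> {0..T} - N \<Longrightarrow> (F has_vector_derivative F' t) (at t within {0..T})"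
  shows "(F' has_integral (F T - F 0)) {0..T}"
    and "\<exists>\<psi> :: nat \<Rightarrow> real \<Rightarrow> 'a. (\<forall>n. continuous_on UNIV (\<psi> n)) \<and> (\<forall>n t. norm (\<psi> n t) \<le> C) \<and>
      (\<forall>t\<in>{0..T} - insert T N. (\<lambda>n. \<psi> n t) \<longlonglongrightarrow> F' t)"
proof -
  \<comment> \<open>Extending \<open>F\<close> by constants makes the quotients defined on the whole
    line, with the same Lipschitz constant.\<close>
  define G where "G t = F (max 0 (min T t))" for t
  have GF: "G t = F t" if "t \<in> {0..T}" for t using that by (simp add: G_def)
  have Glip: "norm (G t - G s) \<le> C * \<bar>t - s\<bar>" for t s
  proof -
    have "norm (G t - G s) \<le> C * \<bar>max 0 (min T t) - max 0 (min T s)\<bar>"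
      unfolding G_def using lipschitz_onD[OF lip, of "max 0 (min T t)" "max 0 (min T s)"] T
      by (simp add: dist_norm)
    also have "\<dots> \<le> C * \<bar>t - s\<bar>"
      by (rule mult_left_mono) (use lipschitz_on_nonneg[OF lip] in auto)
    finally show ?thesis .
  qed
  then have "C-lipschitz_on UNIV G"
    using lipschitz_on_nonneg[OF lip] by (auto intro!: lipschitz_onI simp: dist_norm)
  then have Gcont: "continuous_on S G" for S
    by (meson continuous_on_subset lipschitz_on_continuous_on subset_UNIV)
  define h where "h n = inverse (real (Suc n))" for n
  have h: "h n > 0" for n by (simp add: h_def)
  have h0: "h \<longlonglongrightarrow> 0" unfolding h_def using LIMSEQ_inverse_real_of_nat by simp
  define \<psi> where "\<psi> n t = (1 / h n) *\<^sub>R (G (t + h n) - G t)" for n t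
  have cont: "continuous_on S (\<psi> n)" for n S
    unfolding \<psi>_def by (intro continuous_intros continuous_on_compose2[OF Gcont]) auto
  have bd: "norm (\<psi> n t) \<le> C" for n t
    using Glip[of "t + h n" t] h[of n] by (simp add: \<psi>_def divide_le_eq del: scaleR_right_diff_distrib)
  \<comment> \<open>The point \<open>T\<close> is excluded because the forward quotients of the
    constant extension vanish there.\<close>
  have lim: "(\<lambda>n. \<psi> n t) \<longlonglongrightarrow> F' t" if t: "t \<in> {0..T} - insert T N" for t
  proof -
    have tT: "0 \<le> t" "t < T" using t by auto
    have d: "((\<lambda>y. (1 / norm (y - t)) *\<^sub>R (F y - (F t + (y - t) *\<^sub>R F' t))) \<longlongrightarrow> 0) (at t within {0..T})"
      using D[of t] t by (auto simp: has_vector_derivative_def has_derivative_within)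
    have ev: "\<forall>\<^sub>F n in sequentially. h n < T - t"
      using order_tendstoD(2)[OF h0, of "T - t"] tT by simp
    have "filterlim (\<lambda>n. t + h n) (at t within {0..T}) sequentially"
      unfolding filterlim_at
    proof
      show "(\<lambda>n. t + h n) \<longlonglongrightarrow> t" using tendsto_add[OF tendsto_const h0, of t] by simp
      show "\<forall>\<^sub>F n in sequentially. t + h n \<in> {0..T} \<and> t + h n \<noteq> t"
        using ev
      proof eventually_elim
        case (elim n)
        then show ?case using tT h[of n] by simp
      qed
    qed
    from filterlim_compose[OF d this]
    have "(\<lambda>n. (1 / h n) *\<^sub>R (F (t + h n) - (F t + h n *\<^sub>R F' t))) \<longlonglongrightarrow> 0"
      using h by (simp add: less_imp_le)
    moreover have "\<forall>\<^sub>F n in sequentially. (1 / h n) *\<^sub>R (F (t + h n) - (F t + h n *\<^sub>R F' t)) = \<psi> n t - F' t"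
      using ev
    proof eventually_elim
      case (elim n)
      then have "G (t + h n) = F (t + h n)" "G t = F t"
        using tT h[of n] by (auto intro!: GF)
      then show ?case using h[of n] by (simp add: \<psi>_def algebra_simps)
    qed
    ultimately have "(\<lambda>n. \<psi> n t - F' t) \<longlonglongrightarrow> 0"
      by (rule Lim_transform_eventually)
    then show ?thesis by (simp add: LIM_zero_iff)
  qed
  show "\<exists>\<psi> :: nat \<Rightarrow> real \<Rightarrow> 'a. (\<forall>n. continuous_on UNIV (\<psi> n)) \<and> (\<forall>n t. norm (\<psi> n t) \<le> C) \<and>
      (\<forall>t\<in>{0..T} - insert T N. (\<lambda>n. \<psi> n t) \<longlonglongrightarrow> F' t)"
    using cont bd lim by blast
  have Gint: "G integrable_on {a..b}" for a b
    by (rule integrable_continuous_interval[OF Gcont])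
  \<comment> \<open>Shifting the variable leaves the mean of \<open>G\<close> over [T, T + h], which
    is exactly \<open>F T\<close>, minus its mean over [0, h].\<close>
  have int: "integral {0..T} (\<psi> n) = F T - (1 / h n) *\<^sub>R integral {0..h n} G" for n
  proof -
    have "((\<lambda>t. G (t + h n)) has_integral integral {h n..T + h n} G) {0..T}"
      using has_integral_shift_real_ivl[OF integrable_integral[OF Gint], of "h n" "h n" "T + h n"] by simp
    then have "integral {0..T} (\<psi> n) = (1 / h n) *\<^sub>R (integral {h n..T + h n} G - integral {0..T} G)"
      unfolding \<psi>_def
      by (intro integral_unique has_integral_cmul has_integral_diff integrable_integral Gint)
    also have "integral {h n..T + h n} G - integral {0..T} G = integral {T..T + h n} G - integral {0..h n} G"
      using Henstock_Kurzweil_Integration.integral_combine[of 0 T "T + h n" G]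
        Henstock_Kurzweil_Integration.integral_combine[of 0 "h n" "T + h n" G] Gint h[of n] T
      by (simp add: algebra_simps)
    also have "integral {T..T + h n} G = integral {T..T + h n} (\<lambda>_. F T)"
      by (rule integral_cong) (use T in \<open>auto simp: G_def max_def min_def\<close>)
    also have "\<dots> = h n *\<^sub>R F T"
      using h[of n] by simp
    finally show ?thesis using h[of n] by (simp add: algebra_simps)
  qed
  have intlim: "(\<lambda>n. integral {0..T} (\<psi> n)) \<longlonglongrightarrow> F T - F 0"
  proof -
    have "norm ((1 / h n) *\<^sub>R integral {0..h n} G - F 0) \<le> C * h n" for n
    proof -
      have "continuous_on {0..h n} (\<lambda>t. G t - F 0)"
        by (intro continuous_intros Gcont)
      moreover have "norm (G t - F 0) \<le> C * h n" if "t \<in> {0..h n}" for t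
      proof -
        have "norm (G t - G 0) \<le> C * h n"
          using order_trans[OF Glip[of t 0] mult_left_mono[OF _ lipschitz_on_nonneg[OF lip]], of "h n"] that by simp
        then show ?thesis using T by (simp add: GF)
      qed
      ultimately have "norm (integral {0..h n} (\<lambda>t. G t - F 0)) \<le> (C * h n) * (h n - 0)"
        using h[of n] by (intro integral_bound) auto
      also have "integral {0..h n} (\<lambda>t. G t - F 0) = integral {0..h n} G - h n *\<^sub>R F 0"
        using h[of n] by (subst integral_diff) (auto intro: Gint)
      also have "\<dots> = h n *\<^sub>R ((1 / h n) *\<^sub>R integral {0..h n} G - F 0)"
        using h[of n] by (simp add: algebra_simps)
      finally show ?thesis using h[of n] by (simp add: power2_eq_square mult.commute)
    qed
    then have "\<forall>\<^sub>F n in sequentially. norm ((1 / h n) *\<^sub>R integral {0..h n} G - F 0) \<le> C * h n"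
      by (simp add: always_eventually)
    then have "(\<lambda>n. (1 / h n) *\<^sub>R integral {0..h n} G - F 0) \<longlonglongrightarrow> 0"
      by (rule Lim_null_comparison[OF _ tendsto_mult_right_zero[OF h0]])
    then have "(\<lambda>n. (1 / h n) *\<^sub>R integral {0..h n} G) \<longlonglongrightarrow> F 0"
      by (simp add: LIM_zero_iff)
    then show ?thesis unfolding int by (intro tendsto_intros)
  qed
  define M where "M = insert T N"
  have M: "negligible M" unfolding M_def using N by simp
  have "((\<lambda>t. if t \<in> M then 0 else F' t) has_integral (F T - F 0)) {0..T}"
  proof (rule has_integral_dominated_convergence[where f = "\<lambda>n t. if t \<in> M then 0 else \<psi> n t"
        and h = "\<lambda>_. C" and y = "\<lambda>n. integral {0..T} (\<psi> n)"])
    show "((\<lambda>t. if t \<in> M then 0 else \<psi> n t) has_integral integral {0..T} (\<psi> n)) {0..T}" for n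
      by (rule has_integral_spike[OF M _ integrable_integral[OF integrable_continuous_interval[OF cont]]]) auto
  qed (use bd lim lipschitz_on_nonneg[OF lip] intlim in \<open>auto simp: M_def\<close>)
  then show "(F' has_integral (F T - F 0)) {0..T}"
    by (rule has_integral_spike[OF M, rotated]) auto
qed

text \<open>The norms of the difference quotients are continuous, bounded and converge almost
  everywhere to the speed, so dominated convergence yields integrability and approximation in L1.
  The approximations later drive the rotating frame, whose angle must be differentiable
  everywhere.\<close>

lemma norm_deriv_integrable:
  fixes g :: "real \<Rightarrow> 'a::euclidean_space"
  assumes T: "T > 0" and lip: "C-lipschitz_on {0..T} g" and N: "negligible N"
    and D: "\<And>t. t \<in> {0..T} - N \<Longrightarrow> (g has_vector_derivative g' t) (at t within {0..T})"
  shows "(\<lambda>t. norm (g' t)) integrable_on {0..T}"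
    and "\<exists>\<psi> :: nat \<Rightarrow> real \<Rightarrow> real. (\<forall>n. continuous_on UNIV (\<psi> n)) \<and> (\<forall>n t. 0 \<le> \<psi> n t \<and> \<psi> n t \<le> C) \<and>
      (\<lambda>n. integral {0..T} (\<lambda>t. \<bar>\<psi> n t - norm (g' t)\<bar>)) \<longlonglongrightarrow> 0 \<and>
      (\<forall>n. (\<lambda>t. \<bar>\<psi> n t - norm (g' t)\<bar>) integrable_on {0..T})"
proof -
  obtain q :: "nat \<Rightarrow> real \<Rightarrow> 'a" where q: "\<And>n. continuous_on UNIV (q n)" "\<And>n t. norm (q n t) \<le> C"
    "\<And>t. t \<in> {0..T} - insert T N \<Longrightarrow> (\<lambda>n. q n t) \<longlonglongrightarrow> g' t"
    using lipschitz_on_ftc_ae(2)[OF assms] by blast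
  define M where "M = insert T N"
  have M: "negligible M" unfolding M_def using N by simp
  let ?\<psi> = "\<lambda>n t. norm (q n t)"
  have qint: "?\<psi> n integrable_on {0..T}" for n
    by (intro integrable_continuous_interval continuous_intros continuous_on_subset[OF q(1)]) auto
  have C: "C \<ge> 0" using lipschitz_on_nonneg[OF lip] .
  let ?G = "\<lambda>t. if t \<in> M then 0 else norm (g' t)"
  have G: "?G integrable_on {0..T}"
  proof (rule dominated_convergence(1)[where f = "\<lambda>n t. if t \<in> M then 0 else ?\<psi> n t" and h = "\<lambda>_. C"])
    show "(\<lambda>t. if t \<in> M then 0 else ?\<psi> n t) integrable_on {0..T}" for n
      by (rule integrable_spike[OF qint[of n] M]) auto
    show "(\<lambda>n. if t \<in> M then 0 else ?\<psi> n t) \<longlonglongrightarrow> ?G t" if "t \<in> {0..T}" for t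
      using that q(3)[of t] by (auto simp: M_def intro!: tendsto_norm)
  qed (use q(2) C in auto)
  show I: "(\<lambda>t. norm (g' t)) integrable_on {0..T}"
    by (rule integrable_spike[OF G M]) auto
  have bd: "norm (g' t) \<le> C" if "t \<in> {0..T} - M" for t
    using that q(3)[of t] q(2) by (intro tendsto_upperbound[OF tendsto_norm[OF q(3)]]) (auto simp: M_def)
  have ai: "(\<lambda>t. \<bar>?\<psi> n t - norm (g' t)\<bar>) integrable_on {0..T}" for n
  proof -
    have "?\<psi> n absolutely_integrable_on {0..T}" "(\<lambda>t. norm (g' t)) absolutely_integrable_on {0..T}"
      by (intro nonnegative_absolutely_integrable_1 qint I; simp)+
    then have "(\<lambda>t. ?\<psi> n t - norm (g' t)) absolutely_integrable_on {0..T}"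
      by (rule set_integral_diff)
    then show ?thesis by (simp add: absolutely_integrable_on_def)
  qed
  have "(\<lambda>n. integral {0..T} (\<lambda>t. if t \<in> M then 0 else \<bar>?\<psi> n t - norm (g' t)\<bar>)) \<longlonglongrightarrow> integral {0..T} (\<lambda>_. 0)"
  proof (rule dominated_convergence(2)[where h = "\<lambda>_. C"])
    show "(\<lambda>t. if t \<in> M then 0 else \<bar>?\<psi> n t - norm (g' t)\<bar>) integrable_on {0..T}" for n
      by (rule integrable_spike[OF ai[of n] M]) auto
    show "(\<lambda>n. if t \<in> M then 0 else \<bar>?\<psi> n t - norm (g' t)\<bar>) \<longlonglongrightarrow> 0" if "t \<in> {0..T}" for t
    proof (cases "t \<in> M")
      case False
      then have "(\<lambda>n. \<bar>?\<psi> n t - norm (g' t)\<bar>) \<longlonglongrightarrow> \<bar>norm (g' t) - norm (g' t)\<bar>"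
        using that by (intro tendsto_intros q(3)) (auto simp: M_def)
      then show ?thesis using False by simp
    qed simp
    show "norm (if t \<in> M then 0 else \<bar>?\<psi> n t - norm (g' t)\<bar>) \<le> C" if "t \<in> {0..T}" for n t
    proof (cases "t \<in> M")
      case False
      have "\<bar>a - b\<bar> \<le> C" if "0 \<le> a" "a \<le> C" "0 \<le> b" "b \<le> C" for a b :: real using that by linarith
      from this[OF norm_ge_zero q(2) norm_ge_zero bd] show ?thesis using that False by simp
    qed (use C in simp)
  qed auto
  moreover have "integral {0..T} (\<lambda>t. if t \<in> M then 0 else \<bar>?\<psi> n t - norm (g' t)\<bar>) =
      integral {0..T} (\<lambda>t. \<bar>?\<psi> n t - norm (g' t)\<bar>)" for n
    by (rule integral_spike[OF M]) auto
  ultimately have "(\<lambda>n. integral {0..T} (\<lambda>t. \<bar>?\<psi> n t - norm (g' t)\<bar>)) \<longlonglongrightarrow> 0"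
    by simp
  with ai q(1,2) show "\<exists>\<psi> :: nat \<Rightarrow> real \<Rightarrow> real. (\<forall>n. continuous_on UNIV (\<psi> n)) \<and> (\<forall>n t. 0 \<le> \<psi> n t \<and> \<psi> n t \<le> C) \<and>
      (\<lambda>n. integral {0..T} (\<lambda>t. \<bar>\<psi> n t - norm (g' t)\<bar>)) \<longlonglongrightarrow> 0 \<and>
      (\<forall>n. (\<lambda>t. \<bar>\<psi> n t - norm (g' t)\<bar>) integrable_on {0..T})"
    by (intro exI[of _ ?\<psi>]) (auto intro!: continuous_intros)
qed

text \<open>Formally the derivative of arccos x is at most \<open>l\<close>. But arccos is not
  Lipschitz at 1, where the curve starts; so the argument is run for \<open>r * x\<close> with r <
  1, where the chain rule and the fundamental theorem apply, and then r tends to 1.\<close>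

lemma arccos_le_integral:
  fixes x l :: "real \<Rightarrow> real"
  assumes T: "T > 0" and lip: "C-lipschitz_on {0..T} x" and N: "negligible N"
    and D: "\<And>t. t \<in> {0..T} - N \<Longrightarrow> (x has_vector_derivative x' t) (at t within {0..T})"
    and bd: "\<And>t. t \<in> {0..T} \<Longrightarrow> \<bar>x t\<bar> \<le> 1"
    and le: "\<And>t. t \<in> {0..T} - N \<Longrightarrow> \<bar>x' t\<bar> \<le> sqrt (1 - (x t)\<^sup>2) * l t"
    and l: "l integrable_on {0..T}" "\<And>t. l t \<ge> 0"
    and x0: "x 0 = 1"
  shows "arccos (x T) \<le> integral {0..T} l"
proof -
  have "arccos (r * x T) - arccos r \<le> integral {0..T} l" if r: "0 < r" "r < 1" for r
  proof -
    have rx: "\<bar>r * x t\<bar> \<le> r" if "t \<in> {0..T}" for t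
      using bd[OF that] r by (simp add: abs_mult mult_left_le)
    have ad: "(arccos has_real_derivative - inverse (sqrt (1 - y\<^sup>2))) (at y)" if "\<bar>y\<bar> \<le> r" for y
      using that r by (intro DERIV_cong[OF DERIV_arccos]) auto
    have alip: "(inverse (sqrt (1 - r\<^sup>2)))-lipschitz_on {-r..r} arccos"
    proof (rule bounded_derivative_imp_lipschitz[where f' = "\<lambda>y. (*) (- inverse (sqrt (1 - y\<^sup>2)))"])
      fix y assume y: "y \<in> {-r..r}"
      show "(arccos has_derivative (*) (- inverse (sqrt (1 - y\<^sup>2)))) (at y within {-r..r})"
        using y by (intro has_derivative_at_withinI[OF ad[unfolded has_field_derivative_def]]) auto
      have y2: "y\<^sup>2 \<le> r\<^sup>2" using y by (metis abs_le_square_iff abs_of_pos r(1) abs_le_iff atLeastAtMost_iff minus_le_iff)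
      have r2: "r\<^sup>2 < 1" using r by (simp add: power_less_one_iff)
      have "inverse (sqrt (1 - y\<^sup>2)) \<le> inverse (sqrt (1 - r\<^sup>2))"
        using y2 r2 by (intro le_imp_inverse_le) auto
      moreover have "0 \<le> inverse (sqrt (1 - y\<^sup>2))" using y2 r2 by simp
      ultimately have "\<bar>- inverse (sqrt (1 - y\<^sup>2))\<bar> \<le> inverse (sqrt (1 - r\<^sup>2))" by linarith
      then show "onorm ((*) (- inverse (sqrt (1 - y\<^sup>2)))) \<le> inverse (sqrt (1 - r\<^sup>2))"
        by (intro onorm_le) (auto simp: abs_mult intro: mult_right_mono)
    qed (use r in \<open>auto simp: power_le_one_iff\<close>)
    have Flip: "(inverse (sqrt (1 - r\<^sup>2)) * (\<bar>r\<bar> * C))-lipschitz_on {0..T} (\<lambda>t. arccos (r * x t))"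
    proof (rule lipschitz_on_compose2[where g = arccos])
      show "(\<bar>r\<bar> * C)-lipschitz_on {0..T} (\<lambda>t. r * x t)" by (rule lipschitz_on_cmult_real[OF lip])
      show "(inverse (sqrt (1 - r\<^sup>2)))-lipschitz_on ((\<lambda>t. r * x t) ` {0..T}) arccos"
        by (rule lipschitz_on_subset[OF alip]) (use rx in \<open>auto simp: abs_le_iff minus_le_iff\<close>)
    qed
    let ?F' = "\<lambda>t. - inverse (sqrt (1 - (r * x t)\<^sup>2)) * (r * x' t)"
    have FD: "((\<lambda>t. arccos (r * x t)) has_vector_derivative ?F' t) (at t within {0..T})"
      if "t \<in> {0..T} - N" for t
    proof -
      have "((\<lambda>t. r * x t) has_vector_derivative r * x' t) (at t within {0..T})"
        using has_vector_derivative_mult_right[OF D[OF that], of r] by simp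
      from field_vector_diff_chain_within[OF this has_field_derivative_at_within[OF ad[OF rx]]] that
      show ?thesis by (simp add: o_def mult.commute)
    qed
    have I: "(?F' has_integral (arccos (r * x T) - arccos (r * x 0))) {0..T}"
      by (rule lipschitz_on_ftc_ae(1)[OF T Flip N FD])
    \<comment> \<open>Scaling by \<open>r\<close> preserves the bound because r sqrt (1 - x^2) is at
      most sqrt (1 - (r x)^2).\<close>
    have pt: "?F' t \<le> l t" if t: "t \<in> {0..T} - N" for t
    proof -
      have x2: "(x t)\<^sup>2 \<le> 1" using bd[of t] t by (simp add: abs_square_le_1)
      have rx2: "(r * x t)\<^sup>2 < 1"
        using rx[of t] t r by (simp add: abs_square_less_1)
      have "r\<^sup>2 * (1 - (x t)\<^sup>2) \<le> 1 - (r * x t)\<^sup>2"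
        using r by (simp add: power_mult_distrib algebra_simps power_le_one_iff)
      then have "r * sqrt (1 - (x t)\<^sup>2) \<le> sqrt (1 - (r * x t)\<^sup>2)"
        using r by (metis abs_of_pos real_sqrt_abs real_sqrt_le_iff real_sqrt_mult)
      then have "r * sqrt (1 - (x t)\<^sup>2) * l t \<le> sqrt (1 - (r * x t)\<^sup>2) * l t"
        using l(2) by (intro mult_right_mono)
      moreover have "- (r * x' t) \<le> r * (sqrt (1 - (x t)\<^sup>2) * l t)"
        using mult_left_mono[OF le[OF t], of r] r by (simp add: abs_le_iff)
           (metis (no_types, opaque_lifting) abs_ge_minus_self le mult_left_mono mult_minus_right order_trans t less_imp_le)
      ultimately have "- (r * x' t) \<le> l t * sqrt (1 - (r * x t)\<^sup>2)"
        by (simp add: mult.assoc mult.commute mult.left_commute)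
      then have "- (r * x' t) / sqrt (1 - (r * x t)\<^sup>2) \<le> l t"
        using rx2 by (subst pos_divide_le_eq) simp_all
      then show ?thesis by (simp add: divide_inverse mult.commute)
    qed
    have "arccos (r * x T) - arccos (r * x 0) \<le> integral {0..T} l"
    proof (rule has_integral_le)
      show "((\<lambda>t. if t \<in> N then l t else ?F' t) has_integral (arccos (r * x T) - arccos (r * x 0))) {0..T}"
        by (rule has_integral_spike[OF N _ I]) auto
    qed (use l pt in \<open>auto simp: integrable_integral\<close>)
    then show ?thesis by (simp add: x0)
  qed
  note * = this
  \<comment> \<open>The shift by 2 keeps the factor strictly between 0 and 1, also for n =
    0.\<close>
  have "((\<lambda>n. arccos ((1 - 1 / real (n+2)) * x T) - arccos (1 - 1 / real (n+2))) \<longlonglongrightarrow> arccos (1 * x T) - arccos 1)"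
  proof (rule tendsto_diff)
    have lim: "(\<lambda>n. 1 - 1 / real (n+2)) \<longlonglongrightarrow> 1"
    proof -
      have "(\<lambda>n. 1 / real (n+2)) \<longlonglongrightarrow> 0"
        using LIMSEQ_ignore_initial_segment[OF lim_1_over_n, of 2] by simp
      from tendsto_diff[OF tendsto_const[of 1] this] show ?thesis by simp
    qed
    have in1: "1 - 1 / real (n + 2) \<in> {0..1}" for n by (simp add: field_simps)
    have xT: "\<bar>x T\<bar> \<le> 1" using bd[of T] T by simp
    show "(\<lambda>n. arccos (1 - 1 / real (n+2))) \<longlonglongrightarrow> arccos 1"
    proof (rule continuous_on_tendsto_compose[OF continuous_on_arccos' lim])
      have "1 - 1 / real (n + 2) \<in> {-1..1}" for n
        using in1[of n] unfolding atLeastAtMost_iff by (intro conjI; linarith)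
      then show "\<forall>\<^sub>F n in sequentially. 1 - 1 / real (n + 2) \<in> {-1..1}"
        by (intro always_eventually allI)
    qed simp
    have in2: "\<bar>(1 - 1 / real (n + 2)) * x T\<bar> \<le> 1" for n
      using mult_mono[of "\<bar>1 - 1 / real (n+2)\<bar>" 1 "\<bar>x T\<bar>" 1] in1[of n] xT by (simp add: abs_mult)
    show "(\<lambda>n. arccos ((1 - 1 / real (n+2)) * x T)) \<longlonglongrightarrow> arccos (1 * x T)"
      by (rule continuous_on_tendsto_compose[OF continuous_on_arccos' tendsto_mult[OF lim tendsto_const]])
        (use in2 xT in \<open>auto simp: abs_le_iff minus_le_iff intro!: always_eventually\<close>)
  qed
  then have "arccos (1 * x T) - arccos 1 \<le> integral {0..T} l"
    by (rule tendsto_upperbound) (use * in \<open>auto intro!: always_eventually\<close>)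
  then show ?thesis by simp
qed

lemma norm_fst_SU2_le:
  assumes "g \<in> SU2"
  shows "cmod (fst g) \<le> 1"
proof (rule power2_le_imp_le)
  have "(cmod (fst g))\<^sup>2 + (cmod (snd g))\<^sup>2 = 1"
    using assms by (simp add: SU2_def case_prod_beta)
  then show "(cmod (fst g))\<^sup>2 \<le> 1\<^sup>2"
    using zero_le_power2[of "cmod (snd g)"] unfolding power_one by linarith
qed simp

lemma norm_cis_diff_le: "cmod (cis a - cis b) \<le> \<bar>a - b\<bar>"
proof -
  have "cis a - cis b = cis b * (exp (\<i> * of_real (a - b)) - 1)"
    by (simp only: cis_conv_exp[symmetric] right_diff_distrib cis_mult) simp
  then have "cmod (cis a - cis b) = 2 * \<bar>sin ((a - b) / 2)\<bar>"
    by (simp add: norm_mult dist_exp_i_1 del: of_real_diff)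
  also have "\<dots> \<le> \<bar>a - b\<bar>"
    using abs_sin_x_le_abs_x[of "(a - b) / 2"] by simp
  finally show ?thesis .
qed

text \<open>\<open>z\<close> is the coordinate of g^{-1} v in p. The factor 2 reflects that the unit
  vectors p1 and p2 have coordinates of modulus 1/2.\<close>

lemma Distr_eq:
  assumes "g \<in> SU2" "v \<in> Distr g"
  obtains z where "v = (- snd g * cnj z, fst g * z)" "cmod z = norm v" "sqrt (sr_inner g v v) = 2 * norm v"
proof -
  define z where "z = cnj (fst g) * snd v - snd g * cnj (fst v)"
  have h: "cnj (fst g) * fst v + snd g * cnj (snd v) = 0"
    using assms Distr_iff by blast
  have g: "fst g * cnj (fst g) + snd g * cnj (snd g) = 1" using assms(1) by (simp add: mem_SU2_iff)
  have h': "fst g * cnj (fst v) + cnj (snd g) * snd v = 0"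
    using arg_cong[OF h, of cnj] by simp
  have "fst g * z = snd v * (fst g * cnj (fst g) + snd g * cnj (snd g)) - snd g * (fst g * cnj (fst v) + cnj (snd g) * snd v)"
    by (simp add: z_def algebra_simps)
  then have 2: "snd v = fst g * z" by (simp only: g h') simp
  have "- snd g * cnj z = fst v * (fst g * cnj (fst g) + snd g * cnj (snd g)) - fst g * (cnj (fst g) * fst v + snd g * cnj (snd v))"
    by (simp add: z_def algebra_simps)
  then have 1: "fst v = - snd g * cnj z" by (simp only: g h) simp
  have v: "v = (- snd g * cnj z, fst g * z)" using 1 2 by (simp add: prod_eq_iff)
  have "(norm v)\<^sup>2 = ((cmod (snd g))\<^sup>2 + (cmod (fst g))\<^sup>2) * (cmod z)\<^sup>2"
    by (subst v) (simp add: norm_Pair norm_mult power_mult_distrib algebra_simps)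
  also have "\<dots> = (cmod z)\<^sup>2"
    using assms(1) by (simp add: SU2_def case_prod_beta add.commute)
  finally have n: "cmod z = norm v" by simp
  have "sr_inner g v v = 4 * (cmod z)\<^sup>2"
    using sr_inner_eq[OF assms(1) assms(2,2)] unfolding z_def[symmetric] complex_norm_square[symmetric]
    by simp
  then have "sqrt (sr_inner g v v) = 2 * norm v" by (simp add: real_sqrt_mult n)
  with v n that show ?thesis by blast
qed

text \<open>
  In the rotating frame \<open>\<alpha> \<cdot> cis (S t)\<close> the curve moves on the round sphere with speed
  \<open>sqrt (cmod z ^ 2 + S' ^ 2)\<close>, so its spherical distance to the identity is controlled.
  The frame has to rotate proportionally to arclength; as the speed of a Lipschitz curve is only
  measurable, it is replaced by continuous approximations.
\<close>

lemma horizontal_curve_bound: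
  fixes g :: "real \<Rightarrow> complex \<times> complex" and a b :: real
  assumes T: "T > 0" and lip: "C-lipschitz_on {0..T} g" and N: "negligible N"
    and D: "\<And>t. t \<in> {0..T} - N \<Longrightarrow> (g has_vector_derivative g' t) (at t within {0..T})"
    and hor: "\<And>t. t \<in> {0..T} - N \<Longrightarrow> g' t \<in> Distr (g t)"
    and SU2: "\<And>t. t \<in> {0..T} \<Longrightarrow> g t \<in> SU2"
    and g0: "g 0 = (1, 0)"
    and b: "integral {0..T} (\<lambda>t. norm (g' t)) < b" and ab: "a\<^sup>2 + b\<^sup>2 \<le> pi\<^sup>2"
  shows "cos (sqrt (a\<^sup>2 + b\<^sup>2)) \<le> Re (fst (g T) * cis a)"
proof -
  let ?f = "\<lambda>t. norm (g' t)"
  have f: "?f integrable_on {0..T}" by (rule norm_deriv_integrable(1)[OF T lip N D])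
  obtain \<psi> :: "nat \<Rightarrow> real \<Rightarrow> real" where \<psi>: "\<And>n. continuous_on UNIV (\<psi> n)"
      "\<And>n t. 0 \<le> \<psi> n t" "\<And>n t. \<psi> n t \<le> C"
      "(\<lambda>n. integral {0..T} (\<lambda>t. \<bar>\<psi> n t - ?f t\<bar>)) \<longlonglongrightarrow> 0"
      "\<And>n. (\<lambda>t. \<bar>\<psi> n t - ?f t\<bar>) integrable_on {0..T}"
    using norm_deriv_integrable(2)[OF T lip N D] by blast
  let ?b0 = "integral {0..T} ?f"
  have b0: "0 \<le> ?b0" by (intro integral_nonneg f) auto
  \<comment> \<open>The strict gap between \<open>b\<close> and the Euclidean length is spread
    evenly over [0, T], so that speed plus \<open>\<delta>\<close> integrates exactly to
    \<open>b\<close>.\<close>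
  define \<delta> where "\<delta> = (b - ?b0) / T"
  have \<delta>: "\<delta> > 0" "\<delta> * T = b - ?b0" using T b by (simp_all add: \<delta>_def)
  \<comment> \<open>The frame turns \<open>m\<close> times as fast as the curve moves, hence by
    \<open>a\<close> in total; the two orthogonal speeds combine to the factor
    \<open>q = sqrt (1 + m^2)\<close>.\<close>
  define m where "m = a / b"
  have bpos: "b > 0" using b b0 by simp
  have mb: "m * b = a" using bpos by (simp add: m_def)
  define S where "S n t = m * (integral {0..t} (\<psi> n) + \<delta> * t)" for n t
  define e where "e n = integral {0..T} (\<lambda>t. \<bar>\<psi> n t - ?f t\<bar>)" for n
  define q where "q = sqrt (1 + m\<^sup>2)"
  have \<psi>i: "\<psi> n integrable_on {0..T}" for n
    by (intro integrable_continuous_interval continuous_on_subset[OF \<psi>(1)]) auto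
  have SD: "(S n has_real_derivative m * (\<psi> n t + \<delta>)) (at t within {0..T})" if "t \<in> {0..T}" for n t
  proof -
    have "((\<lambda>u. integral {0..u} (\<psi> n)) has_real_derivative \<psi> n t) (at t within {0..T})"
      by (rule integral_has_real_derivative[OF continuous_on_subset[OF \<psi>(1)] that]) auto
    then show ?thesis unfolding S_def by (auto intro!: derivative_eq_intros)
  qed
  have S0: "S n 0 = 0" for n by (simp add: S_def)
  have main: "arccos (Re (fst (g T) * cis (S n T))) \<le> q * b + \<bar>m\<bar> * e n" for n
  proof -
    let ?x = "\<lambda>t. Re (fst (g t) * cis (S n t))"
    \<comment> \<open>The first summand integrates to \<open>q * b\<close>, the desired arc length;
      the second one pays for using \<open>\<psi> n\<close> in place of the true speed and vanishes
      in the limit.\<close>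
    let ?l = "\<lambda>t. q * (?f t + \<delta>) + \<bar>m\<bar> * \<bar>\<psi> n t - ?f t\<bar>"
    let ?x' = "\<lambda>t. Re (fst (g t) * (m * (\<psi> n t + \<delta>) * \<i> * cis (S n t)) + fst (g' t) * cis (S n t))"
    have fst1: "cmod (fst (g t)) \<le> 1" if "t \<in> {0..T}" for t
      using norm_fst_SU2_le[OF SU2[OF that]] .
    have Slip: "\<bar>S n t - S n s\<bar> \<le> \<bar>m\<bar> * (C + \<delta>) * \<bar>t - s\<bar>" if "t \<in> {0..T}" "s \<in> {0..T}" for t s
    proof -
      have "norm (S n t - S n s) \<le> \<bar>m\<bar> * (C + \<delta>) * norm (t - s)"
      proof (rule field_differentiable_bound[OF _ SD])
        show "norm (m * (\<psi> n u + \<delta>)) \<le> \<bar>m\<bar> * (C + \<delta>)" for u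
          using \<psi>(2,3)[of n u] \<delta> by (auto simp: abs_mult intro!: mult_left_mono)
      qed (use that in auto)
      then show ?thesis by simp
    qed
    have xlip: "(C + \<bar>m\<bar> * (C + \<delta>))-lipschitz_on {0..T} ?x"
    proof (rule lipschitz_onI)
      fix t s assume ts: "t \<in> {0..T}" "s \<in> {0..T}"
      note norm_cis_diff_le[of "S n t" "S n s"]
      also note Slip[OF ts]
      finally have 1: "cmod (cis (S n t) - cis (S n s)) \<le> \<bar>m\<bar> * (C + \<delta>) * \<bar>t - s\<bar>" .
      have 2: "cmod (fst (g t) - fst (g s)) \<le> C * \<bar>t - s\<bar>"
        using order_trans[OF dist_fst_le lipschitz_onD[OF lip ts]] by (simp add: dist_norm)
      have "\<bar>?x t - ?x s\<bar> = \<bar>Re ((fst (g t) - fst (g s)) * cis (S n t) + fst (g s) * (cis (S n t) - cis (S n s)))\<bar>"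
        by (simp add: algebra_simps)
      also have "\<dots> \<le> cmod ((fst (g t) - fst (g s)) * cis (S n t) + fst (g s) * (cis (S n t) - cis (S n s)))"
        by (rule abs_Re_le_cmod)
      also have "\<dots> \<le> cmod (fst (g t) - fst (g s)) + 1 * cmod (cis (S n t) - cis (S n s))"
        by (rule order_trans[OF norm_triangle_ineq add_mono])
          (use fst1[OF ts(2)] in \<open>auto simp: norm_mult mult_left_le_one_le\<close>)
      finally show "dist (?x t) (?x s) \<le> (C + \<bar>m\<bar> * (C + \<delta>)) * dist t s"
        using 1 2 by (simp add: dist_real_def algebra_simps)
    qed (use lipschitz_on_nonneg[OF lip] \<delta> in simp)
    have xD: "(?x has_vector_derivative ?x' t) (at t within {0..T})" if "t \<in> {0..T} - N" for t
    proof -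
      have cisD: "((\<lambda>t. cis (S n t)) has_vector_derivative m * (\<psi> n t + \<delta>) * \<i> * cis (S n t)) (at t within {0..T})"
      proof -
        have "(S n has_vector_derivative m * (\<psi> n t + \<delta>)) (at t within {0..T})"
          using SD[of t n] that by (simp add: has_real_derivative_iff_has_vector_derivative)
        then have "((\<lambda>t. \<i> * of_real (S n t)) has_vector_derivative \<i> * of_real (m * (\<psi> n t + \<delta>))) (at t within {0..T})"
          by (intro has_vector_derivative_mult_right bounded_linear.has_vector_derivative[OF bounded_linear_of_real])
        from field_vector_diff_chain_within[OF this DERIV_subset[OF DERIV_exp]]
        show ?thesis by (simp add: o_def cis_conv_exp mult_ac)
      qed
      have "((\<lambda>t. fst (g t)) has_vector_derivative fst (g' t)) (at t within {0..T})"
        using D[OF that] bounded_linear.has_vector_derivative[OF bounded_linear_fst] by blast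
      from bounded_linear.has_vector_derivative[OF bounded_linear_Re has_vector_derivative_mult[OF this cisD]]
      show ?thesis .
    qed
    have bdx: "\<bar>?x t\<bar> \<le> 1" if "t \<in> {0..T}" for t
      using order_trans[OF abs_Re_le_cmod fst1[OF that], of] abs_Re_le_cmod[of "fst (g t) * cis (S n t)"] fst1[OF that]
      by (simp add: norm_mult)
    have le: "\<bar>?x' t\<bar> \<le> sqrt (1 - (?x t)\<^sup>2) * ?l t" if "t \<in> {0..T} - N" for t
    proof -
      have gt: "g t \<in> SU2" using SU2 that by auto
      note hort = hor[OF that]
      obtain z where z: "g' t = (- snd (g t) * cnj z, fst (g t) * z)" "cmod z = ?f t"
        using Distr_eq[OF gt hort] by metis
      define A where "A = fst (g t) * cis (S n t)"
      define k where "k = m * (\<psi> n t + \<delta>)"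
      have "?x' t = - (k * Im A) + Re (- snd (g t) * cnj z * cis (S n t))"
        unfolding A_def k_def z(1) by (simp add: algebra_simps)
      moreover have "\<bar>- (k * Im A) + r\<bar> \<le> \<bar>Im A\<bar> * \<bar>k\<bar> + c" if "\<bar>r\<bar> \<le> c" for r c
        using abs_triangle_ineq[of "- (k * Im A)" r] that by (simp add: abs_mult mult.commute)
      moreover have "\<bar>Re (- snd (g t) * cnj z * cis (S n t))\<bar> \<le> cmod (snd (g t)) * cmod z"
        by (rule order_trans[OF abs_Re_le_cmod]) (simp add: norm_mult)
      ultimately have "\<bar>?x' t\<bar> \<le> \<bar>Im A\<bar> * \<bar>k\<bar> + cmod (snd (g t)) * cmod z"
        by presburger
      \<comment> \<open>Cauchy-Schwarz on the sphere: the coordinates other than the real part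
        \<open>?x\<close> have squared norm 1 - ?x^2, the factor demanded by
        \<open>arccos_le_integral\<close>.\<close>
      also have "\<dots> \<le> sqrt ((\<bar>Im A\<bar>)\<^sup>2 + (cmod (snd (g t)))\<^sup>2) * sqrt (\<bar>k\<bar>\<^sup>2 + (cmod z)\<^sup>2)"
      proof -
        have "u * k + v * w \<le> sqrt (u\<^sup>2 + v\<^sup>2) * sqrt (k\<^sup>2 + w\<^sup>2)" for u v k w :: real
          using norm_cauchy_schwarz[of "(u, v)" "(k, w)"] by (simp add: norm_Pair)
        then show ?thesis .
      qed
      also have "(\<bar>Im A\<bar>)\<^sup>2 + (cmod (snd (g t)))\<^sup>2 = 1 - (?x t)\<^sup>2"
      proof -
        have "(cmod A)\<^sup>2 + (cmod (snd (g t)))\<^sup>2 = 1"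
          using gt by (simp add: A_def norm_mult SU2_def case_prod_beta)
        then show ?thesis by (simp add: cmod_power2 A_def)
      qed
      finally have fin: "\<bar>?x' t\<bar> \<le> sqrt (1 - (?x t)\<^sup>2) * sqrt (\<bar>k\<bar>\<^sup>2 + (cmod z)\<^sup>2)" .
      have sl: "sqrt (\<bar>k\<bar>\<^sup>2 + (cmod z)\<^sup>2) \<le> ?l t"
      proof -
        have "sqrt (\<bar>k\<bar>\<^sup>2 + (cmod z)\<^sup>2) = norm (?f t, m * (\<psi> n t + \<delta>))"
          by (simp add: norm_Pair k_def z(2) add.commute)
        also have "\<dots> \<le> norm (?f t + \<delta>, m * (\<psi> n t + \<delta>))"
          using \<delta> by (simp add: norm_Pair power_mono)
        \<comment> \<open>The velocity is split into the one with the exact ratio \<open>m\<close>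
          of frame speed to curve speed and the approximation error.\<close>
        also have "(?f t + \<delta>, m * (\<psi> n t + \<delta>)) = (?f t + \<delta>) *\<^sub>R (1, m) + (0, m * (\<psi> n t - ?f t))"
          by (simp add: algebra_simps)
        also have "norm \<dots> \<le> norm ((?f t + \<delta>) *\<^sub>R (1::real, m)) + norm (0::real, m * (\<psi> n t - ?f t))"
          by (rule norm_triangle_ineq)
        also have "\<dots> = ?l t"
          using \<delta> unfolding norm_scaleR by (simp add: norm_Pair q_def abs_mult)
        finally show ?thesis .
      qed
      have "0 \<le> sqrt (1 - (?x t)\<^sup>2)"
        using bdx[of t] that by (simp only: real_sqrt_ge_0_iff diff_ge_0_iff_ge abs_square_le_1) simp
      from order_trans[OF fin mult_left_mono[OF sl this]] show ?thesis .
    qed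
    have li: "(?l has_integral (q * (?b0 + \<delta> * T) + \<bar>m\<bar> * e n)) {0..T}"
      unfolding e_def using T has_integral_const_real[of \<delta> 0 T]
      by (intro has_integral_add has_integral_mult_right integrable_integral f \<psi>(5)) (simp add: mult.commute)
    have "arccos (?x T) \<le> integral {0..T} ?l"
      by (rule arccos_le_integral[OF T xlip N xD bdx le])
        (use li \<delta> g0 S0 in \<open>auto simp: q_def\<close>)
    then show ?thesis using li \<delta>(2) by (simp add: integral_unique)
  qed
  have e0: "e \<longlonglongrightarrow> 0" unfolding e_def by (rule \<psi>(4))
  have "(\<lambda>n. integral {0..T} (\<psi> n)) \<longlonglongrightarrow> ?b0"
  proof -
    have "\<bar>integral {0..T} (\<psi> n) - ?b0\<bar> \<le> e n" for n
    proof -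
      have "norm (integral {0..T} (\<lambda>t. \<psi> n t - ?f t)) \<le> e n"
        unfolding e_def by (rule integral_norm_bound_integral) (auto intro: integrable_diff \<psi>i f \<psi>(5))
      then show ?thesis by (simp add: integral_diff \<psi>i f)
    qed
    then have "(\<lambda>n. integral {0..T} (\<psi> n) - ?b0) \<longlonglongrightarrow> 0"
      by (intro Lim_null_comparison[OF _ e0]) (simp add: always_eventually)
    then show ?thesis by (simp add: LIM_zero_iff)
  qed
  then have "(\<lambda>n. S n T) \<longlonglongrightarrow> m * (?b0 + \<delta> * T)"
    unfolding S_def by (intro tendsto_intros)
  then have Slim: "(\<lambda>n. S n T) \<longlonglongrightarrow> a" using \<delta>(2) mb by simp
  have xb: "\<bar>Re (fst (g T) * cis s)\<bar> \<le> 1" for s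
    using abs_Re_le_cmod[of "fst (g T) * cis s"] norm_fst_SU2_le[OF SU2[of T]] T
    by (simp add: norm_mult)
  have xb2: "- 1 \<le> Re (fst (g T) * cis s)" "Re (fst (g T) * cis s) \<le> 1" for s
    using xb[of s] unfolding abs_le_iff by linarith+
  have "(\<lambda>n. arccos (Re (fst (g T) * cis (S n T)))) \<longlonglongrightarrow> arccos (Re (fst (g T) * cis a))"
  proof (rule continuous_on_tendsto_compose[OF continuous_on_arccos'])
    show "(\<lambda>n. Re (fst (g T) * cis (S n T))) \<longlonglongrightarrow> Re (fst (g T) * cis a)"
      unfolding cis_conv_exp by (intro tendsto_intros Slim)
    have in1: "Re (fst (g T) * cis s) \<in> {-1..1}" for s
      using xb2[of s] unfolding atLeastAtMost_iff by blast
    then show "Re (fst (g T) * cis a) \<in> {-1..1}" .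
    show "\<forall>\<^sub>F n in sequentially. Re (fst (g T) * cis (S n T)) \<in> {-1..1}"
      using in1 by (intro always_eventually allI)
  qed
  moreover have "(\<lambda>n. q * b + \<bar>m\<bar> * e n) \<longlonglongrightarrow> q * b + \<bar>m\<bar> * 0"
    by (intro tendsto_intros e0)
  ultimately have "arccos (Re (fst (g T) * cis a)) \<le> q * b + \<bar>m\<bar> * 0"
    by (rule LIMSEQ_le) (use main in auto)
  also have "q * b = sqrt (a\<^sup>2 + b\<^sup>2)"
  proof -
    have "sqrt (a\<^sup>2 + b\<^sup>2) = sqrt ((1 + m\<^sup>2) * b\<^sup>2)"
      using bpos by (simp add: m_def power_divide field_simps)
    then show ?thesis using bpos by (simp add: q_def real_sqrt_mult)
  qed
  finally have le: "arccos (Re (fst (g T) * cis a)) \<le> sqrt (a\<^sup>2 + b\<^sup>2)" by simp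
  have "sqrt (a\<^sup>2 + b\<^sup>2) \<le> pi" using ab by (simp add: real_le_lsqrt)
  then have "cos (sqrt (a\<^sup>2 + b\<^sup>2)) \<le> cos (arccos (Re (fst (g T) * cis a)))"
    using le by (intro cos_monotone_0_pi_le arccos_lbound xb2)
  then show ?thesis using xb[of a] cos_arccos_abs[of "Re (fst (g T) * cis a)"] by simp
qed

section \<open>Optimality certificates\<close>

text \<open>The numerator of the derivative of sin t / t is t cos t - sin t, which is negative
  because sin t - t cos t starts at 0 and has derivative t sin t. This monotonicity is the convexity
  of cos (sqrt x) up to pi^2.\<close>

lemma sinc_strict_decreasing:
  assumes "0 < x" "x < y" "y \<le> pi"
  shows "x * sin y < y * sin (x::real)"
proof -
  have pos: "t * cos t < sin t" if "0 < t" "t < pi" for t :: real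
  proof -
    have "(\<lambda>t. sin t - t * cos t) 0 < (\<lambda>t. sin t - t * cos t) t"
    proof (rule DERIV_pos_imp_increasing_open[OF that(1)])
      fix u assume u: "0 < u" "u < t"
      have "((\<lambda>t. sin t - t * cos t) has_real_derivative u * sin u) (at u)"
        by (auto intro!: derivative_eq_intros)
      moreover have "u * sin u > 0" using u that by (simp add: sin_gt_zero)
      ultimately show "\<exists>d. ((\<lambda>t. sin t - t * cos t) has_real_derivative d) (at u) \<and> 0 < d" by blast
    qed (intro continuous_intros)
    then show ?thesis by simp
  qed
  have "(\<lambda>t. sin t / t) y < (\<lambda>t. sin t / t) x"
  proof (rule DERIV_neg_imp_decreasing_open[OF assms(2)])
    fix u assume u: "x < u" "u < y"
    have "((\<lambda>t. sin t / t) has_real_derivative (u * cos u - sin u) / u\<^sup>2) (at u)"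
      using u assms by (auto intro!: derivative_eq_intros simp: power2_eq_square mult.commute)
    moreover have "(u * cos u - sin u) / u\<^sup>2 < 0"
      using pos[of u] u assms by (simp add: divide_neg_pos)
    ultimately show "\<exists>d. ((\<lambda>t. sin t / t) has_real_derivative d) (at u) \<and> d < 0" by blast
  qed (use assms in \<open>auto intro!: continuous_intros\<close>)
  then show ?thesis using assms by (simp add: field_simps)
qed

text \<open>This is the tangent inequality for \<open>x \<mapsto> cos (sqrt x)\<close> at \<open>x = u\<^sup>2\<close>.\<close>

lemma cos_ge_tangent:
  fixes u v :: real
  assumes u: "0 < u" "u \<le> pi"
  defines "m \<equiv> sin u / (2 * u)"
  shows "cos u - m * (v\<^sup>2 - u\<^sup>2) \<le> cos v"
    and "v\<^sup>2 < u\<^sup>2 \<Longrightarrow> cos u - m * (v\<^sup>2 - u\<^sup>2) < cos v"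
proof -
  define G where "G v = cos v - cos u + m * (v\<^sup>2 - u\<^sup>2)" for v
  have GD: "(G has_real_derivative (v * sin u - u * sin v) / u) (at v)" for v
    unfolding G_def m_def using u by (auto intro!: derivative_eq_intros simp: field_simps)
  have Gc: "continuous_on S G" for S
    unfolding G_def by (intro continuous_intros)
  have Gu: "G u = 0" by (simp add: G_def)
  have m: "m \<ge> 0" unfolding m_def using u by (simp add: sin_ge_zero)
  have 1: "G v > 0" if "0 \<le> v" "v < u" for v
  proof -
    have "G u < G v"
    proof (rule DERIV_neg_imp_decreasing_open[OF that(2) _ Gc])
      fix x assume x: "v < x" "x < u"
      then have "(x * sin u - u * sin x) / u < 0"
        using sinc_strict_decreasing[of x u] u that by (intro divide_neg_pos) auto
      then show "\<exists>y. (G has_real_derivative y) (at x) \<and> y < 0" using GD by blast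
    qed
    then show ?thesis by (simp add: Gu)
  qed
  have 2: "G v \<ge> 0" if "u < v" "v \<le> pi" for v
  proof -
    have "G u < G v"
    proof (rule DERIV_pos_imp_increasing_open[OF that(1) _ Gc])
      fix x assume x: "u < x" "x < v"
      then have "(x * sin u - u * sin x) / u > 0"
        using sinc_strict_decreasing[of u x] u that by (intro divide_pos_pos) auto
      then show "\<exists>y. (G has_real_derivative y) (at x) \<and> 0 < y" using GD by blast
    qed
    then show ?thesis by (simp add: Gu)
  qed
  \<comment> \<open>Beyond pi convexity fails, but the tangent only continues to fall while cos
    stays above its value at pi.\<close>
  have 3: "G v \<ge> 0" if "v > pi" for v
  proof -
    have "G pi \<ge> 0" using 2[of pi] Gu u by (cases "u = pi") auto
    moreover have "pi\<^sup>2 \<le> v\<^sup>2" using that pi_gt_zero by (intro power_mono) auto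
    then have "m * (pi\<^sup>2 - u\<^sup>2) \<le> m * (v\<^sup>2 - u\<^sup>2)" using m by (intro mult_left_mono) auto
    ultimately show ?thesis
      using cos_ge_minus_one[of v] unfolding G_def cos_pi by linarith
  qed
  have Gabs: "G \<bar>v\<bar> = G v" by (simp add: G_def)
  show "cos u - m * (v\<^sup>2 - u\<^sup>2) \<le> cos v"
    using 1[of "\<bar>v\<bar>"] 2[of "\<bar>v\<bar>"] 3[of "\<bar>v\<bar>"] Gu
    by (cases "\<bar>v\<bar>" u rule: linorder_cases; cases "\<bar>v\<bar> \<le> pi") (auto simp: Gabs, auto simp: G_def)
  assume "v\<^sup>2 < u\<^sup>2"
  then have "\<bar>v\<bar> < u" using u by (simp add: abs_square_less_1 power2_less_imp_less)
  from 1[OF abs_ge_zero this] show "cos u - m * (v\<^sup>2 - u\<^sup>2) < cos v"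
    unfolding Gabs by (simp add: G_def)
qed

text \<open>
  \<open>Re (fst (Exp_su2 \<theta> c t) * cis a)\<close> is a convex combination of \<open>cos (d + e)\<close> and \<open>cos (d - e)\<close>,
  and the corresponding mean of \<open>(d \<plusminus> e)\<^sup>2\<close> is \<open>a\<^sup>2 + (t / 2)\<^sup>2\<close>: Jensen's inequality applies.
\<close>

lemma Exp_su2_bound:
  assumes t: "t > 0" and at: "a\<^sup>2 + (t / 2)\<^sup>2 \<le> pi\<^sup>2"
  shows "cos (sqrt (a\<^sup>2 + (t / 2)\<^sup>2)) \<le> Re (fst (Exp_su2 \<theta> c t) * cis a)"
    and "a \<noteq> c * t / 2 \<Longrightarrow> cos (sqrt (a\<^sup>2 + (t / 2)\<^sup>2)) < Re (fst (Exp_su2 \<theta> c t) * cis a)"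
proof -
  define w where "w = sqrt (1 + c\<^sup>2)"
  have w: "w > 0" "w\<^sup>2 = 1 + c\<^sup>2" unfolding w_def by (simp_all add: add_pos_nonneg)
  \<comment> \<open>The weights of the convex combination are (1 + \<kappa>) / 2 and (1 - \<kappa>)
    / 2; both are positive since |c| < w.\<close>
  define \<kappa> where "\<kappa> = c / w"
  have "c\<^sup>2 < w\<^sup>2" using w by simp
  then have "\<bar>c\<bar> < w" using w(1) by (metis abs_of_pos power2_less_imp_less abs_ge_zero less_imp_le power2_abs)
  then have \<kappa>: "\<bar>\<kappa>\<bar> < 1" using w(1) by (simp add: \<kappa>_def)
  define d where "d = a - c * t / 2"
  define e where "e = w * t / 2"
  define u where "u = sqrt (a\<^sup>2 + (t / 2)\<^sup>2)"
  have u2: "u\<^sup>2 = a\<^sup>2 + (t / 2)\<^sup>2" by (simp add: u_def)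
  have u: "0 < u" "u \<le> pi"
    using t at by (auto simp: u_def add_nonneg_pos real_le_lsqrt)
  have e: "e > 0" using t w by (simp add: e_def)
  have Re: "Re (fst (Exp_su2 \<theta> c t) * cis a) = (1 + \<kappa>) / 2 * cos (d + e) + (1 - \<kappa>) / 2 * cos (d - e)"
  proof -
    have "fst (Exp_su2 \<theta> c t) * cis a = cis d * Complex (cos e) (\<kappa> * sin e)"
      unfolding Exp_su2_eq w_def[symmetric] fst_conv \<kappa>_def e_def d_def
      by (simp add: cis_mult mult.commute mult.left_commute)
    then show ?thesis by (simp add: cos_add cos_diff field_simps)
  qed
  have avg: "(1 + \<kappa>) / 2 * ((d + e)\<^sup>2 - u\<^sup>2) + (1 - \<kappa>) / 2 * ((d - e)\<^sup>2 - u\<^sup>2) = 0"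
  proof -
    have "(1 + \<kappa>) / 2 * ((d + e)\<^sup>2 - u\<^sup>2) + (1 - \<kappa>) / 2 * ((d - e)\<^sup>2 - u\<^sup>2) = d\<^sup>2 + e\<^sup>2 + 2 * d * (\<kappa> * e) - u\<^sup>2"
      by (simp add: power2_eq_square field_simps)
    also have "\<kappa> * e = c * t / 2" using w(1) by (simp add: \<kappa>_def e_def)
    also have "e\<^sup>2 = (1 + c\<^sup>2) * (t / 2)\<^sup>2" by (simp add: e_def power_mult_distrib power_divide w(2))
    also have "d\<^sup>2 + (1 + c\<^sup>2) * (t / 2)\<^sup>2 + 2 * d * (c * t / 2) - u\<^sup>2 = 0"
      unfolding u2 d_def by (simp add: power2_eq_square field_simps)
    finally show ?thesis .
  qed
  define m where "m = sin u / (2 * u)"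
  have sum: "(1 + \<kappa>) / 2 * (cos u - m * ((d + e)\<^sup>2 - u\<^sup>2)) + (1 - \<kappa>) / 2 * (cos u - m * ((d - e)\<^sup>2 - u\<^sup>2)) = cos u"
  proof -
    have "(1 + \<kappa>) / 2 * (cos u - m * ((d + e)\<^sup>2 - u\<^sup>2)) + (1 - \<kappa>) / 2 * (cos u - m * ((d - e)\<^sup>2 - u\<^sup>2)) =
      cos u - m * ((1 + \<kappa>) / 2 * ((d + e)\<^sup>2 - u\<^sup>2) + (1 - \<kappa>) / 2 * ((d - e)\<^sup>2 - u\<^sup>2))"
      by (simp add: field_simps)
    then show ?thesis by (simp only: avg mult_zero_right diff_zero)
  qed
  note tan = cos_ge_tangent[OF u, folded m_def]
  have p: "(1 + \<kappa>) / 2 > 0" "(1 - \<kappa>) / 2 > 0" using \<kappa> by auto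
  let ?L = "\<lambda>v. cos u - m * (v\<^sup>2 - u\<^sup>2)"
  have 1: "(1 + \<kappa>) / 2 * ?L (d + e) \<le> (1 + \<kappa>) / 2 * cos (d + e)"
    by (rule mult_left_mono[OF tan(1)]) (use p in simp)
  have 2: "(1 - \<kappa>) / 2 * ?L (d - e) \<le> (1 - \<kappa>) / 2 * cos (d - e)"
    by (rule mult_left_mono[OF tan(1)]) (use p in simp)
  show "cos (sqrt (a\<^sup>2 + (t / 2)\<^sup>2)) \<le> Re (fst (Exp_su2 \<theta> c t) * cis a)"
    unfolding Re u_def[symmetric] using 1 2 sum by linarith
  assume "a \<noteq> c * t / 2"
  then have "d * e \<noteq> 0" using e by (simp add: d_def)
  then have ne: "(d + e)\<^sup>2 \<noteq> (d - e)\<^sup>2" by (simp add: power2_eq_square algebra_simps)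
  \<comment> \<open>The tangent inequality is strict only below \<open>u\<close>. Two different
    squares with weighted mean u^2 cannot both be at least u^2.\<close>
  have "(d + e)\<^sup>2 < u\<^sup>2 \<or> (d - e)\<^sup>2 < u\<^sup>2"
  proof (rule ccontr)
    assume "\<not> ?thesis"
    then have *: "0 \<le> (d + e)\<^sup>2 - u\<^sup>2" "0 \<le> (d - e)\<^sup>2 - u\<^sup>2" by auto
    have "0 \<le> (1 + \<kappa>) / 2 * ((d + e)\<^sup>2 - u\<^sup>2)" "0 \<le> (1 - \<kappa>) / 2 * ((d - e)\<^sup>2 - u\<^sup>2)"
      using mult_nonneg_nonneg[OF less_imp_le[OF p(1)] *(1)] mult_nonneg_nonneg[OF less_imp_le[OF p(2)] *(2)]
      by blast+
    with avg have "(1 + \<kappa>) / 2 * ((d + e)\<^sup>2 - u\<^sup>2) = 0" "(1 - \<kappa>) / 2 * ((d - e)\<^sup>2 - u\<^sup>2) = 0"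
      by linarith+
    then have "(d + e)\<^sup>2 - u\<^sup>2 = 0" "(d - e)\<^sup>2 - u\<^sup>2 = 0"
      using p by (simp_all only: mult_eq_0_iff) linarith+
    with ne show False by simp
  qed
  then show "cos (sqrt (a\<^sup>2 + (t / 2)\<^sup>2)) < Re (fst (Exp_su2 \<theta> c t) * cis a)"
  proof
    assume "(d + e)\<^sup>2 < u\<^sup>2"
    from mult_strict_left_mono[OF tan(2)[OF this] p(1)] show ?thesis
      unfolding Re u_def[symmetric] using 2 sum by linarith
  next
    assume "(d - e)\<^sup>2 < u\<^sup>2"
    from mult_strict_left_mono[OF tan(2)[OF this] p(2)] show ?thesis
      unfolding Re u_def[symmetric] using 1 sum by linarith
  qed
qed

section \<open>Reaching every point by a geodesic with a tight certificate\<close>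

text \<open>Polar form of \<open>Exp_su2_eq\<close>: \<open>\<kappa>\<close> is |c| / w,
  \<open>\<tau>\<close> is w t / 2, \<open>\<sigma>\<close> is the sign of c, and \<open>r\<close>,
  \<open>A\<close> are the polar coordinates of the untwisted point cos \<tau> + i \<kappa> sin
  \<tau>. Undoing the twist subtracts |c| t / 2 = \<kappa> \<tau> from the angle. The last
  conclusions record that the curve inequality is an equality for this frame angle.\<close>

lemma Exp_su2_param:
  fixes \<kappa> \<tau> A r \<sigma> :: real and \<alpha> \<beta> :: complex
  assumes \<kappa>: "0 \<le> \<kappa>" "\<kappa> < 1" and \<tau>: "0 < \<tau>" "\<tau> \<le> pi" and A: "A \<le> pi" "\<kappa> * \<tau> \<le> A"
    and rA: "r * cos A = cos \<tau>" "r * sin A = \<kappa> * sin \<tau>" and r: "r \<ge> 0" and \<sigma>: "\<bar>\<sigma>\<bar> = 1"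
    and \<alpha>: "\<alpha> = rcis r (\<sigma> * (A - \<kappa> * \<tau>))" and SU2: "(\<alpha>, \<beta>) \<in> SU2"
  shows "\<exists>\<theta> c t \<phi>. Exp_su2 \<theta> c t = (\<alpha>, \<beta>) \<and> t > 0 \<and> 0 \<le> \<phi> \<and> Re \<alpha> = cmod \<alpha> * cos \<phi> \<and>
    \<phi> + \<bar>c * t / 2\<bar> \<le> pi \<and> \<bar>c * t / 2\<bar>\<^sup>2 + (t / 2)\<^sup>2 \<le> pi\<^sup>2 \<and>
    cmod \<alpha> * cos (\<phi> + \<bar>c * t / 2\<bar>) = cos (sqrt (\<bar>c * t / 2\<bar>\<^sup>2 + (t / 2)\<^sup>2))"
proof -
  define k where "k = sqrt (1 - \<kappa>\<^sup>2)"
  have k2: "k\<^sup>2 = 1 - \<kappa>\<^sup>2" and k: "k > 0"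
    using \<kappa> by (simp_all add: k_def power_le_one_iff power_less_one_iff)
  \<comment> \<open>\<open>c\<close> and \<open>t\<close> solve the equations for
    \<open>\<kappa>\<close> and \<open>\<tau>\<close>; here \<open>k\<close> is 1 / w.\<close>
  define c where "c = \<sigma> * \<kappa> / k"
  define t where "t = 2 * \<tau> * k"
  define \<theta> where "\<theta> = Arg \<beta> - c * t / 2"
  have \<sigma>2: "\<sigma>\<^sup>2 = 1" using \<sigma> by (metis one_power2 power2_abs)
  have \<sigma>': "\<sigma> = 1 \<or> \<sigma> = -1" using \<sigma> by linarith
  have ct: "c * t / 2 = \<sigma> * (\<kappa> * \<tau>)" using k by (simp add: c_def t_def)
  have act: "\<bar>c * t / 2\<bar> = \<kappa> * \<tau>" unfolding ct using \<sigma> \<kappa> \<tau> by (simp add: abs_mult)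
  have "1 + c\<^sup>2 = (k\<^sup>2 + \<kappa>\<^sup>2) / k\<^sup>2" using k by (simp add: c_def power_divide power_mult_distrib \<sigma>2 field_simps)
  then have "1 + c\<^sup>2 = (1 / k)\<^sup>2" by (simp add: k2 power_divide)
  then have w: "sqrt (1 + c\<^sup>2) = 1 / k" using k by simp
  have wt: "sqrt (1 + c\<^sup>2) * t / 2 = \<tau>" unfolding w t_def using k by simp
  have cw: "c / sqrt (1 + c\<^sup>2) = \<sigma> * \<kappa>" unfolding w using k by (simp add: c_def)
  have "Complex (cos \<tau>) (\<sigma> * \<kappa> * sin \<tau>) = rcis r (\<sigma> * A)"
    using \<sigma>' rA by (auto simp: complex_eq_iff)
  then have 1: "cis (- (c * t / 2)) * Complex (cos \<tau>) (\<sigma> * \<kappa> * sin \<tau>) = \<alpha>"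
    unfolding \<alpha> ct by (simp add: cis_rcis_eq rcis_mult algebra_simps)
  have cm: "cmod \<alpha> = r" using r by (simp add: \<alpha>)
  have "(cmod \<beta>)\<^sup>2 = 1 - r\<^sup>2" using SU2 cm by (simp add: SU2_def)
  also have "\<dots> = (sin \<tau> * k)\<^sup>2"
  proof -
    have "r\<^sup>2 = (r * cos A)\<^sup>2 + (r * sin A)\<^sup>2"
      by (simp add: power_mult_distrib flip: distrib_left)
    then show ?thesis unfolding rA
      by (simp add: power_mult_distrib k2 cos_squared_eq algebra_simps)
  qed
  finally have "cmod \<beta> = sin \<tau> * k"
    by (rule power2_eq_imp_eq) (use k \<tau> in \<open>auto intro!: mult_nonneg_nonneg sin_ge_zero\<close>)
  then have 2: "cis (\<theta> + c * t / 2) * of_real (sin \<tau> / sqrt (1 + c\<^sup>2)) = \<beta>"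
    unfolding w \<theta>_def using rcis_cmod_Arg[of \<beta>] by (simp add: rcis_def mult.commute)
  have E: "Exp_su2 \<theta> c t = (\<alpha>, \<beta>)"
    unfolding Exp_su2_eq wt cw 1 2 ..
  have b: "(\<kappa> * \<tau>)\<^sup>2 + (t / 2)\<^sup>2 = \<tau>\<^sup>2"
    by (simp add: t_def power_mult_distrib k2 algebra_simps)
  have Re: "Re \<alpha> = r * cos (A - \<kappa> * \<tau>)"
    unfolding \<alpha> using \<sigma>' by (elim disjE) (simp_all del: minus_diff_eq)
  have \<tau>2: "\<tau>\<^sup>2 \<le> pi\<^sup>2" using \<tau> by (intro power_mono) auto
  have sqrt: "sqrt (\<tau>\<^sup>2) = \<tau>" using \<tau> by simp
  show ?thesis
  proof (intro exI conjI)
    show "Exp_su2 \<theta> c t = (\<alpha>, \<beta>)" by (rule E)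
    show "t > 0" using \<tau> k by (simp add: t_def)
    show "0 \<le> A - \<kappa> * \<tau>" using A by simp
    show "Re \<alpha> = cmod \<alpha> * cos (A - \<kappa> * \<tau>)" unfolding cm by (rule Re)
    show "A - \<kappa> * \<tau> + \<bar>c * t / 2\<bar> \<le> pi" unfolding act using A by simp
    show "\<bar>c * t / 2\<bar>\<^sup>2 + (t / 2)\<^sup>2 \<le> pi\<^sup>2" unfolding act b by (rule \<tau>2)
    show "cmod \<alpha> * cos (A - \<kappa> * \<tau> + \<bar>c * t / 2\<bar>) = cos (sqrt (\<bar>c * t / 2\<bar>\<^sup>2 + (t / 2)\<^sup>2))"
      unfolding act b sqrt cm using rA(1) by simp
  qed
qed

text \<open>For fixed modulus r in (0, 1) the untwisted angle \<open>A\<close> determines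
  \<open>\<tau>\<close> and \<open>\<kappa>\<close>. The resulting |arg \<alpha>|, namely A -
  \<kappa> \<tau>, is continuous in A and runs from 0 to pi, so the prescribed phase is
  attained.\<close>

lemma Exp_su2_surj:
  assumes g: "g \<in> SU2" and ne: "fst g \<noteq> 1"
  shows "\<exists>\<theta> c t \<phi>. Exp_su2 \<theta> c t = g \<and> t > 0 \<and> 0 \<le> \<phi> \<and> Re (fst g) = cmod (fst g) * cos \<phi> \<and>
    \<phi> + \<bar>c * t / 2\<bar> \<le> pi \<and> \<bar>c * t / 2\<bar>\<^sup>2 + (t / 2)\<^sup>2 \<le> pi\<^sup>2 \<and>
    cmod (fst g) * cos (\<phi> + \<bar>c * t / 2\<bar>) = cos (sqrt (\<bar>c * t / 2\<bar>\<^sup>2 + (t / 2)\<^sup>2))"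
proof -
  obtain \<alpha> \<beta> where gab: "g = (\<alpha>, \<beta>)" by force
  define r where "r = cmod \<alpha>"
  have r: "0 \<le> r" "r \<le> 1" using norm_fst_SU2_le[OF g] by (auto simp: r_def gab)
  define \<phi> where "\<phi> = \<bar>Arg \<alpha>\<bar>"
  obtain \<sigma> :: real where \<sigma>: "\<bar>\<sigma>\<bar> = 1" "\<sigma> * \<phi> = Arg \<alpha>"
  proof (cases "Arg \<alpha> \<ge> 0")
    case True
    then show ?thesis by (intro that[of 1]) (auto simp: \<phi>_def)
  next
    case False
    then show ?thesis by (intro that[of "-1"]) (auto simp: \<phi>_def)
  qed
  have \<phi>: "0 \<le> \<phi>" "\<phi> \<le> pi" using Arg_bounded[of \<alpha>] by (auto simp: \<phi>_def)
  have \<alpha>: "\<alpha> = rcis r (\<sigma> * \<phi>)" by (simp add: \<sigma> r_def rcis_cmod_Arg)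
  have SU2: "(\<alpha>, \<beta>) \<in> SU2" using g gab by simp
  consider "r = 0" | "r = 1" | "0 < r" "r < 1" using r by linarith
  then obtain \<kappa> \<tau> A where "0 \<le> \<kappa>" "\<kappa> < 1" "0 < \<tau>" "\<tau> \<le> pi" "A \<le> pi" "\<kappa> * \<tau> \<le> A"
    "r * cos A = cos \<tau>" "r * sin A = \<kappa> * sin \<tau>" "\<alpha> = rcis r (\<sigma> * (A - \<kappa> * \<tau>))"
  proof cases
    case 1
    \<comment> \<open>If \<alpha> = 0 there is no phase to match; these values mean c = 0 and t =
      pi.\<close>
    then show ?thesis using that[of 0 "pi / 2" 0] \<alpha> by simp
  next
    case 2
    \<comment> \<open>For r = 1 the sine of \<open>\<tau>\<close> must vanish, so the great circle
      is followed up to its antipode, \<tau> = A = pi, and \<open>\<kappa>\<close> is solved from A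
      - \<kappa> \<tau> = \<phi>. It is less than 1 because \<alpha> is not 1.\<close>
    have "\<phi> \<noteq> 0" using \<alpha> ne 2 by (auto simp: gab)
    then have "\<phi> > 0" using \<phi> by simp
    then show ?thesis
      using \<phi> \<alpha> 2 by (intro that[of "1 - \<phi> / pi" pi pi]) (auto simp: field_simps)
  next
    case 3
    let ?D = "\<lambda>A. 1 - (r * cos A)\<^sup>2"
    let ?k = "\<lambda>A. r * sin A / sqrt (?D A)"
    let ?h = "\<lambda>A. A - ?k A * arccos (r * cos A)"
    have rc: "\<bar>r * cos A\<bar> < 1" for A
    proof -
      have "r * \<bar>cos A\<bar> \<le> r * 1" using 3 by (intro mult_left_mono) auto
      then show ?thesis using 3 by (simp only: abs_mult abs_of_pos)
    qed
    then have D: "?D A > 0" for A using abs_square_less_1[of "r * cos A"] by simp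
    have rc': "-1 < r * cos A" "r * cos A < 1" for A
      using rc[of A] by (simp_all only: abs_less_iff) linarith+
    have "continuous_on {0..pi} ?h"
      using D rc' by (intro continuous_intros) (auto simp: less_imp_le less_imp_neq[THEN not_sym])
    then obtain A where A: "0 \<le> A" "A \<le> pi" "?h A = \<phi>"
      using IVT'[of ?h 0 \<phi> pi] \<phi> by auto
    define \<tau> where "\<tau> = arccos (r * cos A)"
    have \<tau>: "0 < \<tau>" "\<tau> \<le> pi" "cos \<tau> = r * cos A"
      using rc'[of A] arccos_lt_bounded[of "r * cos A"] by (auto simp: \<tau>_def)
    have st: "sin \<tau> = sqrt (?D A)"
      using rc'[of A] by (simp add: \<tau>_def sin_arccos)
    have k0: "0 \<le> ?k A" using A 3 D[of A] by (auto intro!: divide_nonneg_pos mult_nonneg_nonneg sin_ge_zero)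
    have "(r * sin A)\<^sup>2 < ?D A"
    proof -
      have "(r * sin A)\<^sup>2 + (r * cos A)\<^sup>2 = r\<^sup>2"
        by (simp add: power_mult_distrib flip: distrib_left)
      moreover have "r\<^sup>2 < 1" using 3 by (simp add: power_less_one_iff)
      ultimately show ?thesis by linarith
    qed
    then have "r * sin A < sqrt (?D A)" by (rule real_less_rsqrt)
    then have k1: "?k A < 1" using D[of A] by simp
    show ?thesis
    proof (rule that[of "?k A" \<tau> A])
      show "?k A * \<tau> \<le> A" using A \<phi> by (simp add: \<tau>_def)
      show "r * sin A = ?k A * sin \<tau>" unfolding st using D[of A] by simp
      show "\<alpha> = rcis r (\<sigma> * (A - ?k A * \<tau>))" using A(3) \<alpha> by (simp add: \<tau>_def)
    qed (use k0 k1 \<tau> A in auto)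
  qed
  from Exp_su2_param[OF this(1-8) r(1) \<sigma>(1) this(9) SU2] show ?thesis
    unfolding gab by simp
qed

text \<open>
  Interpolating the frame rotation \<open>a\<^sub>1\<close> linearly to \<open>0\<close>, as the phase goes from \<open>\<phi>\<close> to \<open>pi\<close>, turns the
  optimal certificate for the phase \<open>\<phi>\<close> into one for every larger phase.
\<close>

lemma certificate_mono:
  fixes \<alpha> :: complex and \<phi> a\<^sub>1 b\<^sub>1 :: real
  assumes r: "cmod \<alpha> = r" "r \<le> 1" and \<phi>: "0 \<le> \<phi>" and a1: "0 \<le> a\<^sub>1" "\<phi> + a\<^sub>1 \<le> pi" and b1: "b\<^sub>1 > 0"
    and ab: "a\<^sub>1\<^sup>2 + b\<^sub>1\<^sup>2 \<le> pi\<^sup>2" and eq: "r * cos (\<phi> + a\<^sub>1) = cos (sqrt (a\<^sub>1\<^sup>2 + b\<^sub>1\<^sup>2))"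
    and le: "Re \<alpha> \<le> r * cos \<phi>"
  shows "\<exists>a b. b\<^sub>1 \<le> b \<and> (Re \<alpha> < r * cos \<phi> \<longrightarrow> b\<^sub>1 < b) \<and> a\<^sup>2 + b\<^sup>2 \<le> pi\<^sup>2 \<and>
    Re (\<alpha> * cis a) \<le> cos (sqrt (a\<^sup>2 + b\<^sup>2))"
proof (cases "r = 0")
  case True
  \<comment> \<open>With modulus 0 the phase is irrelevant and the given certificate already
    serves.\<close>
  then show ?thesis using r ab eq by (intro exI[of _ a\<^sub>1] exI[of _ b\<^sub>1]) simp
next
  case False
  then have r0: "r > 0" using r norm_ge_zero[of \<alpha>] by linarith
  define \<psi> where "\<psi> = \<bar>Arg \<alpha>\<bar>"
  obtain \<sigma> :: real where \<sigma>: "\<sigma> = 1 \<or> \<sigma> = -1" "\<sigma> * \<psi> = Arg \<alpha>"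
  proof (cases "Arg \<alpha> \<ge> 0")
    case True
    then show ?thesis by (intro that[of 1]) (auto simp: \<psi>_def)
  next
    case False
    then show ?thesis by (intro that[of "-1"]) (auto simp: \<psi>_def)
  qed
  have \<psi>: "0 \<le> \<psi>" "\<psi> \<le> pi" using Arg_bounded[of \<alpha>] by (auto simp: \<psi>_def)
  have \<alpha>: "\<alpha> = rcis r (\<sigma> * \<psi>)" using rcis_cmod_Arg[of \<alpha>] r by (simp add: \<sigma>)
  have Re: "Re \<alpha> = r * cos \<psi>" unfolding \<alpha> using \<sigma>(1) by auto
  have "\<phi> \<le> \<psi>" using le r0 \<phi> a1 \<psi> cos_mono_le_eq[of \<psi> \<phi>] unfolding Re by simp
  show ?thesis
  proof (cases "\<phi> = \<psi>")
    case True
    have "Re (\<alpha> * cis (\<sigma> * a\<^sub>1)) = cos (sqrt (a\<^sub>1\<^sup>2 + b\<^sub>1\<^sup>2))"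
      using \<sigma>(1) eq unfolding \<alpha> cis_rcis_eq rcis_mult True by (auto simp: cos_add sin_add)
    moreover have "(\<sigma> * a\<^sub>1)\<^sup>2 = a\<^sub>1\<^sup>2" using \<sigma>(1) by auto
    ultimately show ?thesis
      using ab True Re by (intro exI[of _ "\<sigma> * a\<^sub>1"] exI[of _ b\<^sub>1]) simp
  next
    case False
    with \<open>\<phi> \<le> \<psi>\<close> have lt: "\<phi> < \<psi>" by simp
    define s where "s = (\<psi> - \<phi>) / (pi - \<phi>)"
    have s: "0 < s" "s \<le> 1" and s': "s * (pi - \<phi>) = \<psi> - \<phi>" using lt \<psi> by (auto simp: s_def)
    define a where "a = a\<^sub>1 - s * a\<^sub>1"
    have a: "0 \<le> a" "a \<le> a\<^sub>1" using s a1 by (auto simp: a_def mult_left_le_one_le)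
    have psa: "\<psi> + a = \<phi> + a\<^sub>1 + s * (pi - (\<phi> + a\<^sub>1))" using s' by (simp add: a_def algebra_simps)
    have sA: "0 \<le> s * (pi - (\<phi> + a\<^sub>1))" "s * (pi - (\<phi> + a\<^sub>1)) \<le> pi - (\<phi> + a\<^sub>1)"
      using s a1 by (auto intro: mult_left_le_one_le)
    define c where "c = r * cos (\<psi> + a)"
    define \<tau> where "\<tau> = sqrt (a\<^sub>1\<^sup>2 + b\<^sub>1\<^sup>2)"
    have \<tau>: "0 \<le> \<tau>" "\<tau> \<le> pi" using ab by (auto simp: \<tau>_def real_le_lsqrt)
    have c1: "\<bar>c\<bar> \<le> 1" unfolding c_def
      using mult_mono[OF r(2) abs_cos_le_one[of "\<psi> + a"]] r0 by (simp add: abs_mult)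
    have cle: "c \<le> cos \<tau>"
      unfolding c_def \<tau>_def eq[symmetric]
      using r0 sA \<phi> a1 unfolding psa by (intro mult_left_mono cos_monotone_0_pi_le) auto
    define \<tau>\<^sub>0 where "\<tau>\<^sub>0 = arccos c"
    have ac: "arccos (cos \<tau>) = \<tau>" using \<tau> by (rule arccos_cos)
    have \<tau>0: "\<tau> \<le> \<tau>\<^sub>0" "\<tau>\<^sub>0 \<le> pi" "cos \<tau>\<^sub>0 = c"
      using arccos_le_mono[of c "cos \<tau>"] c1 cle ac arccos_ubound[of c] cos_arccos_abs[OF c1]
      by (auto simp: \<tau>\<^sub>0_def abs_le_iff minus_le_iff)
    \<comment> \<open>If the old frame angle is positive, the new one is smaller; if it is 0, the
      phase itself has grown and the arc becomes longer. Either way \<open>b\<close> must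
      grow.\<close>
    have strict: "a < a\<^sub>1 \<or> \<tau> < \<tau>\<^sub>0"
    proof (cases "a\<^sub>1 = 0")
      case False
      then show ?thesis using s a1 by (auto simp: a_def)
    next
      case True
      then have "cos (\<psi> + a) < cos (\<phi> + a\<^sub>1)"
        using lt \<phi> \<psi> by (simp add: a_def cos_monotone_0_pi)
      then have "c < cos \<tau>" unfolding c_def \<tau>_def eq[symmetric] using r0 by simp
      then show ?thesis using \<tau>0 by (cases "\<tau> = \<tau>\<^sub>0") auto
    qed
    \<comment> \<open>This \<open>b\<close> makes sqrt (a^2 + b^2) equal to
      \<open>\<tau>\<^sub>0\<close>, that is, the certificate is again an equality.\<close>
    define b where "b = sqrt (\<tau>\<^sub>0\<^sup>2 - a\<^sup>2)"
    have a2: "a\<^sup>2 \<le> a\<^sub>1\<^sup>2" using a by (intro power_mono) auto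
    have t2: "\<tau>\<^sup>2 \<le> \<tau>\<^sub>0\<^sup>2" using \<tau> \<tau>0 by (intro power_mono) auto
    have tt: "\<tau>\<^sup>2 = a\<^sub>1\<^sup>2 + b\<^sub>1\<^sup>2" by (simp add: \<tau>_def)
    have st2: "a\<^sup>2 < a\<^sub>1\<^sup>2 \<or> \<tau>\<^sup>2 < \<tau>\<^sub>0\<^sup>2"
      using strict power_strict_mono[of a a\<^sub>1 2] power_strict_mono[of \<tau> \<tau>\<^sub>0 2] a(1) \<tau>(1) by linarith
    have "b\<^sub>1\<^sup>2 < \<tau>\<^sub>0\<^sup>2 - a\<^sup>2" using a2 t2 tt st2 by linarith
    then have bb: "b\<^sub>1 < b" unfolding b_def by (rule real_less_rsqrt)
    have "0 \<le> \<tau>\<^sub>0\<^sup>2 - a\<^sup>2" using a2 t2 tt zero_le_power2[of b\<^sub>1] by linarith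
    then have b2: "a\<^sup>2 + b\<^sup>2 = \<tau>\<^sub>0\<^sup>2" unfolding b_def by simp
    have t0: "0 \<le> \<tau>\<^sub>0" using \<tau> \<tau>0 by linarith
    have Rea: "Re (\<alpha> * cis (\<sigma> * a)) = cos \<tau>\<^sub>0"
      unfolding \<tau>0(3) c_def using \<sigma>(1) unfolding \<alpha> cis_rcis_eq rcis_mult by (auto simp: cos_add sin_add)
    have \<sigma>a: "(\<sigma> * a)\<^sup>2 + b\<^sup>2 = \<tau>\<^sub>0\<^sup>2" using \<sigma>(1) b2 by auto
    have sqrt: "sqrt (\<tau>\<^sub>0\<^sup>2) = \<tau>\<^sub>0" using t0 by simp
    show ?thesis
    proof (intro exI conjI)
      show "b\<^sub>1 \<le> b" using bb by simp
      show "Re \<alpha> < r * cos \<phi> \<longrightarrow> b\<^sub>1 < b" using bb by simp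
      show "(\<sigma> * a)\<^sup>2 + b\<^sup>2 \<le> pi\<^sup>2" unfolding \<sigma>a using t0 \<tau>0 by (intro power_mono) auto
      show "Re (\<alpha> * cis (\<sigma> * a)) \<le> cos (sqrt ((\<sigma> * a)\<^sup>2 + b\<^sup>2))" unfolding \<sigma>a sqrt Rea ..
    qed
  qed
qed

lemma cos_sqrt_strict_antimono:
  assumes "0 \<le> b'" "b' < b" "a\<^sup>2 + b\<^sup>2 \<le> pi\<^sup>2"
  shows "cos (sqrt (a\<^sup>2 + b\<^sup>2)) < cos (sqrt (a\<^sup>2 + b'\<^sup>2))"
proof (rule cos_monotone_0_pi)
  have "b'\<^sup>2 < b\<^sup>2" using assms by (intro power_strict_mono) auto
  then show "sqrt (a\<^sup>2 + b'\<^sup>2) < sqrt (a\<^sup>2 + b\<^sup>2)" by simp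
  show "sqrt (a\<^sup>2 + b\<^sup>2) \<le> pi" using assms by (simp add: real_le_lsqrt)
qed simp

section \<open>Smooth functions and submanifolds\<close>

lemma k_smooth_on_const: "k_smooth_on n U (\<lambda>_. c)"
proof (induction n arbitrary: c)
  case (Suc n)
  then show ?case by (simp add: frechet_derivative_const)
qed simp

text \<open>The recursion in \<open>k_smooth_on\<close> ends after one step: directional derivatives
  of an affine map are constants.\<close>

lemma
  assumes "bounded_linear L"
  shows frechet_derivative_affine: "frechet_derivative (\<lambda>x. L x + c) (at x) = L"
    and smooth_on_affine: "smooth_on U (\<lambda>x. L x + c)"
proof -
  have D: "((\<lambda>x. L x + c) has_derivative L) (at x)" for x
    using has_derivative_add[OF bounded_linear_imp_has_derivative[OF assms] has_derivative_const] by simp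
  then show F: "frechet_derivative (\<lambda>x. L x + c) (at x) = L" for x
    by (metis frechet_derivative_at)
  show "smooth_on U (\<lambda>x. L x + c)"
    unfolding smooth_on_def
  proof
    fix n
    show "k_smooth_on n U (\<lambda>x. L x + c)"
    proof (cases n)
      case 0
      then show ?thesis
        by (simp add: continuous_intros bounded_linear.continuous_on[OF assms] continuous_on_add)
    next
      case (Suc m)
      then show ?thesis
        using D by (auto simp: F k_smooth_on_const differentiable_def)
    qed
  qed
qed

text \<open>Directional derivatives of a square norm are linear, which reduces smoothness to the
  affine case. The defining functions of all strata are of these two kinds.\<close>

lemma
  fixes P :: "'a::euclidean_space \<Rightarrow> 'b::euclidean_space"
  assumes P: "bounded_linear P"
  shows frechet_derivative_square: "frechet_derivative (\<lambda>x. P x \<bullet> P x + c) (at x) = (\<lambda>v. 2 * (P x \<bullet> P v))"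
    and smooth_on_square: "smooth_on U (\<lambda>x. P x \<bullet> P x + c)"
proof -
  have dP: "(P has_derivative P) (at x)" for x by (rule bounded_linear_imp_has_derivative[OF P])
  have D: "((\<lambda>x. P x \<bullet> P x + c) has_derivative (\<lambda>v. 2 * (P x \<bullet> P v))) (at x)" for x
    by (rule derivative_eq_intros dP refl)+ (simp add: inner_commute)
  then show F: "frechet_derivative (\<lambda>x. P x \<bullet> P x + c) (at x) = (\<lambda>v. 2 * (P x \<bullet> P v))" for x
    by (metis frechet_derivative_at)
  show "smooth_on U (\<lambda>x. P x \<bullet> P x + c)"
    unfolding smooth_on_def
  proof
    fix n
    show "k_smooth_on n U (\<lambda>x. P x \<bullet> P x + c)"
    proof (cases n)
      case 0
      then show ?thesis
        by (auto intro!: continuous_intros bounded_linear.continuous_on[OF P])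
    next
      case (Suc m)
      have "bounded_linear (\<lambda>x. 2 * (P x \<bullet> P v))" for v
        by (intro bounded_linear_const_mult bounded_linear_compose[OF bounded_linear_inner_left P])
      then have "k_smooth_on m U (\<lambda>x. 2 * (P x \<bullet> P v))" for v
        using smooth_on_affine[of "\<lambda>x. 2 * (P x \<bullet> P v)" U 0] by (simp add: smooth_on_def)
      then show ?thesis
        using D Suc by (auto simp: F differentiable_def)
    qed
  qed
qed

lemma mem_SU2_iff_inner: "g \<in> SU2 \<longleftrightarrow> fst g \<bullet> fst g + snd g \<bullet> snd g + -1 = 0"
  by (auto simp: SU2_def case_prod_beta dot_square_norm)

text \<open>Once the other points are removed, the four real coordinates centred at x cut out
  x.\<close>

lemma submanifold_finite:
  fixes S :: "(complex \<times> complex) set"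
  assumes "finite S"
  shows "submanifold 0 S"
  unfolding submanifold_def
proof (intro exI[of _ 4] conjI ballI)
  fix x assume x: "x \<in> S"
  let ?U = "- (S - {x})"
  let ?L = "\<lambda>i y. [Re (fst y), Im (fst y), Re (snd y), Im (snd y)] ! i"
  let ?c = "\<lambda>i. - ?L i x"
  have L: "bounded_linear (?L i)" if "i < 4" for i
  proof -
    have "i = 0 \<or> i = 1 \<or> i = 2 \<or> i = 3" using that by auto
    then show ?thesis
      by (auto intro: bounded_linear_compose[OF bounded_linear_Re bounded_linear_fst] bounded_linear_compose[OF bounded_linear_Im bounded_linear_fst]
        bounded_linear_compose[OF bounded_linear_Re bounded_linear_snd] bounded_linear_compose[OF bounded_linear_Im bounded_linear_snd])
  qed
  have All4: "(\<forall>i<4. P i) \<longleftrightarrow> P 0 \<and> P 1 \<and> P 2 \<and> P 3" for P :: "nat \<Rightarrow> bool"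
    by (auto simp: numeral_eq_Suc All_less_Suc)
  show "\<exists>U f. open U \<and> x \<in> U \<and> (\<forall>i<4. smooth_on U (f i)) \<and> S \<inter> U = {y \<in> U. \<forall>i<4. f i y = (0::real)} \<and>
     (\<forall>y \<in> S \<inter> U. \<forall>c :: nat \<Rightarrow> real. \<exists>v. \<forall>i<4. frechet_derivative (f i) (at y) v = c i)"
  proof (intro exI[of _ ?U] exI[of _ "\<lambda>i y. ?L i y + ?c i"] conjI ballI allI impI)
    show "open ?U" by (intro open_Compl finite_imp_closed) (use assms in simp)
    show "smooth_on ?U (\<lambda>y. ?L i y + ?c i)" if "i < 4" for i
      by (rule smooth_on_affine[OF L[OF that]])
    show "S \<inter> ?U = {y \<in> ?U. \<forall>i<4. ?L i y + ?c i = 0}"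
      using x by (auto simp: All4 prod_eq_iff complex_eq_iff)
    fix y and c :: "nat \<Rightarrow> real"
    let ?v = "(Complex (c 0) (c 1), Complex (c 2) (c 3))"
    have "frechet_derivative (\<lambda>y. ?L i y + ?c i) (at y) ?v = c i" if "i < 4" for i
    proof -
      have "i = 0 \<or> i = 1 \<or> i = 2 \<or> i = 3" using that by auto
      then show ?thesis unfolding frechet_derivative_affine[OF L[OF that]] by auto
    qed
    then show "\<exists>v. \<forall>i<4. frechet_derivative (\<lambda>y. ?L i y + ?c i) (at y) v = c i" by blast
  qed (use x in auto)
qed simp

lemma All_less_3: "(\<forall>i<3. P i) \<longleftrightarrow> P 0 \<and> P 1 \<and> P (2::nat)"
  by (auto simp: numeral_eq_Suc All_less_Suc)

lemma All_less_2: "(\<forall>i<2. P i) \<longleftrightarrow> P 0 \<and> P (1::nat)"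
  by (auto simp: numeral_eq_Suc All_less_Suc)

text \<open>\<open>P\<close> and \<open>Q\<close> stand for the two complex coordinates in either
  order: Q = 0 gives two linear equations and the sphere gives |P| = 1. The open set
  \<open>W\<close> allows for punctures.\<close>

lemma submanifold_circle:
  fixes P Q :: "complex \<times> complex \<Rightarrow> complex"
  assumes P: "bounded_linear P" and Q: "bounded_linear Q" and W: "open W"
    and surj: "\<And>a b. \<exists>v. P v = a \<and> Q v = b"
    and SU2: "\<And>g. Q g = 0 \<Longrightarrow> g \<in> SU2 \<longleftrightarrow> P g \<bullet> P g = 1"
  shows "submanifold 1 {g \<in> SU2. Q g = 0 \<and> g \<in> W}" (is "submanifold 1 ?S")
  unfolding submanifold_def
proof (intro exI[of _ 3] conjI ballI)
  fix x assume x: "x \<in> ?S"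
  let ?f = "\<lambda>i y. if i = (0::nat) then Re (Q y) + 0 else if i = 1 then Im (Q y) + 0 else P y \<bullet> P y + -1"
  have QR: "bounded_linear (\<lambda>y. Re (Q y))" and QI: "bounded_linear (\<lambda>y. Im (Q y))"
    using bounded_linear_compose[OF bounded_linear_Re Q] bounded_linear_compose[OF bounded_linear_Im Q] by simp_all
  note fd = frechet_derivative_affine[OF QR] frechet_derivative_affine[OF QI] frechet_derivative_square[OF P]
  show "\<exists>U f. open U \<and> x \<in> U \<and> (\<forall>i<3. smooth_on U (f i)) \<and> ?S \<inter> U = {y \<in> U. \<forall>i<3. f i y = (0::real)} \<and>
     (\<forall>y \<in> ?S \<inter> U. \<forall>c :: nat \<Rightarrow> real. \<exists>v. \<forall>i<3. frechet_derivative (f i) (at y) v = c i)"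
  proof (intro exI[of _ W] exI[of _ ?f] conjI ballI)
    show "\<forall>i<3. smooth_on W (?f i)"
      unfolding All_less_3 using smooth_on_affine[OF QR, of W 0] smooth_on_affine[OF QI, of W 0] smooth_on_square[OF P, of W "-1"]
      by simp
    show "?S \<inter> W = {y \<in> W. \<forall>i<3. ?f i y = 0}"
    proof -
      have "Q y = 0 \<longleftrightarrow> Re (Q y) = 0 \<and> Im (Q y) = 0" for y by (simp add: complex_eq_iff)
      then have "y \<in> ?S \<inter> W \<longleftrightarrow> y \<in> {y \<in> W. \<forall>i<3. ?f i y = 0}" for y
        using SU2[of y] unfolding All_less_3 by auto
      then show ?thesis by blast
    qed
    fix y assume y: "y \<in> ?S \<inter> W"
    then have PP: "P y \<bullet> P y = 1" using SU2[of y] by simp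
    show "\<forall>c :: nat \<Rightarrow> real. \<exists>v. \<forall>i<3. frechet_derivative (?f i) (at y) v = c i"
    proof
      fix c :: "nat \<Rightarrow> real"
      \<comment> \<open>A radial displacement of \<open>P\<close> changes its square norm at twice
        the rate, hence the factor 1/2.\<close>
      obtain v where v: "P v = (c 2 / 2) *\<^sub>R P y" "Q v = Complex (c 0) (c 1)" using surj by blast
      show "\<exists>v. \<forall>i<3. frechet_derivative (?f i) (at y) v = c i"
      proof (rule exI[of _ v], unfold All_less_3, intro conjI)
        show "frechet_derivative (?f 0) (at y) v = c 0" using fd(1)[of 0 y] v by simp
        show "frechet_derivative (?f 1) (at y) v = c 1" using fd(2)[of 0 y] v by simp
        show "frechet_derivative (?f 2) (at y) v = c 2" using fd(3)[of "-1" y] v PP by simp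
      qed
    qed
  qed (use W x in auto)
qed simp

text \<open>The equation confines the first coordinate to \<open>n\<close> rays from 0. Near a given
  point only one ray matters, and there the equation may be replaced by the linear one saying that
  the first coordinate is a real multiple of that of the point.\<close>

lemma submanifold_rays:
  fixes n :: nat
  assumes n: "n > 0"
  shows "submanifold 2 {g \<in> SU2. fst g \<noteq> 0 \<and> snd g \<noteq> 0 \<and> fst g ^ n = - of_real (cmod (fst g) ^ n)}" (is "submanifold 2 ?S")
  unfolding submanifold_def
proof (intro exI[of _ 2] conjI ballI)
  fix x assume x: "x \<in> ?S"
  define \<alpha>\<^sub>0 where "\<alpha>\<^sub>0 = fst x"
  have a0: "\<alpha>\<^sub>0 \<noteq> 0" "\<alpha>\<^sub>0 ^ n = - (of_real (cmod \<alpha>\<^sub>0) ^ n)" using x by (auto simp: \<alpha>\<^sub>0_def)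
  let ?f = "\<lambda>i y :: complex \<times> complex. if i = (0::nat) then Im (fst y * cnj \<alpha>\<^sub>0) + 0 else y \<bullet> y + -1"
  let ?R = "{\<omega>::complex. \<omega> ^ n = 1} - {1}"
  let ?B = "\<lambda>\<omega>. {y :: complex \<times> complex. Im (fst y * cnj (\<omega> * \<alpha>\<^sub>0)) = 0 \<and> 0 \<le> Re (fst y * cnj (\<omega> * \<alpha>\<^sub>0))}"
  \<comment> \<open>The half-plane around \<open>\<alpha>\<^sub>0\<close> turns the real line
    through it into a ray; the finitely many other closed rays are removed.\<close>
  let ?U = "{y :: complex \<times> complex. 0 < Re (fst y * cnj \<alpha>\<^sub>0)} \<inter> {y. snd y \<noteq> 0} \<inter> - (\<Union>\<omega>\<in>?R. ?B \<omega>)"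
  have fin: "finite ?R" using finite_roots_unity[of n] n by simp
  have BL: "bounded_linear (\<lambda>y :: complex \<times> complex. Im (fst y * cnj \<alpha>\<^sub>0))"
    by (rule bounded_linear_compose[OF bounded_linear_Im bounded_linear_mult_const[OF bounded_linear_fst]])
  have U: "open ?U"
  proof (intro open_Int open_Compl)
    show "closed (\<Union>\<omega>\<in>?R. ?B \<omega>)"
      using fin unfolding Collect_conj_eq
      by (intro closed_UN closed_Int closed_Collect_eq closed_Collect_le ballI continuous_intros) auto
    show "open {y :: complex \<times> complex. 0 < Re (fst y * cnj \<alpha>\<^sub>0)}"
      by (intro open_Collect_less continuous_intros)
    show "open {y :: complex \<times> complex. snd y \<noteq> 0}"
      by (intro open_Collect_neq continuous_intros)
  qed
  have SU2: "y \<in> SU2 \<longleftrightarrow> y \<bullet> y + -1 = 0" for y :: "complex \<times> complex"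
    using mem_SU2_iff_inner[of y] by (simp add: inner_prod_def)
  have dir: "\<exists>\<omega> s. \<omega> ^ n = 1 \<and> s > 0 \<and> fst y = of_real s * (\<omega> * \<alpha>\<^sub>0)" if "y \<in> ?S" for y
  proof -
    have y: "fst y \<noteq> 0" "fst y ^ n = - (of_real (cmod (fst y)) ^ n)" using that by auto
    let ?s = "cmod (fst y) / cmod \<alpha>\<^sub>0"
    let ?\<omega> = "fst y / (of_real ?s * \<alpha>\<^sub>0)"
    have s: "?s > 0" using y(1) a0(1) by simp
    have "?\<omega> ^ n = 1"
      using a0 y by (simp add: power_divide power_mult_distrib)
    moreover have "fst y = of_real ?s * (?\<omega> * \<alpha>\<^sub>0)" using s a0 by simp
    ultimately show ?thesis using s by blast
  qed
  have inB: "of_real s * (\<omega> * \<alpha>\<^sub>0) * cnj (\<omega> * \<alpha>\<^sub>0) = of_real (s * (cmod (\<omega> * \<alpha>\<^sub>0))\<^sup>2)" for s \<omega>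
    unfolding of_real_mult complex_norm_square by (simp add: mult_ac)
  have memU: "y \<in> ?U \<Longrightarrow> y \<in> ?S \<longleftrightarrow> Im (fst y * cnj \<alpha>\<^sub>0) = 0 \<and> y \<in> SU2" for y
  proof
    assume yU: "y \<in> ?U" and yS: "y \<in> ?S"
    obtain \<omega> s where w: "\<omega> ^ n = 1" "s > 0" "fst y = of_real s * (\<omega> * \<alpha>\<^sub>0)" using dir[OF yS] by blast
    have "y \<in> ?B \<omega>"
      unfolding mem_Collect_eq w(3) inB using w(2) by simp
    then have "\<omega> = 1" using yU w(1) by blast
    then show "Im (fst y * cnj \<alpha>\<^sub>0) = 0 \<and> y \<in> SU2" using \<open>y \<in> ?B \<omega>\<close> yS by simp
  next
    assume yU: "y \<in> ?U" and y: "Im (fst y * cnj \<alpha>\<^sub>0) = 0 \<and> y \<in> SU2"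
    define \<rho> where "\<rho> = Re (fst y * cnj \<alpha>\<^sub>0)"
    have \<rho>: "\<rho> > 0" using yU by (simp add: \<rho>_def)
    have "fst y * cnj \<alpha>\<^sub>0 = of_real \<rho>" using y by (simp add: complex_eq_iff \<rho>_def)
    then have "fst y * (\<alpha>\<^sub>0 * cnj \<alpha>\<^sub>0) = of_real \<rho> * \<alpha>\<^sub>0" by (simp add: mult_ac)
    then have "fst y = of_real (\<rho> / (cmod \<alpha>\<^sub>0)\<^sup>2) * \<alpha>\<^sub>0"
      using a0(1) unfolding complex_norm_square[symmetric] by (simp add: field_simps)
    moreover define s where "s = \<rho> / (cmod \<alpha>\<^sub>0)\<^sup>2"
    ultimately have fy: "fst y = of_real s * \<alpha>\<^sub>0" by simp
    have s: "s > 0" using \<rho> a0(1) by (simp add: s_def)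
    have "fst y ^ n = - of_real (cmod (fst y) ^ n)"
      using s by (simp add: fy power_mult_distrib a0(2) norm_mult)
    then show "y \<in> ?S" using y yU s a0(1) fy by auto
  qed
  show "\<exists>U f. open U \<and> x \<in> U \<and> (\<forall>i<2. smooth_on U (f i)) \<and> ?S \<inter> U = {y \<in> U. \<forall>i<2. f i y = (0::real)} \<and>
     (\<forall>y \<in> ?S \<inter> U. \<forall>c :: nat \<Rightarrow> real. \<exists>v. \<forall>i<2. frechet_derivative (f i) (at y) v = c i)"
  proof (intro exI[of _ ?U] exI[of _ ?f] conjI ballI)
    show "open ?U" by (rule U)
    have "x \<notin> ?B \<omega>" if "\<omega> \<in> ?R" for \<omega>
    proof
      assume "x \<in> ?B \<omega>"
      then have "Im (\<alpha>\<^sub>0 * cnj \<alpha>\<^sub>0 * cnj \<omega>) = 0" "0 \<le> Re (\<alpha>\<^sub>0 * cnj \<alpha>\<^sub>0 * cnj \<omega>)"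
        by (simp_all add: \<alpha>\<^sub>0_def mult_ac)
      then have "Im \<omega> = 0" "0 \<le> Re \<omega>"
        using a0(1) unfolding complex_norm_square[symmetric] by (simp_all add: zero_le_mult_iff)
      moreover have "cmod \<omega> = 1"
      proof -
        have "cmod (\<omega> ^ n) = 1" using that by simp
        then show ?thesis using power_eq_1_iff[of "cmod \<omega>" n] n by (auto simp: norm_power)
      qed
      ultimately have "\<omega> = 1" by (simp add: complex_eq_iff cmod_def)
      then show False using that by simp
    qed
    moreover have "0 < Re (fst x * cnj \<alpha>\<^sub>0)"
      using a0(1) unfolding \<alpha>\<^sub>0_def[symmetric] complex_norm_square[symmetric] by simp
    ultimately show "x \<in> ?U" using x by blast
    show "\<forall>i<2. smooth_on ?U (?f i)"
      unfolding All_less_2 using smooth_on_affine[OF BL, of ?U 0] smooth_on_square[OF bounded_linear_ident, of ?U "-1"] by simp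
    show "?S \<inter> ?U = {y \<in> ?U. \<forall>i<2. ?f i y = 0}"
    proof -
      have "y \<in> ?S \<inter> ?U \<longleftrightarrow> y \<in> {y \<in> ?U. \<forall>i<2. ?f i y = 0}" for y
        using memU[of y] SU2[of y] unfolding All_less_2 by auto
      then show ?thesis by blast
    qed
    fix y assume y: "y \<in> ?S \<inter> ?U"
    then have sy: "snd y \<bullet> snd y \<noteq> 0" by simp
    show "\<forall>c :: nat \<Rightarrow> real. \<exists>v. \<forall>i<2. frechet_derivative (?f i) (at y) v = c i"
    proof
      fix c :: "nat \<Rightarrow> real"
      \<comment> \<open>The first component of \<open>v\<close> moves perpendicularly to the ray;
        the second one adjusts the norm, which is possible because \<open>snd y\<close> is not
        0.\<close>
      define u where "u = c 0 / (cmod \<alpha>\<^sub>0)\<^sup>2"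
      define v where "v = (of_real u * \<i> * \<alpha>\<^sub>0, ((c 1 / 2 - fst y \<bullet> (of_real u * \<i> * \<alpha>\<^sub>0)) / (snd y \<bullet> snd y)) *\<^sub>R snd y)"
      show "\<exists>v. \<forall>i<2. frechet_derivative (?f i) (at y) v = c i"
      proof (rule exI[of _ v], unfold All_less_2, intro conjI)
        have "fst v * cnj \<alpha>\<^sub>0 = \<i> * of_real (u * (cmod \<alpha>\<^sub>0)\<^sup>2)"
          unfolding of_real_mult complex_norm_square by (simp add: v_def mult_ac)
        then have "Im (fst v * cnj \<alpha>\<^sub>0) = c 0" using a0(1) by (simp add: u_def)
        then show "frechet_derivative (?f 0) (at y) v = c 0"
          using frechet_derivative_affine[OF BL, of 0 y] by simp
        have "y \<bullet> v = c 1 / 2" using sy by (simp add: inner_prod_def v_def)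
        then show "frechet_derivative (?f 1) (at y) v = c 1"
          using frechet_derivative_square[OF bounded_linear_ident, of "-1" y] by simp
      qed
    qed
  qed
qed simp

lemma submanifold_snd_eq_0:
  assumes "open W"
  shows "submanifold 1 {g \<in> SU2. snd g = 0 \<and> g \<in> W}"
proof (rule submanifold_circle[OF bounded_linear_fst bounded_linear_snd assms])
  show "\<exists>v. fst v = a \<and> snd v = b" for a b :: complex by (intro exI[of _ "(a, b)"]) simp
qed (auto simp: mem_SU2_iff_inner)

lemma submanifold_fst_eq_0: "submanifold 1 {g \<in> SU2. fst g = 0}"
proof -
  have "submanifold 1 {g \<in> SU2. fst g = 0 \<and> g \<in> UNIV}"
  proof (rule submanifold_circle[OF bounded_linear_snd bounded_linear_fst open_UNIV])
    show "\<exists>v. snd v = a \<and> fst v = b" for a b :: complex by (intro exI[of _ "(b, a)"]) simp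
  qed (auto simp: mem_SU2_iff_inner)
  then show ?thesis by simp
qed

section \<open>The boundary of the fundamental domain\<close>

text \<open>Taking the closure makes both inequalities weak. On the sphere, Re \<alpha> = 0 leaves
  Im^2 + |\<beta>|^2 = 1, and dividing Im^2 by a sine square only enlarges it; so a closure point
  outside the open set \<open>E_dom\<close> satisfies the equality.\<close>

lemma frontier_E_dom:
  "top_of_set SU2 frontier_of E_dom p = {(\<alpha>, \<beta>). (\<alpha>, \<beta>) \<in> SU2 \<and> Re \<alpha> \<ge> 0 \<and> sin (pi / of_int p) \<noteq> 0 \<and>
     (Im \<alpha>)\<^sup>2 / (sin (pi / of_int p))\<^sup>2 + (cmod \<beta>)\<^sup>2 = 1}"
proof (cases "sin (pi / of_int p) = 0")
  \<comment> \<open>Here \<open>E_dom\<close> is empty by its guard, and so is the right-hand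
    side.\<close>
  case True
  then have "E_dom p = {}" by (auto simp: E_dom_def)
  then show ?thesis using True by simp
next
  case False
  define s where "s = (sin (pi / of_int p))\<^sup>2"
  have s: "0 < s" "s \<le> 1"
    using False by (auto simp: s_def abs_square_le_1)
  let ?q = "\<lambda>g :: complex \<times> complex. (Im (fst g))\<^sup>2 / s + (cmod (snd g))\<^sup>2"
  have E: "E_dom p = SU2 \<inter> {g. 0 < Re (fst g) \<and> ?q g < 1}"
    using False by (auto simp: E_dom_def s_def)
  have contq: "continuous_on UNIV ?q" "continuous_on UNIV (\<lambda>g :: complex \<times> complex. Re (fst g))"
    using s by (auto intro!: continuous_intros)
  have "open {g :: complex \<times> complex. 0 < Re (fst g) \<and> ?q g < 1}"
    unfolding Collect_conj_eq
    by (intro open_Int open_Collect_less contq continuous_on_const)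
  then have opn: "openin (top_of_set SU2) (E_dom p)"
    unfolding E by (rule openin_open_Int)
  have cl: "top_of_set SU2 closure_of E_dom p = SU2 \<inter> closure (E_dom p)"
    by (simp add: closure_of_subtopology E Int_assoc[symmetric])
  have fr: "top_of_set SU2 frontier_of E_dom p = SU2 \<inter> closure (E_dom p) - E_dom p"
    unfolding frontier_of_def cl using opn by (simp add: interior_of_openin)
  have sub: "closure (E_dom p) \<subseteq> {g. 0 \<le> Re (fst g) \<and> ?q g \<le> 1}"
  proof (rule closure_minimal)
    show "closed {g :: complex \<times> complex. 0 \<le> Re (fst g) \<and> ?q g \<le> 1}"
      unfolding Collect_conj_eq
      by (intro closed_Int closed_Collect_le contq continuous_on_const)
  qed (auto simp: E)
  have norm1: "(Re (fst g))\<^sup>2 + (Im (fst g))\<^sup>2 + (cmod (snd g))\<^sup>2 = 1" if "g \<in> SU2" for g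
    using that by (auto simp: SU2_def cmod_power2)
  have "g \<in> top_of_set SU2 frontier_of E_dom p \<longleftrightarrow> g \<in> SU2 \<and> 0 \<le> Re (fst g) \<and> ?q g = 1" for g
  proof
    assume "g \<in> top_of_set SU2 frontier_of E_dom p"
    then have "g \<in> SU2" "g \<in> closure (E_dom p)" "g \<notin> E_dom p" unfolding fr by auto
    then have g: "g \<in> SU2" "0 \<le> Re (fst g)" "?q g \<le> 1" "\<not> (0 < Re (fst g) \<and> ?q g < 1)"
      using sub by (blast, blast, blast, simp add: E)
    have "?q g = 1"
    proof (rule ccontr)
      assume "?q g \<noteq> 1"
      then have "Re (fst g) = 0" "?q g < 1" using g by auto
      moreover have "(Im (fst g))\<^sup>2 \<le> (Im (fst g))\<^sup>2 / s"
        using s mult_left_mono[OF s(2), of "(Im (fst g))\<^sup>2"] by (simp add: pos_le_divide_eq)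
      ultimately show False using norm1[OF g(1)] by simp
    qed
    with g show "g \<in> SU2 \<and> 0 \<le> Re (fst g) \<and> ?q g = 1" by simp
  next
    assume g: "g \<in> SU2 \<and> 0 \<le> Re (fst g) \<and> ?q g = 1"
    \<comment> \<open>Pushing the point in the positive real direction makes its norm exceed 1;
      rescaling to the sphere then divides the quadratic form by more than 1, which leads into
      \<open>E_dom\<close>.\<close>
    define v where "v \<epsilon> = (fst g + of_real \<epsilon>, snd g)" for \<epsilon>
    define f where "f \<epsilon> = (1 / norm (v \<epsilon>)) *\<^sub>R v \<epsilon>" for \<epsilon>
    have n2: "(norm (v \<epsilon>))\<^sup>2 = 1 + 2 * \<epsilon> * Re (fst g) + \<epsilon>\<^sup>2" for \<epsilon>
      using norm1[of g] g by (simp add: v_def norm_Pair cmod_power2) (simp add: power2_eq_square algebra_simps)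
    have in_E: "f \<epsilon> \<in> E_dom p" if "\<epsilon> > 0" for \<epsilon>
    proof -
      have gt: "(norm (v \<epsilon>))\<^sup>2 > 1" unfolding n2 using that g by (simp add: add_nonneg_pos)
      then have N: "norm (v \<epsilon>) > 0" by (metis norm_le_zero_iff not_less not_one_less_zero norm_zero power_zero_numeral)
      have "(norm (f \<epsilon>))\<^sup>2 = 1" using N by (simp add: f_def)
      then have "f \<epsilon> \<in> SU2" by (simp add: SU2_def case_prod_beta norm_prod_def)
      moreover have "0 < Re (fst (f \<epsilon>))" using N g that by (simp add: f_def v_def)
      moreover have "?q (f \<epsilon>) = ?q g / (norm (v \<epsilon>))\<^sup>2"
        by (simp add: f_def v_def power_divide norm_mult power_mult_distrib add_divide_distrib norm_divide)
      then have "?q (f \<epsilon>) < 1" using gt g by (simp add: divide_less_eq)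
      ultimately show ?thesis unfolding E by simp
    qed
    have vn: "norm (v 0) = 1"
      by (rule power2_eq_imp_eq) (use n2[of 0] in simp_all)
    have "(f \<longlongrightarrow> f 0) (at_right 0)"
      unfolding f_def v_def using vn unfolding v_def by (intro tendsto_intros) auto
    moreover have "f 0 = g" using vn by (simp add: f_def) (simp add: v_def)
    ultimately have lim: "(f \<longlongrightarrow> g) (at_right 0)" by simp
    have "g \<in> closure (E_dom p)"
    proof (rule Lim_in_closed_set[OF closed_closure _ _ lim])
      show "\<forall>\<^sub>F \<epsilon> in at_right 0. f \<epsilon> \<in> closure (E_dom p)"
        by (rule eventually_at_rightI[of 0 1]) (use in_E closure_subset in auto)
    qed simp
    moreover have "g \<notin> E_dom p" using g by (simp add: E)
    ultimately show "g \<in> top_of_set SU2 frontier_of E_dom p" using g unfolding fr by blast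
  qed
  then show ?thesis using False by (auto simp: s_def)
qed

lemma sin_pi_div_int:
  assumes "p \<noteq> 0"
  shows "sin (pi / of_int p) \<noteq> 0 \<longleftrightarrow> 2 \<le> nat \<bar>p\<bar>"
    and "(sin (pi / of_int p))\<^sup>2 = (sin (pi / of_nat (nat \<bar>p\<bar>)))\<^sup>2"
proof -
  have disj: "pi / of_int p = pi / of_nat (nat \<bar>p\<bar>) \<or> pi / of_int p = - (pi / of_nat (nat \<bar>p\<bar>))"
    by (cases "p > 0") auto
  then show "(sin (pi / of_int p))\<^sup>2 = (sin (pi / of_nat (nat \<bar>p\<bar>)))\<^sup>2" by auto
  have eq: "sin (pi / of_int p) \<noteq> 0 \<longleftrightarrow> sin (pi / of_nat (nat \<bar>p\<bar>)) \<noteq> 0" using disj by auto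
  have main: "sin (pi / of_nat n) \<noteq> 0 \<longleftrightarrow> 2 \<le> n" if n: "n > 0" for n :: nat
  proof (cases "n = 1")
    case False
    then have "0 < pi / n" "pi / n < pi" using n by (auto simp: field_simps)
    then have "sin (pi / n) > 0" by (rule sin_gt_zero)
    then show ?thesis using False n by auto
  qed simp
  show "sin (pi / of_int p) \<noteq> 0 \<longleftrightarrow> 2 \<le> nat \<bar>p\<bar>"
    unfolding eq by (rule main) (use assms in simp)
qed

text \<open>On the sphere |\<beta>|^2 = 1 - |\<alpha>|^2, so the ellipsoid becomes |Im \<alpha>| =
  |\<alpha>| sin (pi / n), a pair of half-planes. Writing them with \<open>rcis\<close> includes
  \<alpha> = 0; n at least 2 makes cos (pi / n) nonnegative, in agreement with the sign of Re
  \<alpha>.\<close>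

lemma boundary_equation_iff:
  fixes \<alpha> \<beta> :: complex and n :: nat
  assumes n: "2 \<le> n" and ab: "(cmod \<alpha>)\<^sup>2 + (cmod \<beta>)\<^sup>2 = 1"
  shows "0 \<le> Re \<alpha> \<and> (Im \<alpha>)\<^sup>2 / (sin (pi / n))\<^sup>2 + (cmod \<beta>)\<^sup>2 = 1 \<longleftrightarrow>
    \<alpha> = rcis (cmod \<alpha>) (pi / n) \<or> \<alpha> = rcis (cmod \<alpha>) (- (pi / n))"
proof -
  define r where "r = cmod \<alpha>"
  have pn: "0 < pi / n" "pi / n \<le> pi / 2" using n by (auto simp: field_simps)
  then have s: "sin (pi / n) > 0" using pi_gt_zero by (intro sin_gt_zero) linarith+
  have c: "cos (pi / n) \<ge> 0" using pn by (intro cos_ge_zero) linarith+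
  have r2: "r\<^sup>2 = (Re \<alpha>)\<^sup>2 + (Im \<alpha>)\<^sup>2" unfolding r_def by (rule cmod_power2)
  have "(Im \<alpha>)\<^sup>2 / (sin (pi / n))\<^sup>2 + (cmod \<beta>)\<^sup>2 = 1 \<longleftrightarrow> (Im \<alpha>)\<^sup>2 / (sin (pi / n))\<^sup>2 = r\<^sup>2"
    using ab unfolding r_def by linarith
  also have "\<dots> \<longleftrightarrow> (Im \<alpha>)\<^sup>2 = (r * sin (pi / n))\<^sup>2"
    using s by (simp add: power_mult_distrib divide_eq_eq)
  finally have eq: "(Im \<alpha>)\<^sup>2 / (sin (pi / n))\<^sup>2 + (cmod \<beta>)\<^sup>2 = 1 \<longleftrightarrow> (Im \<alpha>)\<^sup>2 = (r * sin (pi / n))\<^sup>2" .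
  have Re: "Re \<alpha> = r * cos (pi / n)" if "0 \<le> Re \<alpha>" "(Im \<alpha>)\<^sup>2 = (r * sin (pi / n))\<^sup>2"
  proof (rule power2_eq_imp_eq)
    have "(r * cos (pi / n))\<^sup>2 = r\<^sup>2 - (r * sin (pi / n))\<^sup>2"
      by (simp add: power_mult_distrib cos_squared_eq algebra_simps)
    then show "(Re \<alpha>)\<^sup>2 = (r * cos (pi / n))\<^sup>2" using r2 that(2) by simp
  qed (use that c in \<open>auto simp: r_def\<close>)
  show ?thesis
    unfolding eq r_def[symmetric]
  proof
    assume "0 \<le> Re \<alpha> \<and> (Im \<alpha>)\<^sup>2 = (r * sin (pi / n))\<^sup>2"
    with Re show "\<alpha> = rcis r (pi / n) \<or> \<alpha> = rcis r (- (pi / n))"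
      by (auto simp: complex_eq_iff power2_eq_iff)
  next
    assume "\<alpha> = rcis r (pi / n) \<or> \<alpha> = rcis r (- (pi / n))"
    moreover have "0 \<le> r" by (simp add: r_def)
    ultimately show "0 \<le> Re \<alpha> \<and> (Im \<alpha>)\<^sup>2 = (r * sin (pi / n))\<^sup>2"
      using c by (auto simp: Re_rcis Im_rcis simp del: rcis_cmod_Arg)
  qed
qed

lemma K_sym_eq:
  "K_sym p q = {proj p q (\<alpha>, \<beta>) | \<alpha> \<beta>. (cmod \<alpha>)\<^sup>2 + (cmod \<beta>)\<^sup>2 = 1 \<and> Re \<alpha> \<ge> 0
     \<and> sin (pi / of_int p) \<noteq> 0 \<and> (Im \<alpha>)\<^sup>2 / (sin (pi / of_int p))\<^sup>2 + (cmod \<beta>)\<^sup>2 = 1}"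
  unfolding K_sym_def frontier_E_dom by (auto simp: SU2_def)

lemma limit_at_right_in_closure:
  assumes "(f \<longlongrightarrow> g) (at_right 0)" "d > (0::real)" "\<And>s. 0 < s \<Longrightarrow> s < d \<Longrightarrow> f s \<in> S"
  shows "g \<in> closure S"
proof (rule Lim_in_closed_set[OF closed_closure _ _ assms(1)])
  show "\<forall>\<^sub>F s in at_right 0. f s \<in> closure S"
    by (rule eventually_at_rightI[OF _ assms(2)]) (use assms(3) closure_subset in auto)
qed simp

section \<open>The distance on lens spaces\<close>

lemma powi_eq_1_iff: "(\<omega>::complex) powi p = 1 \<longleftrightarrow> \<omega> ^ nat \<bar>p\<bar> = 1"
  by (auto simp: power_int_def power_inverse abs_if)

lemma finite_powi_roots_unity: "p \<noteq> 0 \<Longrightarrow> finite {\<omega>::complex. \<omega> powi p = 1}"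
  unfolding powi_eq_1_iff by (rule finite_roots_unity) auto

lemma bounded_linear_act: "bounded_linear (act q \<omega>)"
  unfolding act_def
  by (intro bounded_linear_Pair bounded_linear_mult_const bounded_linear_const_mult bounded_linear_fst bounded_linear_snd)

context
  fixes p q :: int
  assumes p: "p \<noteq> 0" and cop: "coprime p q"
begin

lemma root_norm: "\<omega> powi p = 1 \<Longrightarrow> cmod \<omega> = 1" "\<omega> powi p = 1 \<Longrightarrow> cmod (\<omega> powi q) = 1"
  using root_of_unity_cnj[OF _ p] root_of_unity_powi_cnj[OF _ p, of _ q]
  by (metis abs_1 abs_norm_cancel complex_norm_square norm_ge_zero of_real_eq_1_iff power2_eq_1_iff real_sqrt_abs real_sqrt_one)+

lemma norm_act: "\<omega> powi p = 1 \<Longrightarrow> norm (act q \<omega> v) = norm v"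
  by (simp add: act_def norm_prod_def norm_mult root_norm)

lemma dist_act: "\<omega> powi p = 1 \<Longrightarrow> dist (act q \<omega> g) (act q \<omega> h) = dist g h"
  using norm_act[of \<omega> "g - h"] linear_diff[OF bounded_linear.linear[OF bounded_linear_act]]
  by (simp add: dist_norm)

lemma root_inverse: "(\<omega>::complex) powi p = 1 \<Longrightarrow> inverse \<omega> powi p = 1"
  by (simp add: power_int_inverse)

lemma root_mult: "(\<omega>::complex) powi p = 1 \<Longrightarrow> \<eta> powi p = 1 \<Longrightarrow> (\<omega> * \<eta>) powi p = 1"
  by (simp add: power_int_mult_distrib)

lemma root_nonzero: "(\<omega>::complex) powi p = 1 \<Longrightarrow> \<omega> \<noteq> 0"
  using root_norm(1)[of \<omega>] by auto

lemma act_inverse: "\<omega> powi p = 1 \<Longrightarrow> act q (inverse \<omega>) (act q \<omega> g) = g"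
  by (simp add: act_act root_nonzero)

lemma proj_eq_iff:
  assumes "g \<in> SU2" "h \<in> SU2"
  shows "proj p q g = proj p q h \<longleftrightarrow> (\<exists>\<omega>. \<omega> powi p = 1 \<and> h = act q \<omega> g)"
  unfolding proj_def eq_equiv_class_iff[OF equiv_lens_rel[OF p] assms] using assms by (auto simp: lens_rel_def)

lemma proj_act: "g \<in> SU2 \<Longrightarrow> \<omega> powi p = 1 \<Longrightarrow> proj p q (act q \<omega> g) = proj p q g"
  using proj_eq_iff[of g "act q \<omega> g"] act_in_SU2[of \<omega> p g q] p by auto

lemma mem_proj: "g \<in> SU2 \<Longrightarrow> h \<in> proj p q g \<longleftrightarrow> (\<exists>\<omega>. \<omega> powi p = 1 \<and> h = act q \<omega> g)"
  using act_in_SU2[OF _ p, of _ g q] by (auto simp: proj_def lens_rel_def)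

section \<open>Lifting curves from the lens space to SU(2)\<close>

text \<open>Bisection of [0, T]: lifts on adjacent intervals differ at the common end by a root of
  unity, and moving the second one by that root glues them. A last root of unity adjusts the
  starting point.\<close>

lemma global_lift:
  assumes lip: "lens_lipschitz p q T \<gamma>" and T: "T > 0" and g0: "g0 \<in> SU2" "\<gamma> 0 = proj p q g0"
  obtains g C where "C-lipschitz_on {0..T} g" "local_lift p q \<gamma> {0..T} g" "g 0 = g0"
proof -
  let ?P = "\<lambda>a b. 0 \<le> a \<and> b \<le> T \<longrightarrow> (\<exists>g C. C-lipschitz_on {a..b} g \<and> local_lift p q \<gamma> {a..b} g)"
  have lact: "C-lipschitz_on S (\<lambda>t. act q \<omega> (g t))" if "C-lipschitz_on S g" "\<omega> powi p = 1"
    for C S g \<omega>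
    using that(1) by (simp add: lipschitz_on_def dist_act[OF that(2)])
  have liftact: "local_lift p q \<gamma> S (\<lambda>t. act q \<omega> (g t))" if "local_lift p q \<gamma> S g" "\<omega> powi p = 1"
    for S g \<omega>
    using that by (simp add: local_lift_def proj_act act_in_SU2 p)
  have "?P 0 T"
  proof (rule Bolzano[where P = ?P])
    fix a b c :: real assume ab: "?P a b" and bc: "?P b c" and le: "a \<le> b" "b \<le> c"
    show "?P a c"
    proof
      assume ac: "0 \<le> a \<and> c \<le> T"
      with ab le obtain g C where g: "C-lipschitz_on {a..b} g" "local_lift p q \<gamma> {a..b} g" by force
      from ac bc le obtain h D where h: "D-lipschitz_on {b..c} h" "local_lift p q \<gamma> {b..c} h" by force
      have "g b \<in> SU2 \<and> \<gamma> b = proj p q (g b)" "h b \<in> SU2 \<and> \<gamma> b = proj p q (h b)"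
        using bspec[OF g(2)[unfolded local_lift_def], of b] bspec[OF h(2)[unfolded local_lift_def], of b] le
        by simp_all
      then have "g b \<in> SU2" "h b \<in> SU2" "proj p q (h b) = proj p q (g b)" by metis+
      then obtain \<omega> where \<omega>: "\<omega> powi p = 1" "g b = act q \<omega> (h b)" using proj_eq_iff by blast
      from lipschitz_on_concat_max[OF g(1) lact[OF h(1) \<omega>(1)] \<omega>(2)]
      have "(max C D)-lipschitz_on {a..c} (\<lambda>x. if x \<le> b then g x else act q \<omega> (h x))" .
      moreover have "local_lift p q \<gamma> {a..c} (\<lambda>x. if x \<le> b then g x else act q \<omega> (h x))"
        using g(2) liftact[OF h(2) \<omega>(1)] by (auto simp: local_lift_def)
      ultimately show "\<exists>g C. C-lipschitz_on {a..c} g \<and> local_lift p q \<gamma> {a..c} g" by blast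
    qed
  next
    fix x assume x: "0 \<le> x" "x \<le> T"
    then obtain \<epsilon> g C where e: "\<epsilon> > 0" "local_lift p q \<gamma> ({0..T} \<inter> ball x \<epsilon>) g" "C-lipschitz_on ({0..T} \<inter> ball x \<epsilon>) g"
      using lip unfolding lens_lipschitz_def by (meson atLeastAtMost_iff)
    show "\<exists>d>0. \<forall>a b. a \<le> x \<and> x \<le> b \<and> b - a < d \<longrightarrow> ?P a b"
    proof (intro exI[of _ \<epsilon>] conjI allI impI e(1))
      fix a b assume "a \<le> x \<and> x \<le> b \<and> b - a < \<epsilon>" "0 \<le> a \<and> b \<le> T"
      then have sub: "{a..b} \<subseteq> {0..T} \<inter> ball x \<epsilon>" by (auto simp: dist_real_def)
      show "\<exists>g C. C-lipschitz_on {a..b} g \<and> local_lift p q \<gamma> {a..b} g"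
        using e(2) lipschitz_on_subset[OF e(3) sub] sub unfolding local_lift_def by blast
    qed
  qed (use T in simp)
  then obtain g C where g: "C-lipschitz_on {0..T} g" "local_lift p q \<gamma> {0..T} g" by auto
  have "g 0 \<in> SU2 \<and> \<gamma> 0 = proj p q (g 0)"
    using bspec[OF g(2)[unfolded local_lift_def], of 0] T by simp
  then have "g 0 \<in> SU2" "proj p q (g 0) = proj p q g0" using g0(2) by metis+
  then obtain \<omega> where \<omega>: "\<omega> powi p = 1" "g0 = act q \<omega> (g 0)" using proj_eq_iff[of "g 0" g0] g0 by blast
  show ?thesis
    by (rule that[OF lact[OF g(1) \<omega>(1)] liftact[OF g(2) \<omega>(1)]]) (simp add: \<omega>(2))
qed

text \<open>Orbits are finite and the action is free because p and q are coprime, so distinct roots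
  move a point to places at a positive distance.\<close>

lemma roots_separated:
  assumes "h \<in> SU2" "\<omega>\<^sub>0 powi p = 1"
  obtains \<delta> where "\<delta> > 0" "\<And>\<omega>. \<omega> powi p = 1 \<Longrightarrow> dist (act q \<omega> h) (act q \<omega>\<^sub>0 h) < \<delta> \<Longrightarrow> \<omega> = \<omega>\<^sub>0"
proof -
  let ?D = "(\<lambda>\<omega>. dist (act q \<omega> h) (act q \<omega>\<^sub>0 h)) ` ({\<omega>. \<omega> powi p = 1} - {\<omega>\<^sub>0})"
  have fin: "finite ?D" using finite_powi_roots_unity[OF p] by simp
  have pos: "d > 0" if "d \<in> ?D" for d
  proof -
    obtain \<omega> where \<omega>: "\<omega> powi p = 1" "\<omega> \<noteq> \<omega>\<^sub>0" "d = dist (act q \<omega> h) (act q \<omega>\<^sub>0 h)" using \<open>d \<in> ?D\<close> by auto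
    have "act q \<omega> h \<noteq> act q \<omega>\<^sub>0 h"
    proof
      assume "act q \<omega> h = act q \<omega>\<^sub>0 h"
      then have "act q (inverse \<omega>\<^sub>0 * \<omega>) h = h"
        using act_inverse[OF assms(2), of h] by (simp add: act_act[symmetric])
      moreover have "(inverse \<omega>\<^sub>0 * \<omega>) powi p = 1"
        by (intro root_mult root_inverse assms(2) \<omega>(1))
      ultimately have "inverse \<omega>\<^sub>0 * \<omega> = 1" using act_inj_root[OF assms(1) cop _ p] by blast
      then show False using \<omega>(2) root_nonzero[OF assms(2)] by (simp add: field_simps)
    qed
    then show ?thesis using \<omega>(3) by simp
  qed
  show ?thesis
  \<comment> \<open>Inserting 1 keeps the set nonempty when there is only one root.\<close>
  proof (rule that[of "Min (insert 1 ?D)"])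
    show "Min (insert 1 ?D) > 0" using fin pos by simp
    fix \<omega> assume \<omega>: "\<omega> powi p = 1" "dist (act q \<omega> h) (act q \<omega>\<^sub>0 h) < Min (insert 1 ?D)"
    show "\<omega> = \<omega>\<^sub>0"
    proof (rule ccontr)
      assume "\<omega> \<noteq> \<omega>\<^sub>0"
      then have "dist (act q \<omega> h) (act q \<omega>\<^sub>0 h) \<in> insert 1 ?D" using \<omega>(1) by blast
      then have "Min (insert 1 ?D) \<le> dist (act q \<omega> h) (act q \<omega>\<^sub>0 h)" using fin by (intro Min_le) auto
      then show False using \<omega>(2) by simp
    qed
  qed
qed

text \<open>Any local lift differs from \<open>g\<close> at each time by some root of unity. Both
  lifts are continuous at \<open>t\<close>, so near \<open>t\<close> the root is constant by
  \<open>roots_separated\<close>; the two velocities are then related by the action and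
  \<open>push\<close> identifies them.\<close>

lemma has_velocity_iff:
  assumes cont: "continuous_on {0..T} g" and lift: "local_lift p q \<gamma> {0..T} g" and t: "t \<in> {0..T}"
  shows "has_velocity p q T \<gamma> t V \<longleftrightarrow>
    (\<exists>v. (g has_vector_derivative v) (at t within {0..T}) \<and> V = push p q (g t) v)"
proof
  assume "\<exists>v. (g has_vector_derivative v) (at t within {0..T}) \<and> V = push p q (g t) v"
  then show "has_velocity p q T \<gamma> t V"
    unfolding has_velocity_def using lift by (intro exI[of _ 1]) (auto simp: local_lift_def)
next
  assume "has_velocity p q T \<gamma> t V"
  then obtain \<epsilon> h v where e: "\<epsilon> > 0" and h: "local_lift p q \<gamma> ({0..T} \<inter> ball t \<epsilon>) h"
    and v: "(h has_vector_derivative v) (at t within {0..T})" and V: "V = push p q (h t) v"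
    unfolding has_velocity_def by blast
  have rel: "\<exists>\<omega>. \<omega> powi p = 1 \<and> h s = act q \<omega> (g s)" if "s \<in> {0..T}" "dist s t < \<epsilon>" for s
    using that h lift proj_eq_iff[of "g s" "h s"] by (auto simp: local_lift_def dist_commute)
  obtain \<omega>\<^sub>0 where \<omega>0: "\<omega>\<^sub>0 powi p = 1" "h t = act q \<omega>\<^sub>0 (g t)" using rel[of t] t e by auto
  have gt: "g t \<in> SU2" using lift t by (simp add: local_lift_def)
  obtain \<delta> where \<delta>: "\<delta> > 0" "\<And>\<omega>. \<omega> powi p = 1 \<Longrightarrow> dist (act q \<omega> (g t)) (act q \<omega>\<^sub>0 (g t)) < \<delta> \<Longrightarrow> \<omega> = \<omega>\<^sub>0"
    using roots_separated[OF gt \<omega>0(1)] by blast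
  have "continuous (at t within {0..T}) h" using v has_vector_derivative_continuous by blast
  then obtain d1 where d1: "d1 > 0" "\<And>s. s \<in> {0..T} \<Longrightarrow> dist s t < d1 \<Longrightarrow> dist (h s) (h t) < \<delta> / 2"
    unfolding continuous_within_eps_delta using \<delta>(1) by (meson half_gt_zero)
  have "continuous (at t within {0..T}) g" using cont t by (simp add: continuous_on_eq_continuous_within)
  then obtain d2 where d2: "d2 > 0" "\<And>s. s \<in> {0..T} \<Longrightarrow> dist s t < d2 \<Longrightarrow> dist (g s) (g t) < \<delta> / 2"
    unfolding continuous_within_eps_delta using \<delta>(1) by (meson half_gt_zero)
  have near: "act q (inverse \<omega>\<^sub>0) (h s) = g s" if s: "s \<in> {0..T}" "dist s t < min \<epsilon> (min d1 d2)" for s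
  proof -
    obtain \<omega> where \<omega>: "\<omega> powi p = 1" "h s = act q \<omega> (g s)" using rel[of s] s by auto
    have "dist (act q \<omega> (g t)) (act q \<omega>\<^sub>0 (g t)) \<le> dist (act q \<omega> (g t)) (h s) + dist (h s) (h t)"
      unfolding \<omega>0(2)[symmetric] by (rule dist_triangle)
    also have "dist (act q \<omega> (g t)) (h s) = dist (g s) (g t)"
      unfolding \<omega>(2) dist_act[OF \<omega>(1)] by (rule dist_commute)
    finally have "dist (act q \<omega> (g t)) (act q \<omega>\<^sub>0 (g t)) < \<delta>"
      using d1(2)[OF s(1)] d2(2)[OF s(1)] s(2) by simp
    from \<delta>(2)[OF \<omega>(1) this] show ?thesis using \<omega> act_inverse by simp
  qed
  have "((\<lambda>s. act q (inverse \<omega>\<^sub>0) (h s)) has_vector_derivative act q (inverse \<omega>\<^sub>0) v) (at t within {0..T})"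
    by (rule bounded_linear.has_vector_derivative[OF bounded_linear_act v])
  then have "(g has_vector_derivative act q (inverse \<omega>\<^sub>0) v) (at t within {0..T})"
    by (rule has_vector_derivative_transform_within[of _ _ _ _ "min \<epsilon> (min d1 d2)"])
      (use e d1(1) d2(1) t near in auto)
  moreover have "V = push p q (g t) (act q (inverse \<omega>\<^sub>0) v)"
  proof -
    have "g t = act q (inverse \<omega>\<^sub>0) (h t)" using near[OF t] e d1(1) d2(1) by simp
    then show ?thesis
      using push_act[OF root_inverse[OF \<omega>0(1)] p, of q "h t" v] V by simp
  qed
  ultimately show "\<exists>v. (g has_vector_derivative v) (at t within {0..T}) \<and> V = push p q (g t) v" by blast
qed

lemma speed_eq:
  assumes T: "T > 0" and cont: "continuous_on {0..T} g" and lift: "local_lift p q \<gamma> {0..T} g" and t: "t \<in> {0..T}"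
    and v: "(g has_vector_derivative v) (at t within {0..T})" "v \<in> Distr (g t)"
  shows "speed p q T \<gamma> t = 2 * norm v"
proof -
  have gt: "g t \<in> SU2" using lift t by (simp add: local_lift_def)
  have bot: "at t within {0..T} \<noteq> bot"
    using t T islimpt_Icc[of 0 T t] by (simp add: trivial_limit_within)
  have "(THE V. has_velocity p q T \<gamma> t V) = push p q (g t) v"
  proof (rule the_equality)
    show "has_velocity p q T \<gamma> t (push p q (g t) v)"
      using has_velocity_iff[OF cont lift t] v by blast
    fix V assume "has_velocity p q T \<gamma> t V"
    then show "V = push p q (g t) v"
      using has_velocity_iff[OF cont lift t] vector_derivative_unique_within[OF bot] v by blast
  qed
  moreover obtain z where "sqrt (sr_inner (g t) v v) = 2 * norm v"
    using Distr_eq[OF gt v(2)] by metis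
  ultimately show ?thesis
    by (simp add: speed_def lens_inner_push[OF p cop gt v(2) v(2)])
qed

lemma push_in_lens_Distr:
  assumes "g \<in> SU2" "push p q g v \<in> lens_Distr p q (proj p q g)"
  shows "v \<in> Distr g"
proof -
  obtain h w where h: "push p q g v = push p q h w" "h \<in> proj p q g" "w \<in> Distr h"
    using assms(2) unfolding lens_Distr_def by blast
  have hS: "h \<in> SU2" using h(2) act_in_SU2[OF _ p assms(1)] by (auto simp: mem_proj[OF assms(1)])
  have "(g, v) \<in> push p q g v"
    unfolding push_def by (auto intro!: exI[of _ 1])
  then have "(g, v) \<in> push p q h w"
    by (simp only: h(1))
  then obtain \<omega> where "\<omega> powi p = 1" "g = act q \<omega> h" "v = act q \<omega> w"
    by (auto simp: push_def)
  then show ?thesis using act_Distr[OF _ p hS h(3)] by simp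
qed

text \<open>The lift from the identity ends at an unknown representative \<open>h\<close> of the end
  point, so a lower bound for the distance must be certified at every representative.\<close>

lemma horizontal_lens_bound:
  assumes T: "T > 0" and hor: "horizontal p q T \<gamma>" and \<gamma>: "\<gamma> 0 = lens_Id p q"
  obtains h where "h \<in> SU2" "\<gamma> T = proj p q h" "curve_length p q T \<gamma> \<ge> 0"
    "\<And>a b. curve_length p q T \<gamma> / 2 < b \<Longrightarrow> a\<^sup>2 + b\<^sup>2 \<le> pi\<^sup>2 \<Longrightarrow> cos (sqrt (a\<^sup>2 + b\<^sup>2)) \<le> Re (fst h * cis a)"
proof -
  have Id: "su2_coords (mat 1) = (1, 0)" by (simp add: su2_coords_def)
  have "(1, 0) \<in> SU2" by (simp add: SU2_def)
  moreover have "\<gamma> 0 = proj p q (1, 0)" using \<gamma> by (simp add: lens_Id_def Id)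
  ultimately obtain g C where g: "C-lipschitz_on {0..T} g" "local_lift p q \<gamma> {0..T} g" "g 0 = (1, 0)"
    using global_lift[OF _ T] hor unfolding horizontal_def by metis
  have cont: "continuous_on {0..T} g" using g(1) lipschitz_on_continuous_on by blast
  have SU2: "g t \<in> SU2" "\<gamma> t = proj p q (g t)" if "t \<in> {0..T}" for t
    using g(2) that by (auto simp: local_lift_def)
  from hor obtain N where N: "N \<in> null_sets lebesgue"
      "{t. \<not> (t \<in> {0..T} \<longrightarrow> (\<exists>V \<in> lens_Distr p q (\<gamma> t). has_velocity p q T \<gamma> t V))} \<subseteq> N"
    unfolding horizontal_def eventually_ae_filter by auto
  have neg: "negligible N" using N(1) by (simp add: negligible_iff_null_sets)
  have ex: "\<exists>v. (g has_vector_derivative v) (at t within {0..T}) \<and> v \<in> Distr (g t)" if t: "t \<in> {0..T} - N" for t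
  proof -
    obtain V where "V \<in> lens_Distr p q (\<gamma> t)" "has_velocity p q T \<gamma> t V" using t N(2) by auto
    then show ?thesis
      using has_velocity_iff[OF cont g(2)] push_in_lens_Distr SU2 t by (metis DiffD1)
  qed
  define g' where "g' t = (SOME v. (g has_vector_derivative v) (at t within {0..T}) \<and> v \<in> Distr (g t))" for t
  have g': "(g has_vector_derivative g' t) (at t within {0..T})" "g' t \<in> Distr (g t)" if "t \<in> {0..T} - N" for t
    using someI_ex[OF ex[OF that]] unfolding g'_def by auto
  have len: "curve_length p q T \<gamma> = 2 * integral {0..T} (\<lambda>t. norm (g' t))"
  proof -
    have "curve_length p q T \<gamma> = integral {0..T} (\<lambda>t. 2 * norm (g' t))"
      unfolding curve_length_def
    proof (rule integral_spike[OF neg])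
      fix t assume t: "t \<in> {0..T} - N"
      then show "2 * norm (g' t) = speed p q T \<gamma> t"
        using speed_eq[OF T cont g(2) _ g'[OF t]] by simp
    qed
    then show ?thesis by simp
  qed
  show ?thesis
  proof (rule that[of "g T"])
    show "g T \<in> SU2" "\<gamma> T = proj p q (g T)" using SU2[of T] T by auto
    show "0 \<le> curve_length p q T \<gamma>"
      unfolding len using norm_deriv_integrable(1)[OF T g(1) neg g'(1)] by (simp add: integral_nonneg)
    fix a b assume "curve_length p q T \<gamma> / 2 < b" "a\<^sup>2 + b\<^sup>2 \<le> pi\<^sup>2"
    then show "cos (sqrt (a\<^sup>2 + b\<^sup>2)) \<le> Re (fst (g T) * cis a)"
      by (intro horizontal_curve_bound[OF T g(1) neg g' SU2(1) g(3)]) (auto simp: len)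
  qed
qed

text \<open>The geodesic itself is a competitor: its Euclidean speed 1/2 is sub-Riemannian speed
  1.\<close>

lemma lens_dist_geodesic_le:
  assumes t: "t > 0"
  shows "lens_dist p q (lens_Id p q) (lens_geodesic p q \<theta> c t) \<le> ereal t"
proof -
  let ?\<gamma> = "lens_geodesic p q \<theta> c" and ?g = "Exp_su2 \<theta> c"
  let ?g' = "\<lambda>s. (- snd (Exp_su2 \<theta> c s) * cnj (cis (\<theta> + c * s) / 2), fst (Exp_su2 \<theta> c s) * (cis (\<theta> + c * s) / 2))"
  note D = Exp_su2_has_vector_derivative[of \<theta> c]
  have dis: "?g' s \<in> Distr (?g s)" and nrm: "norm (?g' s) = 1 / 2" for s
    using Exp_su2_deriv_Distr[OF Exp_su2_in_SU2[of \<theta> c s], of "cis (\<theta> + c * s) / 2"] by (simp_all add: norm_divide)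
  have lift: "local_lift p q ?\<gamma> S ?g" for S
    by (simp add: local_lift_def Exp_su2_in_SU2 lens_geodesic_def)
  have lip: "(1/2)-lipschitz_on {0..t} ?g"
  proof (rule bounded_derivative_imp_lipschitz)
    show "(?g has_derivative (\<lambda>x. x *\<^sub>R ?g' s)) (at s within {0..t})" for s
      using D by (simp add: has_vector_derivative_def)
    show "onorm (\<lambda>x. x *\<^sub>R ?g' s) \<le> 1/2" for s
      by (rule onorm_le) (simp only: norm_scaleR nrm real_norm_def mult.commute)
  qed auto
  have cont: "continuous_on {0..t} ?g" using lip lipschitz_on_continuous_on by blast
  have sp: "speed p q t ?\<gamma> s = 1" if "s \<in> {0..t}" for s
    using speed_eq[OF t cont lift that D dis] unfolding nrm by simp
  have hor: "horizontal p q t ?\<gamma>"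
    unfolding horizontal_def
  proof (intro conjI AE_I2 impI)
    show "lens_lipschitz p q t ?\<gamma>"
      unfolding lens_lipschitz_def
      by (intro ballI exI[of _ 1] conjI exI[of _ ?g] exI[of _ "1/2"] lift lipschitz_on_subset[OF lip]) auto
    fix s assume s: "s \<in> {0..t}"
    show "\<exists>V\<in>lens_Distr p q (?\<gamma> s). has_velocity p q t ?\<gamma> s V"
    proof (rule bexI)
      show "has_velocity p q t ?\<gamma> s (push p q (?g s) (?g' s))"
        using has_velocity_iff[OF cont lift s] D by blast
      have "?g s \<in> ?\<gamma> s"
        unfolding lens_geodesic_def mem_proj[OF Exp_su2_in_SU2] by (rule exI[of _ 1]) simp
      then show "push p q (?g s) (?g' s) \<in> lens_Distr p q (?\<gamma> s)"
        unfolding lens_Distr_def using dis by blast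
    qed
  qed
  have "curve_length p q t ?\<gamma> = integral {0..t} (\<lambda>_. 1)"
    unfolding curve_length_def by (rule integral_cong) (rule sp)
  then have "curve_length p q t ?\<gamma> = t" using t by simp
  moreover have "Exp_su2 \<theta> c 0 = su2_coords (mat 1)"
    by (simp add: Exp_su2_eq su2_coords_def complex_eq_iff)
  then have "?\<gamma> 0 = lens_Id p q"
    by (simp add: lens_geodesic_def lens_Id_def)
  ultimately show ?thesis
    unfolding lens_dist_def using t hor by (intro Inf_lower) (metis (mono_tags, lifting) mem_Collect_eq)
qed

text \<open>A constant curve is horizontal. Together with the requirement t > 0 this keeps [Id] out
  of the cut locus.\<close>

lemma lens_dist_refl_le:
  assumes g: "g \<in> SU2"
  shows "lens_dist p q (proj p q g) (proj p q g) \<le> 0"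
proof -
  let ?\<gamma> = "\<lambda>_::real. proj p q g"
  have lift: "local_lift p q ?\<gamma> S (\<lambda>_. g)" for S
    using g by (simp add: local_lift_def)
  have cont: "continuous_on {0..1} (\<lambda>_::real. g)" by simp
  have D: "((\<lambda>_. g) has_vector_derivative 0) (at s within {0..1})" for s :: real
    by simp
  have dis: "0 \<in> Distr g" by (simp add: Distr_iff[OF g])
  have hor: "horizontal p q 1 ?\<gamma>"
    unfolding horizontal_def
  proof (intro conjI AE_I2 impI)
    show "lens_lipschitz p q 1 ?\<gamma>"
      unfolding lens_lipschitz_def
      by (intro ballI exI[of _ 1] conjI exI[of _ "\<lambda>_. g"] exI[of _ 0] lift lipschitz_on_constant) auto
    fix s :: real assume s: "s \<in> {0..1}"
    show "\<exists>V\<in>lens_Distr p q (?\<gamma> s). has_velocity p q 1 ?\<gamma> s V"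
    proof (rule bexI)
      show "has_velocity p q 1 ?\<gamma> s (push p q g 0)"
        using has_velocity_iff[OF cont lift s] D by blast
      have "g \<in> proj p q g"
        unfolding mem_proj[OF g] by (rule exI[of _ 1]) simp
      then show "push p q g 0 \<in> lens_Distr p q (?\<gamma> s)"
        unfolding lens_Distr_def using dis by blast
    qed
  qed
  have "curve_length p q 1 ?\<gamma> = integral {0..1::real} (\<lambda>_. 0)"
    unfolding curve_length_def
    by (rule integral_cong) (use speed_eq[OF _ cont lift _ D dis] in simp)
  then show ?thesis
    unfolding lens_dist_def using hor
    by (intro Inf_lower) (auto simp: zero_ereal_def intro!: exI[of _ 1] exI[of _ ?\<gamma>])
qed

section \<open>Distances and cut points\<close>

text \<open>The geodesic to \<open>g\<close> has a tight certificate, and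
  \<open>certificate_mono\<close> carries it over to all representatives, whose real parts are not
  larger. Testing the same certificates on geodesics that arrive at time \<open>t\<close> gives the
  last two conclusions: a strictly better certificate would exclude arrival, and equality in the
  Jensen step fixes \<open>c\<close>.\<close>

lemma lens_dist_minimal:
  assumes g: "g \<in> SU2" and ne: "fst g \<noteq> 1"
    and min: "\<And>\<omega>. \<omega> powi p = 1 \<Longrightarrow> Re (\<omega> * fst g) \<le> Re (fst g)"
  obtains \<theta> c t where "t > 0" "Exp_su2 \<theta> c t = g" "lens_dist p q (lens_Id p q) (proj p q g) = ereal t"
    "\<And>\<theta>' c'. proj p q (Exp_su2 \<theta>' c' t) = proj p q g \<Longrightarrow> Re (fst (Exp_su2 \<theta>' c' t)) = Re (fst g)"
    "\<And>\<theta>\<^sub>1 c\<^sub>1 \<theta>\<^sub>2 c\<^sub>2. proj p q (Exp_su2 \<theta>\<^sub>1 c\<^sub>1 t) = proj p q g \<Longrightarrow>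
      fst (Exp_su2 \<theta>\<^sub>1 c\<^sub>1 t) = fst (Exp_su2 \<theta>\<^sub>2 c\<^sub>2 t) \<Longrightarrow> c\<^sub>1 = c\<^sub>2"
proof -
  define r where "r = cmod (fst g)"
  obtain \<theta> c t \<phi> where E: "Exp_su2 \<theta> c t = g" and t: "t > 0" and \<phi>: "0 \<le> \<phi>" "Re (fst g) = r * cos \<phi>"
    "\<phi> + \<bar>c * t / 2\<bar> \<le> pi" "\<bar>c * t / 2\<bar>\<^sup>2 + (t / 2)\<^sup>2 \<le> pi\<^sup>2"
    "r * cos (\<phi> + \<bar>c * t / 2\<bar>) = cos (sqrt (\<bar>c * t / 2\<bar>\<^sup>2 + (t / 2)\<^sup>2))"
    using Exp_su2_surj[OF g ne] unfolding r_def by blast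
  have cert: "\<exists>a b. t / 2 \<le> b \<and> (Re (fst h) < Re (fst g) \<longrightarrow> t / 2 < b) \<and> a\<^sup>2 + b\<^sup>2 \<le> pi\<^sup>2 \<and>
      Re (fst h * cis a) \<le> cos (sqrt (a\<^sup>2 + b\<^sup>2))" if h: "h \<in> SU2" "proj p q h = proj p q g" for h
  proof -
    obtain \<omega> where \<omega>: "\<omega> powi p = 1" "h = act q \<omega> g"
      using proj_eq_iff[OF g h(1)] h(2) by auto
    have f: "fst h = \<omega> * fst g" by (simp add: \<omega>(2) act_def)
    have "cmod (fst h) = r" by (simp add: f norm_mult root_norm(1)[OF \<omega>(1)] r_def)
    moreover have "r \<le> 1" unfolding r_def by (rule norm_fst_SU2_le[OF g])
    moreover have "Re (fst h) \<le> r * cos \<phi>" using min[OF \<omega>(1)] by (simp only: f \<phi>(2))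
    ultimately show ?thesis
      unfolding \<phi>(2) using certificate_mono[of "fst h" r \<phi> "\<bar>c * t / 2\<bar>" "t / 2"] \<phi> t by auto
  qed
  have "ereal t \<le> lens_dist p q (lens_Id p q) (proj p q g)"
    unfolding lens_dist_def
  proof (rule Inf_greatest, clarify)
    fix T \<gamma> assume T: "T > 0" and hor: "horizontal p q T \<gamma>" and \<gamma>: "\<gamma> 0 = lens_Id p q" "\<gamma> T = proj p q g"
    let ?l = "curve_length p q T \<gamma>"
    obtain h where h: "h \<in> SU2" "\<gamma> T = proj p q h" "?l \<ge> 0"
      "\<And>a b. ?l / 2 < b \<Longrightarrow> a\<^sup>2 + b\<^sup>2 \<le> pi\<^sup>2 \<Longrightarrow> cos (sqrt (a\<^sup>2 + b\<^sup>2)) \<le> Re (fst h * cis a)"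
      using horizontal_lens_bound[OF T hor \<gamma>(1)] by auto
    obtain a b where ab: "t / 2 \<le> b" "a\<^sup>2 + b\<^sup>2 \<le> pi\<^sup>2" "Re (fst h * cis a) \<le> cos (sqrt (a\<^sup>2 + b\<^sup>2))"
      using cert[OF h(1)] h(2) \<gamma>(2) by auto
    have "\<not> ?l < t"
    proof
      assume lt: "?l < t"
      \<comment> \<open>The curve bound requires a strict inequality, so the midpoint between half
        the length and t / 2 is used; it still lies below \<open>b\<close>.\<close>
      define b' where "b' = (?l / 2 + t / 2) / 2"
      have b': "?l / 2 < b'" "b' < b" "0 \<le> b'" using lt ab(1) h(3) t by (auto simp: b'_def)
      have "b'\<^sup>2 \<le> b\<^sup>2" using b' by (intro power_mono) auto
      then have "a\<^sup>2 + b'\<^sup>2 \<le> pi\<^sup>2" using ab(2) by linarith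
      from h(4)[OF b'(1) this] cos_sqrt_strict_antimono[OF b'(3,2) ab(2)] ab(3) show False by linarith
    qed
    then show "ereal t \<le> ereal ?l" by simp
  qed
  moreover have "lens_dist p q (lens_Id p q) (proj p q g) \<le> ereal t"
    using lens_dist_geodesic_le[OF t, of \<theta> c] by (simp add: lens_geodesic_def E)
  ultimately have dist: "lens_dist p q (lens_Id p q) (proj p q g) = ereal t" by (rule antisym[rotated])
  \<comment> \<open>The angle \<open>a\<close> depends on the end point only, so two geodesics with
    the same first coordinate at time \<open>t\<close> share the value c t / 2.\<close>
  have tight: "Re (fst h) = Re (fst g) \<and> (\<exists>a. \<forall>\<theta>' c'. fst (Exp_su2 \<theta>' c' t) = fst h \<longrightarrow> a = c' * t / 2)"
    if h: "h = Exp_su2 \<theta>\<^sub>0 c\<^sub>0 t" "proj p q h = proj p q g" for h \<theta>\<^sub>0 c\<^sub>0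
  proof -
    have hS: "h \<in> SU2" unfolding h(1) by (rule Exp_su2_in_SU2)
    obtain a b where ab: "t / 2 \<le> b" "Re (fst h) < Re (fst g) \<longrightarrow> t / 2 < b" "a\<^sup>2 + b\<^sup>2 \<le> pi\<^sup>2"
      "Re (fst h * cis a) \<le> cos (sqrt (a\<^sup>2 + b\<^sup>2))"
      using cert[OF hS h(2)] by blast
    have "(t / 2)\<^sup>2 \<le> b\<^sup>2" using ab(1) t by (intro power_mono) auto
    then have at: "a\<^sup>2 + (t / 2)\<^sup>2 \<le> pi\<^sup>2" using ab(3) by linarith
    note B = Exp_su2_bound[OF t at]
    have b: "b = t / 2"
    proof (rule ccontr)
      assume "b \<noteq> t / 2"
      then have "t / 2 < b" using ab(1) by simp
      then have "cos (sqrt (a\<^sup>2 + b\<^sup>2)) < cos (sqrt (a\<^sup>2 + (t / 2)\<^sup>2))"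
        using t ab(3) by (intro cos_sqrt_strict_antimono) auto
      then show False using B(1)[of \<theta>\<^sub>0 c\<^sub>0] ab(4) unfolding h(1) by linarith
    qed
    obtain \<omega> where \<omega>: "\<omega> powi p = 1" "h = act q \<omega> g"
      using proj_eq_iff[OF g hS] h(2) by auto
    have "Re (fst h) \<le> Re (fst g)" using min[OF \<omega>(1)] by (simp add: \<omega>(2) act_def)
    moreover have "a = c' * t / 2" if "fst (Exp_su2 \<theta>' c' t) = fst h" for \<theta>' c'
      using B(2)[of c' \<theta>'] ab(4) unfolding that b by linarith
    ultimately show ?thesis using ab(2) b by auto
  qed
  show ?thesis
  proof (rule that[OF t E dist])
    fix \<theta>' c' assume "proj p q (Exp_su2 \<theta>' c' t) = proj p q g"
    then show "Re (fst (Exp_su2 \<theta>' c' t)) = Re (fst g)" using tight by blast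
  next
    fix \<theta>\<^sub>1 c\<^sub>1 \<theta>\<^sub>2 c\<^sub>2
    assume 1: "proj p q (Exp_su2 \<theta>\<^sub>1 c\<^sub>1 t) = proj p q g" and 2: "fst (Exp_su2 \<theta>\<^sub>1 c\<^sub>1 t) = fst (Exp_su2 \<theta>\<^sub>2 c\<^sub>2 t)"
    from tight[OF refl 1] obtain a where "\<forall>\<theta>' c'. fst (Exp_su2 \<theta>' c' t) = fst (Exp_su2 \<theta>\<^sub>1 c\<^sub>1 t) \<longrightarrow> a = c' * t / 2" by blast
    then have "a = c\<^sub>1 * t / 2" "a = c\<^sub>2 * t / 2" using 2 by (metis, metis)
    then show "c\<^sub>1 = c\<^sub>2" using t by simp
  qed
qed

text \<open>There are finitely many roots of unity. A largest real part means a smallest |arg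
  \<alpha>|, hence the name.\<close>

lemma minimal_representative:
  assumes g: "g \<in> SU2"
  obtains \<omega> where "\<omega> powi p = 1" "\<And>\<eta>. \<eta> powi p = 1 \<Longrightarrow> Re (\<eta> * fst (act q \<omega> g)) \<le> Re (fst (act q \<omega> g))"
proof -
  let ?R = "{\<omega>::complex. \<omega> powi p = 1}"
  have fin: "finite ((\<lambda>\<omega>. Re (\<omega> * fst g)) ` ?R)" using finite_powi_roots_unity[OF p] by simp
  have "(1::complex) \<in> ?R" by simp
  then have "Max ((\<lambda>\<omega>. Re (\<omega> * fst g)) ` ?R) \<in> (\<lambda>\<omega>. Re (\<omega> * fst g)) ` ?R"
    using fin by (intro Max_in) blast+
  then obtain \<omega> where \<omega>: "\<omega> powi p = 1" "Max ((\<lambda>\<omega>. Re (\<omega> * fst g)) ` ?R) = Re (\<omega> * fst g)" by auto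
  show ?thesis
  proof (rule that[OF \<omega>(1)])
    fix \<eta> :: complex assume "\<eta> powi p = 1"
    then have "(\<eta> * \<omega>) powi p = 1" using root_mult \<omega>(1) by blast
    then have "Re (\<eta> * \<omega> * fst g) \<le> Re (\<omega> * fst g)"
      unfolding \<omega>(2)[symmetric] by (intro Max_ge[OF fin] image_eqI[of _ _ "\<eta> * \<omega>"]) auto
    then show "Re (\<eta> * fst (act q \<omega> g)) \<le> Re (fst (act q \<omega> g))" by (simp add: act_def mult.assoc)
  qed
qed

text \<open>Competing minimal geodesics end at representatives whose first coordinates share modulus
  and real part with \<alpha>. If these coordinates agree, so do the values of \<open>c\<close>, and
  the angles differ: then \<beta> = 0, or distinct representatives force \<alpha> = 0. Otherwise
  they are \<alpha> and its conjugate, which must lie in one orbit.\<close>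

lemma proj_in_cut_locus_iff_minimal:
  defines "n \<equiv> nat \<bar>p\<bar>"
  assumes g: "g \<in> SU2" and min: "\<And>\<omega>. \<omega> powi p = 1 \<Longrightarrow> Re (\<omega> * fst g) \<le> Re (fst g)"
  shows "proj p q g \<in> cut_locus p q \<longleftrightarrow>
    snd g = 0 \<and> fst g ^ n \<noteq> 1 \<or> 2 \<le> n \<and> fst g ^ n = - of_real (cmod (fst g) ^ n)"
proof (cases "fst g = 1")
  case True
  then have "snd g = 0" using g by (simp add: SU2_def case_prod_beta)
  then have "g = su2_coords (mat 1)" using True by (simp add: su2_coords_def prod_eq_iff)
  then have "lens_Id p q = proj p q g" by (simp add: lens_Id_def)
  then have "\<not> (lens_dist p q (lens_Id p q) (proj p q g) = ereal t \<and> t > 0)" for t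
    using lens_dist_refl_le[OF g] by (auto simp: zero_ereal_def)
  then have "proj p q g \<notin> cut_locus p q"
    by (force simp: cut_locus_def optimal_upto_def)
  moreover have "(1::complex) \<noteq> - 1" by simp
  ultimately show ?thesis using True by simp
next
  case False
  have n: "n > 0" using p by (simp add: n_def)
  have root: "\<omega> powi p = 1 \<longleftrightarrow> \<omega> ^ n = 1" for \<omega> :: complex unfolding n_def by (rule powi_eq_1_iff)
  define \<alpha> r where "\<alpha> = fst g" and "r = cmod \<alpha>"
  obtain \<theta> c t where t: "t > 0" and E: "Exp_su2 \<theta> c t = g"
    and dist: "lens_dist p q (lens_Id p q) (proj p q g) = ereal t"
    and Re: "\<And>\<theta>' c'. proj p q (Exp_su2 \<theta>' c' t) = proj p q g \<Longrightarrow> Re (fst (Exp_su2 \<theta>' c' t)) = Re (fst g)"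
    and uniq: "\<And>\<theta>\<^sub>1 c\<^sub>1 \<theta>\<^sub>2 c\<^sub>2. proj p q (Exp_su2 \<theta>\<^sub>1 c\<^sub>1 t) = proj p q g \<Longrightarrow>
      fst (Exp_su2 \<theta>\<^sub>1 c\<^sub>1 t) = fst (Exp_su2 \<theta>\<^sub>2 c\<^sub>2 t) \<Longrightarrow> c\<^sub>1 = c\<^sub>2"
    using lens_dist_minimal[OF g False min] by metis
  have Re_r: "\<alpha> = of_real r" if "r \<le> Re \<alpha>"
    using that complex_Re_le_cmod[of \<alpha>] cmod_power2[of \<alpha>] unfolding r_def
    by (simp add: complex_eq_iff)
  \<comment> \<open>If \<alpha>^n is the positive number r^n, the orbit contains r itself, so the
    maximal representative must be r.\<close>
  have no_real: "\<alpha> = of_real r" if "\<alpha> ^ n = of_real r ^ n" "\<alpha> \<noteq> 0"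
  proof -
    have "(of_real r / \<alpha>) powi p = 1"
      unfolding root by (simp add: power_divide that(2) flip: that(1))
    from min[OF this] that(2) show ?thesis by (intro Re_r) (simp add: \<alpha>_def)
  qed
  show ?thesis
  proof
    assume "snd g = 0 \<and> fst g ^ n \<noteq> 1 \<or> 2 \<le> n \<and> fst g ^ n = - of_real (cmod (fst g) ^ n)"
    then have "\<exists>\<theta>' c'. \<not> ([\<theta> = \<theta>'] (rmod (2 * pi)) \<and> c = c') \<and> proj p q (Exp_su2 \<theta>' c' t) = proj p q g"
    proof (elim disjE conjE)
      assume "snd g = 0"
      \<comment> \<open>At \<beta> = 0 the sine in the second component vanishes, and with it the
        dependence on \<open>\<theta>\<close>.\<close>
      then have "Exp_su2 (\<theta> + pi) c t = Exp_su2 \<theta> c t"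
        using E by (auto simp: Exp_su2_eq prod_eq_iff)
      moreover have "\<not> [\<theta> = \<theta> + pi] (rmod (2 * pi))"
        unfolding cis_eq_iff[symmetric] by (simp flip: cis_mult)
      ultimately show ?thesis using E by auto
    next
      assume n2: "2 \<le> n" and "fst g ^ n = - of_real (cmod (fst g) ^ n)"
      then have \<alpha>n: "\<alpha> ^ n = - (of_real r ^ n)" by (simp add: \<alpha>_def r_def)
      define \<zeta> where "\<zeta> = cis (2 * pi / n)"
      have \<zeta>: "\<zeta> powi p = 1" "\<zeta> \<noteq> 1"
      proof -
        show "\<zeta> powi p = 1" unfolding root \<zeta>_def using n by (simp add: Complex.DeMoivre)
        have "0 < 2 * pi / n" "2 * pi / n \<le> pi" using n2 by (auto simp: field_simps)
        then have "cos (2 * pi / n) < cos 0" by (intro cos_monotone_0_pi) auto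
        then have "Re \<zeta> < 1" by (simp add: \<zeta>_def)
        then show "\<zeta> \<noteq> 1" by auto
      qed
      obtain \<omega> where \<omega>: "\<omega> powi p = 1" "\<omega> \<noteq> 1" "Re (\<omega> * \<alpha>) = Re \<alpha>"
      proof (cases "\<alpha> = 0")
        case True
        \<comment> \<open>For \<alpha> = 0 every root ties, and n at least 2 supplies a nontrivial
          one.\<close>
        then show ?thesis using that[of \<zeta>] \<zeta> by simp
      next
        case a0: False
        have "cnj (\<alpha> ^ n) = \<alpha> ^ n" unfolding \<alpha>n by simp
        then have "cnj \<alpha> ^ n = \<alpha> ^ n" by simp
        \<comment> \<open>The tie partner of \<alpha> is its conjugate; their quotient is a root of
          unity because \<alpha>^n is real.\<close>
        then have w: "(cnj \<alpha> / \<alpha>) powi p = 1" using a0 by (simp add: root power_divide)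
        have r0: "r > 0" using a0 by (simp add: r_def)
        \<comment> \<open>A real \<alpha> with \<alpha>^n = -r^n would be -r, and then
          multiplication by \<open>\<zeta>\<close> would increase the real part.\<close>
        have "cnj \<alpha> \<noteq> \<alpha>"
        proof
          assume real: "cnj \<alpha> = \<alpha>"
          then have im: "Im \<alpha> = 0" by (simp add: complex_eq_iff)
          have "\<alpha> \<noteq> of_real r" using \<alpha>n r0 by auto
          then have "Re \<alpha> \<noteq> r" using im by (simp add: complex_eq_iff)
          then have al: "\<alpha> = - of_real r"
            using im by (auto simp: r_def complex_eq_iff cmod_def abs_if split: if_splits)
          have "Re (\<zeta> * \<alpha>) \<le> Re \<alpha>" unfolding \<alpha>_def by (rule min[OF \<zeta>(1)])
          then have "1 \<le> Re \<zeta>" unfolding al using r0 by simp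
          then have "\<zeta> = 1" using root_norm(1)[OF \<zeta>(1)] complex_Re_le_cmod[of \<zeta>] cmod_power2[of \<zeta>]
            by (simp add: complex_eq_iff)
          then show False using \<zeta>(2) by simp
        qed
        then show ?thesis using that[OF w] a0 by (simp add: field_simps)
      qed
      let ?h = "act q \<omega> g"
      have hS: "?h \<in> SU2" by (rule act_in_SU2[OF \<omega>(1) p g])
      have hp: "proj p q ?h = proj p q g" by (rule proj_act[OF g \<omega>(1)])
      have hg: "?h \<noteq> g" using act_inj_root[OF g cop \<omega>(1) p] \<omega>(2) by blast
      have fh: "fst ?h = \<omega> * \<alpha>" by (simp add: act_def \<alpha>_def)
      have h1: "fst ?h \<noteq> 1"
      proof
        assume "fst ?h = 1"
        then have "Re \<alpha> = 1" using \<omega>(3) fh by simp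
        moreover have "r \<le> 1" using norm_fst_SU2_le[OF g] by (simp add: r_def \<alpha>_def)
        ultimately have "\<alpha> = of_real r" by (intro Re_r) simp
        with \<open>Re \<alpha> = 1\<close> False show False by (simp add: \<alpha>_def)
      qed
      have hmin: "Re (\<eta> * fst ?h) \<le> Re (fst ?h)" if "\<eta> powi p = 1" for \<eta>
        using min[OF root_mult[OF that \<omega>(1)]] \<omega>(3) by (simp add: fh \<alpha>_def mult.assoc)
      obtain \<theta>' c' t' where h: "Exp_su2 \<theta>' c' t' = ?h" "lens_dist p q (lens_Id p q) (proj p q ?h) = ereal t'"
        using lens_dist_minimal[OF hS h1 hmin] by metis
      \<comment> \<open>The other representative is maximal too, and it lies in the same class, so
        its geodesic has the same length.\<close>
      have "t' = t" using h(2) dist unfolding hp by simp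
      then have "Exp_su2 \<theta>' c' t = ?h" using h(1) by simp
      moreover have "\<not> ([\<theta> = \<theta>'] (rmod (2 * pi)) \<and> c = c')"
        using Exp_su2_cong[of \<theta> \<theta>' c t] E hg calculation unfolding cis_eq_iff[symmetric] by auto
      ultimately show ?thesis using hp by metis
    qed
    then obtain \<theta>' c' where "\<not> ([\<theta> = \<theta>'] (rmod (2 * pi)) \<and> c = c')" "proj p q (Exp_su2 \<theta>' c' t) = proj p q g"
      by blast
    then show "proj p q g \<in> cut_locus p q"
      unfolding cut_locus_def optimal_upto_def lens_geodesic_def mem_Collect_eq
      using t E dist by metis
  next
    assume "proj p q g \<in> cut_locus p q"
    then obtain \<theta>\<^sub>1 c\<^sub>1 \<theta>\<^sub>2 c\<^sub>2 t' where ne: "\<not> ([\<theta>\<^sub>1 = \<theta>\<^sub>2] (rmod (2 * pi)) \<and> c\<^sub>1 = c\<^sub>2)"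
      and x: "proj p q (Exp_su2 \<theta>\<^sub>1 c\<^sub>1 t') = proj p q g" "proj p q (Exp_su2 \<theta>\<^sub>2 c\<^sub>2 t') = proj p q g"
      and "lens_dist p q (lens_Id p q) (proj p q g) = ereal t'"
      unfolding cut_locus_def optimal_upto_def lens_geodesic_def mem_Collect_eq by metis
    then have tt: "t' = t" using dist by simp
    note x = x[unfolded tt]
    define h\<^sub>1 h\<^sub>2 where "h\<^sub>1 = Exp_su2 \<theta>\<^sub>1 c\<^sub>1 t" and "h\<^sub>2 = Exp_su2 \<theta>\<^sub>2 c\<^sub>2 t"
    have S: "h\<^sub>1 \<in> SU2" "h\<^sub>2 \<in> SU2" unfolding h\<^sub>1_def h\<^sub>2_def by (rule Exp_su2_in_SU2)+
    obtain \<omega>\<^sub>1 where \<omega>1: "\<omega>\<^sub>1 powi p = 1" "h\<^sub>1 = act q \<omega>\<^sub>1 g"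
      using proj_eq_iff[OF g S(1)] x(1) by (auto simp: h\<^sub>1_def)
    obtain \<omega>\<^sub>2 where \<omega>2: "\<omega>\<^sub>2 powi p = 1" "h\<^sub>2 = act q \<omega>\<^sub>2 g"
      using proj_eq_iff[OF g S(2)] x(2) by (auto simp: h\<^sub>2_def)
    have f: "fst h\<^sub>1 = \<omega>\<^sub>1 * \<alpha>" "fst h\<^sub>2 = \<omega>\<^sub>2 * \<alpha>" by (simp_all add: \<omega>1 \<omega>2 act_def \<alpha>_def)
    have Ref: "Re (fst h\<^sub>1) = Re \<alpha>" "Re (fst h\<^sub>2) = Re \<alpha>"
      using Re[OF x(1)] Re[OF x(2)] by (simp_all add: h\<^sub>1_def h\<^sub>2_def \<alpha>_def)
    show "snd g = 0 \<and> fst g ^ n \<noteq> 1 \<or> 2 \<le> n \<and> fst g ^ n = - of_real (cmod (fst g) ^ n)"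
    proof (cases "fst h\<^sub>1 = fst h\<^sub>2")
      case True
      then have c: "c\<^sub>1 = c\<^sub>2" using uniq[OF x(1)] by (simp add: h\<^sub>1_def h\<^sub>2_def)
      then have cis: "cis \<theta>\<^sub>1 \<noteq> cis \<theta>\<^sub>2" using ne by (simp add: cis_eq_iff)
      have neq: "h\<^sub>1 \<noteq> h\<^sub>2" if "snd h\<^sub>1 \<noteq> 0"
      proof
        assume "h\<^sub>1 = h\<^sub>2"
        then have "snd h\<^sub>1 = snd h\<^sub>2" by simp
        with that cis show False
          unfolding h\<^sub>1_def h\<^sub>2_def c by (auto simp: Exp_su2_eq simp flip: cis_mult)
      qed
      show ?thesis
      proof (cases "snd h\<^sub>1 = 0")
        case s0: True
        then have "snd g = 0" using root_norm(2)[OF \<omega>1(1)] by (auto simp: \<omega>1(2) act_def)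
        moreover have "\<alpha> ^ n \<noteq> 1"
        proof
          assume 1: "\<alpha> ^ n = 1"
          have "r = 1" using g \<open>snd g = 0\<close> by (simp add: SU2_def case_prod_beta r_def \<alpha>_def abs_square_eq_1)
          then have "\<alpha> = 1" using no_real 1 n by (cases "\<alpha> = 0") (auto simp: power_0_left)
          then show False using False by (simp add: \<alpha>_def)
        qed
        ultimately show ?thesis by (simp add: \<alpha>_def)
      next
        case s0: False
        from neq[OF this] have "\<omega>\<^sub>1 \<noteq> \<omega>\<^sub>2" using \<omega>1 \<omega>2 by auto
        \<comment> \<open>Two different roots act equally on \<alpha>.\<close>
        then have a0: "\<alpha> = 0" using True f by auto
        have "2 \<le> n"
        proof (rule ccontr)
          assume "\<not> 2 \<le> n"
          then have "n = 1" using n by simp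
          then show False using \<open>\<omega>\<^sub>1 \<noteq> \<omega>\<^sub>2\<close> \<omega>1(1) \<omega>2(1) by (simp add: root)
        qed
        then show ?thesis using a0 n by (simp add: \<alpha>_def)
      qed
    next
      case False
      have cm: "cmod (fst h\<^sub>1) = r" "cmod (fst h\<^sub>2) = r"
        using root_norm(1)[OF \<omega>1(1)] root_norm(1)[OF \<omega>2(1)] by (simp_all add: f norm_mult r_def)
      have conj: "z = \<alpha> \<or> z = cnj \<alpha>" if "cmod z = r" "Re z = Re \<alpha>" for z
      proof -
        have "(Im z)\<^sup>2 = (Im \<alpha>)\<^sup>2" using that cmod_power2[of z] cmod_power2[of \<alpha>] by (simp add: r_def)
        then show ?thesis using that by (auto simp: complex_eq_iff power2_eq_iff)
      qed
      from conj[OF cm(1) Ref(1)] conj[OF cm(2) Ref(2)] False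
      obtain \<omega> where \<omega>: "\<omega> powi p = 1" "cnj \<alpha> = \<omega> * \<alpha>" "cnj \<alpha> \<noteq> \<alpha>"
        using f \<omega>1(1) \<omega>2(1) by metis
      have a0: "\<alpha> \<noteq> 0" using \<omega>(3) by auto
      have n2: "2 \<le> n"
      proof (rule ccontr)
        assume "\<not> 2 \<le> n"
        then have "n = 1" using n by simp
        then show False using \<omega> by (simp add: root)
      qed
      \<comment> \<open>Hence \<alpha>^n is real and equals r^n or -r^n; the first is impossible by
        \<open>no_real\<close>, since \<alpha> is not real.\<close>
      have "cnj \<alpha> ^ n = \<alpha> ^ n" using \<omega>(1,2) by (simp add: root power_mult_distrib)
      then have "(\<alpha> ^ n)\<^sup>2 = (\<alpha> * cnj \<alpha>) ^ n" by (simp add: power_mult_distrib power2_eq_square)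
      also have "\<dots> = (of_real r ^ n)\<^sup>2"
        unfolding complex_norm_square[symmetric] r_def by (simp add: power_mult[symmetric] mult.commute)
      finally have "\<alpha> ^ n = of_real r ^ n \<or> \<alpha> ^ n = - (of_real r ^ n)" by (simp add: power2_eq_iff)
      moreover have "\<alpha> ^ n \<noteq> of_real r ^ n"
      proof
        assume "\<alpha> ^ n = of_real r ^ n"
        from no_real[OF this a0] \<omega>(3) show False by (metis complex_cnj_complex_of_real)
      qed
      ultimately show ?thesis using n2 by (simp add: \<alpha>_def r_def)
    qed
  qed
qed

text \<open>The criterion is invariant under the action, so it may be tested at a maximal
  representative.\<close>

lemma proj_in_cut_locus_iff:
  defines "n \<equiv> nat \<bar>p\<bar>"
  assumes g: "g \<in> SU2"
  shows "proj p q g \<in> cut_locus p q \<longleftrightarrow>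
    snd g = 0 \<and> fst g ^ n \<noteq> 1 \<or> 2 \<le> n \<and> fst g ^ n = - of_real (cmod (fst g) ^ n)"
proof -
  obtain \<omega> where \<omega>: "\<omega> powi p = 1"
    and min: "\<And>\<eta>. \<eta> powi p = 1 \<Longrightarrow> Re (\<eta> * fst (act q \<omega> g)) \<le> Re (fst (act q \<omega> g))"
    using minimal_representative[OF g] by blast
  have "\<omega> ^ n = 1" using \<omega> unfolding n_def powi_eq_1_iff .
  then have "fst (act q \<omega> g) ^ n = fst g ^ n" by (simp add: act_def power_mult_distrib)
  moreover have "cmod (fst (act q \<omega> g)) = cmod (fst g)"
    using root_norm(1)[OF \<omega>] by (simp add: act_def norm_mult)
  moreover have "snd (act q \<omega> g) = 0 \<longleftrightarrow> snd g = 0"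
    using root_norm(2)[OF \<omega>] by (auto simp: act_def)
  moreover have "proj p q (act q \<omega> g) = proj p q g" by (rule proj_act[OF g \<omega>])
  ultimately show ?thesis
    using proj_in_cut_locus_iff_minimal[OF act_in_SU2[OF \<omega> p g] min] unfolding n_def by simp
qed

section \<open>The two parts of the cut locus as images of invariant sets\<close>

lemma lens_Id_eq: "lens_Id p q = proj p q (1, 0)"
  by (simp add: lens_Id_def su2_coords_def)

lemma K_loc_eq: "K_loc p q = {proj p q (\<alpha>, 0) | \<alpha>. cmod \<alpha> = 1 \<and> \<alpha> powi p \<noteq> 1}"
proof -
  have "proj p q (\<alpha>, 0) = lens_Id p q \<longleftrightarrow> \<alpha> powi p = 1" if "cmod \<alpha> = 1" for \<alpha>
  proof -
    have "proj p q (1, 0) = proj p q (\<alpha>, 0) \<longleftrightarrow> \<alpha> powi p = 1"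
      using that by (subst proj_eq_iff) (auto simp: SU2_def act_def)
    then show ?thesis unfolding lens_Id_eq by metis
  qed
  then show ?thesis by (auto simp: K_loc_def exp_k_eq)
qed

text \<open>An invariant set is the full preimage of its image; this moves questions about subsets
  of the lens space to SU(2).\<close>

lemma proj_in_image_iff:
  assumes inv: "\<And>g \<omega>. g \<in> SU2 \<Longrightarrow> \<omega> powi p = 1 \<Longrightarrow> P g \<Longrightarrow> P (act q \<omega> g)" and g: "g \<in> SU2"
  shows "proj p q g \<in> proj p q ` {g \<in> SU2. P g} \<longleftrightarrow> P g"
proof
  assume "proj p q g \<in> proj p q ` {g \<in> SU2. P g}"
  then obtain h where h: "h \<in> SU2" "P h" "proj p q h = proj p q g" by force
  then obtain \<omega> where "\<omega> powi p = 1" "g = act q \<omega> h" using proj_eq_iff[OF h(1) g] by auto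
  then show "P g" using inv h by simp
qed (use g in blast)

lemma act_invariants:
  assumes "\<omega> powi p = 1"
  shows "fst (act q \<omega> g) ^ nat \<bar>p\<bar> = fst g ^ nat \<bar>p\<bar>" "cmod (fst (act q \<omega> g)) = cmod (fst g)"
    "fst (act q \<omega> g) = 0 \<longleftrightarrow> fst g = 0" "snd (act q \<omega> g) = 0 \<longleftrightarrow> snd g = 0"
proof -
  have "\<omega> ^ nat \<bar>p\<bar> = 1" using assms by (simp add: powi_eq_1_iff)
  then show "fst (act q \<omega> g) ^ nat \<bar>p\<bar> = fst g ^ nat \<bar>p\<bar>" by (simp add: act_def power_mult_distrib)
  show "cmod (fst (act q \<omega> g)) = cmod (fst g)" "fst (act q \<omega> g) = 0 \<longleftrightarrow> fst g = 0"
    "snd (act q \<omega> g) = 0 \<longleftrightarrow> snd g = 0"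
    using root_norm(1)[OF assms] root_norm(2)[OF assms] by (auto simp: act_def norm_mult)
qed

text \<open>The boundary consists of the arguments pi / n and -pi / n only; saturating it under the
  action gives all \<alpha> with \<alpha>^n = -|\<alpha>|^n, since each of them can be rotated to
  argument pi / n.\<close>

lemma K_sym_eq_image:
  "K_sym p q = proj p q ` {g \<in> SU2. 2 \<le> nat \<bar>p\<bar> \<and> fst g ^ nat \<bar>p\<bar> = - of_real (cmod (fst g) ^ nat \<bar>p\<bar>)}"
proof -
  define n where "n = nat \<bar>p\<bar>"
  have n0: "n > 0" using p by (simp add: n_def)
  have root: "\<omega> powi p = 1 \<longleftrightarrow> \<omega> ^ n = 1" for \<omega> :: complex unfolding n_def by (rule powi_eq_1_iff)
  have K: "K_sym p q = {proj p q (\<alpha>, \<beta>) | \<alpha> \<beta>. (cmod \<alpha>)\<^sup>2 + (cmod \<beta>)\<^sup>2 = 1 \<and> 2 \<le> n \<and>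
      (\<alpha> = rcis (cmod \<alpha>) (pi / n) \<or> \<alpha> = rcis (cmod \<alpha>) (- (pi / n)))}"
    unfolding K_sym_eq sin_pi_div_int[OF p] n_def[symmetric] using boundary_equation_iff[of n] by blast
  have pow: "rcis r (pi / n) ^ n = - (of_real r ^ n)" "rcis r (- (pi / n)) ^ n = - (of_real r ^ n)" for r
    using n0 by (simp_all add: rcis_def power_mult_distrib Complex.DeMoivre complex_eq_iff)
  show ?thesis
    unfolding n_def[symmetric]
  proof (intro equalityI subsetI)
    fix x assume "x \<in> K_sym p q"
    then obtain \<alpha> \<beta> where x: "x = proj p q (\<alpha>, \<beta>)" "(cmod \<alpha>)\<^sup>2 + (cmod \<beta>)\<^sup>2 = 1" "2 \<le> n"
      and "\<alpha> = rcis (cmod \<alpha>) (pi / n) \<or> \<alpha> = rcis (cmod \<alpha>) (- (pi / n))"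
      unfolding K by blast
    then have "\<alpha> ^ n = - (of_real (cmod \<alpha>) ^ n)" using pow by metis
    then show "x \<in> proj p q ` {g \<in> SU2. 2 \<le> n \<and> fst g ^ n = - of_real (cmod (fst g) ^ n)}"
      using x by (intro image_eqI[of _ _ "(\<alpha>, \<beta>)"]) (auto simp: SU2_def)
  next
    fix x assume "x \<in> proj p q ` {g \<in> SU2. 2 \<le> n \<and> fst g ^ n = - of_real (cmod (fst g) ^ n)}"
    then obtain g where x: "x = proj p q g" and g: "g \<in> SU2" "2 \<le> n" "fst g ^ n = - (of_real (cmod (fst g)) ^ n)"
      by auto
    let ?r = "cmod (fst g)"
    obtain \<omega> where \<omega>: "\<omega> powi p = 1" "fst (act q \<omega> g) = rcis ?r (pi / n)"
    proof (cases "fst g = 0")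
      case True
      then show ?thesis using that[of 1] by simp
    next
      case False
      then have "(rcis ?r (pi / n) / fst g) powi p = 1"
        unfolding root power_divide pow(1) g(3) by simp
      then show ?thesis using that False by (simp add: act_def)
    qed
    have "act q \<omega> g \<in> SU2" by (rule act_in_SU2[OF \<omega>(1) p g(1)])
    moreover have "x = proj p q (act q \<omega> g)" unfolding x using proj_act[OF g(1) \<omega>(1)] by simp
    moreover have "fst (act q \<omega> g) = rcis (cmod (fst (act q \<omega> g))) (pi / n)"
      unfolding \<omega>(2) by simp
    ultimately show "x \<in> K_sym p q"
      unfolding K using g(2)
      by (intro CollectI exI[of _ "fst (act q \<omega> g)"] exI[of _ "snd (act q \<omega> g)"]) (auto simp: SU2_def)
  qed
qed

lemma K_loc_eq_image: "K_loc p q = proj p q ` {g \<in> SU2. snd g = 0 \<and> fst g ^ nat \<bar>p\<bar> \<noteq> 1}"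
  unfolding K_loc_eq by (force simp: SU2_def powi_eq_1_iff abs_square_eq_1)

lemma cut_locus_eq_Un: "cut_locus p q = K_sym p q \<union> K_loc p q"
proof -
  have "cut_locus p q \<subseteq> proj p q ` SU2"
    by (auto simp: cut_locus_def lens_geodesic_def Exp_su2_in_SU2)
  then have "cut_locus p q = proj p q ` {g \<in> SU2. proj p q g \<in> cut_locus p q}" by blast
  also have "{g \<in> SU2. proj p q g \<in> cut_locus p q} =
      {g \<in> SU2. 2 \<le> nat \<bar>p\<bar> \<and> fst g ^ nat \<bar>p\<bar> = - of_real (cmod (fst g) ^ nat \<bar>p\<bar>)} \<union>
      {g \<in> SU2. snd g = 0 \<and> fst g ^ nat \<bar>p\<bar> \<noteq> 1}"
    using proj_in_cut_locus_iff by auto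
  finally show ?thesis unfolding K_sym_eq_image K_loc_eq_image image_Un .
qed

section \<open>Closures and strata\<close>

lemma proj_in_lens: "g \<in> SU2 \<Longrightarrow> proj p q g \<in> lens p q"
  unfolding proj_def lens_def by (rule quotientI)

lemma topspace_lens: "topspace (lens_topology p q) = lens p q"
proof
  have "{g \<in> SU2. proj p q g \<in> lens p q} = SU2" using proj_in_lens by auto
  then have "openin (lens_topology p q) (lens p q)" by (simp add: openin_lens_topology)
  then show "lens p q \<subseteq> topspace (lens_topology p q)" by (rule openin_subset)
  show "topspace (lens_topology p q) \<subseteq> lens p q"
    using openin_topspace[of "lens_topology p q"] by (simp only: openin_lens_topology)
qed

lemma proj_in_closure_of:
  assumes g: "g \<in> SU2" and cl: "g \<in> closure {h \<in> SU2. P h}"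
  shows "proj p q g \<in> lens_topology p q closure_of (proj p q ` {h \<in> SU2. P h})"
  unfolding in_closure_of topspace_lens
proof (intro conjI allI impI)
  show "proj p q g \<in> lens p q" by (rule proj_in_lens[OF g])
  fix T assume T: "proj p q g \<in> T \<and> openin (lens_topology p q) T"
  then obtain U where U: "open U" "{g \<in> SU2. proj p q g \<in> T} = SU2 \<inter> U"
    unfolding openin_lens_topology openin_open by auto
  then have "g \<in> U" using T g by blast
  then obtain h where "h \<in> SU2" "P h" "h \<in> U"
    using cl U(1) unfolding closure_iff_nhds_not_empty by (metis (no_types, lifting) disjoint_iff interior_eq interior_subset mem_Collect_eq)
  then show "\<exists>y. y \<in> proj p q ` {h \<in> SU2. P h} \<and> y \<in> T" using U(2) by blast
qed

text \<open>A closed invariant condition descends to a closed set, because the preimage of the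
  complement of its image is open.\<close>

lemma closure_of_subset_image:
  assumes F: "closed {g. Q g}" and inv: "\<And>g \<omega>. g \<in> SU2 \<Longrightarrow> \<omega> powi p = 1 \<Longrightarrow> Q g \<Longrightarrow> Q (act q \<omega> g)"
    and sub: "\<And>g. g \<in> SU2 \<Longrightarrow> P g \<Longrightarrow> Q g"
  shows "lens_topology p q closure_of (proj p q ` {g \<in> SU2. P g}) \<subseteq> proj p q ` {g \<in> SU2. Q g}"
proof
  fix x assume x: "x \<in> lens_topology p q closure_of (proj p q ` {g \<in> SU2. P g})"
  let ?T = "lens p q - proj p q ` {g \<in> SU2. Q g}"
  have "proj p q g \<in> ?T \<longleftrightarrow> \<not> Q g" if "g \<in> SU2" for g
    using proj_in_image_iff[where P = Q, OF inv that] proj_in_lens[OF that] by simp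
  then have "{g \<in> SU2. proj p q g \<in> ?T} = SU2 \<inter> - {g. Q g}"
    by blast
  then have T: "openin (lens_topology p q) ?T"
    using F unfolding openin_lens_topology by (auto intro: openin_open_Int)
  show "x \<in> proj p q ` {g \<in> SU2. Q g}"
  proof (rule ccontr)
    assume "x \<notin> proj p q ` {g \<in> SU2. Q g}"
    moreover have "x \<in> lens p q" using x by (simp add: in_closure_of topspace_lens)
    ultimately have xT: "x \<in> ?T" by blast
    have "\<forall>T. x \<in> T \<and> openin (lens_topology p q) T \<longrightarrow> (\<exists>y. y \<in> proj p q ` {g \<in> SU2. P g} \<and> y \<in> T)"
      using x unfolding in_closure_of by (rule conjunct2)
    then obtain y where "y \<in> proj p q ` {g \<in> SU2. P g}" "y \<in> ?T"
      using xT T by (metis (no_types, lifting))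
    then show False using sub by blast
  qed
qed

lemma proj_image_disjoint:
  assumes "\<And>g \<omega>. g \<in> SU2 \<Longrightarrow> \<omega> powi p = 1 \<Longrightarrow> P g \<Longrightarrow> P (act q \<omega> g)" and "\<And>g. g \<in> SU2 \<Longrightarrow> P g \<Longrightarrow> Q g \<Longrightarrow> False"
  shows "proj p q ` {g \<in> SU2. P g} \<inter> proj p q ` {g \<in> SU2. Q g} = {}"
proof -
  have False if "g \<in> SU2" "P g" "h \<in> SU2" "Q h" "proj p q g = proj p q h" for g h
  proof -
    have "proj p q h \<in> proj p q ` {g \<in> SU2. P g}" using that(1,2,5) by (metis (mono_tags) image_eqI mem_Collect_eq)
    then have "P h" using proj_in_image_iff[where P = P, OF assms(1) that(3)] by simp
    then show False using assms(2)[OF that(3)] that(4) by blast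
  qed
  then show ?thesis by (auto simp: disjoint_iff)
qed

lemma lens_submanifold_image:
  assumes inv: "\<And>g \<omega>. g \<in> SU2 \<Longrightarrow> \<omega> powi p = 1 \<Longrightarrow> P g \<Longrightarrow> P (act q \<omega> g)"
    and sub: "submanifold d {g \<in> SU2. P g}"
  shows "lens_submanifold p q d (proj p q ` {g \<in> SU2. P g})"
proof -
  have "{g \<in> SU2. proj p q g \<in> proj p q ` {g \<in> SU2. P g}} = {g \<in> SU2. P g}"
    using proj_in_image_iff[where P = P, OF inv] by blast
  then show ?thesis using sub proj_in_lens by (auto simp: lens_submanifold_def)
qed

text \<open>Without nontrivial roots no tie occurs, and the local part is a circle minus the
  identity.\<close>

lemma stratification_trivial_group:
  assumes n: "nat \<bar>p\<bar> = 1"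
  shows "stratification p q (K_sym p q \<union> K_loc p q) {K_loc p q}" "K_sym p q = {}"
proof -
  show K: "K_sym p q = {}" using n by (simp add: K_sym_eq_image)
  have L: "K_loc p q = proj p q ` {g \<in> SU2. snd g = 0 \<and> g \<in> {g. fst g \<noteq> 1}}"
    using n by (simp add: K_loc_eq_image)
  have "lens_submanifold p q 1 (K_loc p q)"
    unfolding L
  proof (rule lens_submanifold_image)
    show "submanifold 1 {g \<in> SU2. snd g = 0 \<and> g \<in> {g. fst g \<noteq> 1}}"
      by (intro submanifold_snd_eq_0 open_Collect_neq continuous_intros)
    fix g :: "complex \<times> complex" and \<omega> :: complex assume "\<omega> powi p = 1" "snd g = 0 \<and> g \<in> {g. fst g \<noteq> 1}"
    then show "snd (act q \<omega> g) = 0 \<and> act q \<omega> g \<in> {g. fst g \<noteq> 1}"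
      using act_invariants[of \<omega> g] n by simp
  qed
  moreover from this have "K_loc p q \<subseteq> lens_topology p q closure_of K_loc p q"
    by (intro closure_of_subset) (simp add: topspace_lens lens_submanifold_def)
  moreover have "(-1, 0) \<in> {g \<in> SU2. snd g = 0 \<and> g \<in> {g. fst g \<noteq> 1}}" by (simp add: SU2_def)
  then have "K_loc p q \<noteq> {}" unfolding L by blast
  ultimately show "stratification p q (K_sym p q \<union> K_loc p q) {K_loc p q}"
    unfolding stratification_def K by (auto simp: partition_on_def disjoint_def)
qed

lemma stratification_nontrivial_group:
  assumes n2: "2 \<le> nat \<bar>p\<bar>"
  shows "\<exists>\<S>. stratification p q (K_sym p q \<union> K_loc p q) \<S> \<and>
    (\<exists>\<A>\<subseteq>\<S>. K_sym p q = \<Union>\<A>) \<and> (\<exists>\<B>\<subseteq>\<S>. K_loc p q = \<Union>\<B>)"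
proof -
  define n where "n = nat \<bar>p\<bar>"
  have n: "2 \<le> n" "n > 0" using n2 by (simp_all add: n_def)
  \<comment> \<open>\<open>P\<^sub>3\<close> describes the overlap of the two parts;
    \<open>P\<^sub>4\<close> is phrased as membership in an open set to fit
    \<open>submanifold_snd_eq_0\<close>. The circle \<open>P\<^sub>2\<close> and the points
    \<open>P\<^sub>3\<close> lie in the closure of \<open>P\<^sub>1\<close>, and
    \<open>P\<^sub>3\<close> lies in that of \<open>P\<^sub>4\<close>; no other two strata
    touch.\<close>
  define P\<^sub>1 P\<^sub>2 P\<^sub>3 P\<^sub>4 :: "complex \<times> complex \<Rightarrow> bool" where
    "P\<^sub>1 g \<longleftrightarrow> fst g \<noteq> 0 \<and> snd g \<noteq> 0 \<and> fst g ^ n = - of_real (cmod (fst g) ^ n)" and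
    "P\<^sub>2 g \<longleftrightarrow> fst g = 0" and
    "P\<^sub>3 g \<longleftrightarrow> snd g = 0 \<and> fst g ^ n = - 1" and
    "P\<^sub>4 g \<longleftrightarrow> snd g = 0 \<and> g \<in> {g. fst g ^ n \<noteq> 1} \<inter> {g. fst g ^ n \<noteq> - 1}" for g
  note P_defs = P\<^sub>1_def P\<^sub>2_def P\<^sub>3_def P\<^sub>4_def
  define S where "S P = proj p q ` {g \<in> SU2. P g}" for P
  have inv: "P\<^sub>1 g \<Longrightarrow> P\<^sub>1 (act q \<omega> g)" "P\<^sub>2 g \<Longrightarrow> P\<^sub>2 (act q \<omega> g)" "P\<^sub>3 g \<Longrightarrow> P\<^sub>3 (act q \<omega> g)"
    "P\<^sub>4 g \<Longrightarrow> P\<^sub>4 (act q \<omega> g)" if "\<omega> powi p = 1" for g \<omega>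
    using act_invariants[OF that, of g] unfolding P_defs n_def[symmetric] by simp_all
  have norm1: "cmod (fst g) = 1" if "g \<in> SU2" "snd g = 0" for g
    using that by (auto simp: SU2_def abs_square_eq_1)
  have m1: "(1::complex) \<noteq> - 1" by simp
  have nz: "fst g \<noteq> 0" if "P\<^sub>3 g" for g using that n by (auto simp: P_defs power_0_left)
  have nz4: "fst g \<noteq> 0" if "P\<^sub>4 g" "g \<in> SU2" for g using that norm1[of g] by (auto simp: P_defs)
  have K_sym: "K_sym p q = S P\<^sub>1 \<union> S P\<^sub>2 \<union> S P\<^sub>3"
  proof -
    have "{g \<in> SU2. 2 \<le> n \<and> fst g ^ n = - of_real (cmod (fst g) ^ n)} =
        {g \<in> SU2. P\<^sub>1 g} \<union> {g \<in> SU2. P\<^sub>2 g} \<union> {g \<in> SU2. P\<^sub>3 g}"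
      using n norm1 by (auto simp: P_defs power_0_left)
    then show ?thesis unfolding K_sym_eq_image n_def[symmetric] S_def by (simp only: image_Un)
  qed
  have K_loc: "K_loc p q = S P\<^sub>3 \<union> S P\<^sub>4"
  proof -
    have "{g \<in> SU2. snd g = 0 \<and> fst g ^ n \<noteq> 1} = {g \<in> SU2. P\<^sub>3 g} \<union> {g \<in> SU2. P\<^sub>4 g}"
      using m1 by (auto simp: P_defs)
    then show ?thesis unfolding K_loc_eq_image n_def[symmetric] S_def by (simp only: image_Un)
  qed
  have disj: "S P\<^sub>1 \<inter> S P\<^sub>2 = {}" "S P\<^sub>1 \<inter> S P\<^sub>3 = {}" "S P\<^sub>1 \<inter> S P\<^sub>4 = {}"
    "S P\<^sub>2 \<inter> S P\<^sub>3 = {}" "S P\<^sub>2 \<inter> S P\<^sub>4 = {}" "S P\<^sub>3 \<inter> S P\<^sub>4 = {}"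
  proof -
    have *: "S P \<inter> S Q = {}" if "\<And>g \<omega>. \<omega> powi p = 1 \<Longrightarrow> P g \<Longrightarrow> P (act q \<omega> g)"
      "\<And>g. g \<in> SU2 \<Longrightarrow> P g \<Longrightarrow> Q g \<Longrightarrow> False" for P Q
      unfolding S_def using proj_image_disjoint[of P Q] that by blast
    show "S P\<^sub>1 \<inter> S P\<^sub>2 = {}" "S P\<^sub>1 \<inter> S P\<^sub>3 = {}" "S P\<^sub>1 \<inter> S P\<^sub>4 = {}"
      by (rule *[of P\<^sub>1, OF inv(1)]; simp add: P_defs)+
    show "S P\<^sub>2 \<inter> S P\<^sub>3 = {}" "S P\<^sub>2 \<inter> S P\<^sub>4 = {}"
      using *[of P\<^sub>2 P\<^sub>3, OF inv(2)] *[of P\<^sub>2 P\<^sub>4, OF inv(2)] nz nz4 unfolding P\<^sub>2_def by blast+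
    show "S P\<^sub>3 \<inter> S P\<^sub>4 = {}"
      by (rule *[of P\<^sub>3, OF inv(3)]; simp add: P_defs)
  qed
  define u where "u = cis (pi / n)"
  have u: "u ^ n = - 1" "cmod u = 1" using n by (simp_all add: u_def Complex.DeMoivre)
  \<comment> \<open>A rotation by less than pi / n stays strictly between neighbouring 2n-th roots
    of unity.\<close>
  have cisn: "cis s ^ n \<noteq> 1" "cis s ^ n \<noteq> - 1" if "0 < s" "s < pi / n" for s
  proof -
    have "0 < n * s" "n * s < pi" using that n by (auto simp: field_simps)
    then have "sin (n * s) > 0" by (rule sin_gt_zero)
    then have "Im (cis s ^ n) \<noteq> 0" by (simp add: Complex.DeMoivre)
    then show "cis s ^ n \<noteq> 1" "cis s ^ n \<noteq> - 1" by auto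
  qed
  have pn: "pi / n > 0" using n by simp
  have ne: "S P\<^sub>1 \<noteq> {}" "S P\<^sub>2 \<noteq> {}" "S P\<^sub>3 \<noteq> {}" "S P\<^sub>4 \<noteq> {}"
  proof -
    \<comment> \<open>The Pythagorean pair 3/5, 4/5 puts a point with both coordinates nonzero on
      the sphere.\<close>
    have "(of_real (3/5) * u, of_real (4/5)) \<in> {g \<in> SU2. P\<^sub>1 g}"
      using u by (auto simp: P_defs SU2_def norm_mult norm_divide power_mult_distrib power_divide power2_eq_square)
    moreover have "(0, 1) \<in> {g \<in> SU2. P\<^sub>2 g}" by (simp add: P_defs SU2_def)
    moreover have "(u, 0) \<in> {g \<in> SU2. P\<^sub>3 g}" using u by (simp add: P_defs SU2_def)
    moreover have "(cis (pi / n / 2), 0) \<in> {g \<in> SU2. P\<^sub>4 g}"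
      using cisn[of "pi / n / 2"] pn by (simp add: P_defs SU2_def)
    ultimately show "S P\<^sub>1 \<noteq> {}" "S P\<^sub>2 \<noteq> {}" "S P\<^sub>3 \<noteq> {}" "S P\<^sub>4 \<noteq> {}" unfolding S_def by blast+
  qed
  have sqrt_lim: "((\<lambda>s. sqrt (1 - s\<^sup>2)) \<longlongrightarrow> 1) (at_right 0)"
    by (auto intro!: tendsto_eq_intros)
  have ident_lim: "((\<lambda>s. complex_of_real s) \<longlongrightarrow> 0) (at_right 0)"
    by (auto intro!: tendsto_eq_intros)
  have s2: "s\<^sup>2 < 1" if "0 < s" "s < 1" for s :: real using that by (simp add: power_less_one_iff)
  have cl21: "S P\<^sub>2 \<subseteq> lens_topology p q closure_of S P\<^sub>1"
  proof -
    have "proj p q g \<in> lens_topology p q closure_of S P\<^sub>1" if g: "g \<in> SU2" "P\<^sub>2 g" for g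
      unfolding S_def
    proof (rule proj_in_closure_of[OF g(1)], rule limit_at_right_in_closure[of _ _ 1])
      have b: "cmod (snd g) = 1" using g by (auto simp: P_defs SU2_def abs_square_eq_1)
      have "((\<lambda>s. (of_real s * u, of_real (sqrt (1 - s\<^sup>2)) * snd g)) \<longlongrightarrow> (0 * u, of_real 1 * snd g)) (at_right 0)"
        by (intro tendsto_intros ident_lim sqrt_lim)
      moreover have "(0 * u, of_real 1 * snd g) = g" using g(2) by (simp add: P_defs prod_eq_iff)
      ultimately show "((\<lambda>s. (of_real s * u, of_real (sqrt (1 - s\<^sup>2)) * snd g)) \<longlongrightarrow> g) (at_right 0)" by simp
      fix s :: real assume s: "0 < s" "s < 1"
      then show "(of_real s * u, of_real (sqrt (1 - s\<^sup>2)) * snd g) \<in> {h \<in> SU2. P\<^sub>1 h}"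
        using u b s2[OF s] by (auto simp: P_defs SU2_def norm_mult power_mult_distrib)
    qed simp
    then show ?thesis by (auto simp: S_def)
  qed
  have cl31: "S P\<^sub>3 \<subseteq> lens_topology p q closure_of S P\<^sub>1"
  proof -
    have "proj p q g \<in> lens_topology p q closure_of S P\<^sub>1" if g: "g \<in> SU2" "P\<^sub>3 g" for g
      unfolding S_def
    proof (rule proj_in_closure_of[OF g(1)], rule limit_at_right_in_closure[of _ _ 1])
      have b: "cmod (fst g) = 1" "fst g ^ n = - 1" "fst g \<noteq> 0"
        using norm1[OF g(1)] g(2) nz[OF g(2)] by (auto simp: P_defs)
      have "((\<lambda>s. (of_real (sqrt (1 - s\<^sup>2)) * fst g, complex_of_real s)) \<longlongrightarrow> (of_real 1 * fst g, 0)) (at_right 0)"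
        by (rule tendsto_Pair[OF tendsto_mult[OF tendsto_of_real[OF sqrt_lim] tendsto_const] ident_lim])
      moreover have "(of_real 1 * fst g, 0) = g" using g(2) by (simp add: P_defs prod_eq_iff)
      ultimately show "((\<lambda>s. (of_real (sqrt (1 - s\<^sup>2)) * fst g, complex_of_real s)) \<longlongrightarrow> g) (at_right 0)" by simp
      fix s :: real assume s: "0 < s" "s < 1"
      then show "(of_real (sqrt (1 - s\<^sup>2)) * fst g, complex_of_real s) \<in> {h \<in> SU2. P\<^sub>1 h}"
        using b s2[OF s] by (auto simp: P_defs SU2_def norm_mult power_mult_distrib)
    qed simp
    then show ?thesis by (auto simp: S_def)
  qed
  have cl34: "S P\<^sub>3 \<subseteq> lens_topology p q closure_of S P\<^sub>4"
  proof -
    have "proj p q g \<in> lens_topology p q closure_of S P\<^sub>4" if g: "g \<in> SU2" "P\<^sub>3 g" for g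
      unfolding S_def
    proof (rule proj_in_closure_of[OF g(1)], rule limit_at_right_in_closure[OF _ pn])
      have b: "cmod (fst g) = 1" "fst g ^ n = - 1"
        using norm1[OF g(1)] g(2) by (auto simp: P_defs)
      have "((\<lambda>s. (fst g * cis s, 0::complex)) \<longlongrightarrow> (fst g * cis 0, 0::complex)) (at_right 0)"
        unfolding cis_conv_exp by (intro tendsto_intros)
      moreover have "(fst g * cis 0, 0) = g" using g(2) by (simp add: P_defs prod_eq_iff)
      ultimately show "((\<lambda>s. (fst g * cis s, 0::complex)) \<longlongrightarrow> g) (at_right 0)" by simp
      fix s :: real assume s: "0 < s" "s < pi / n"
      have "(fst g * cis s) ^ n = - (cis s ^ n)" by (simp add: power_mult_distrib b(2))
      then show "(fst g * cis s, 0) \<in> {h \<in> SU2. P\<^sub>4 h}"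
        using b cisn[OF s] by (auto simp: P_defs SU2_def norm_mult minus_equation_iff[of _ 1])
    qed
    then show ?thesis by (auto simp: S_def)
  qed
  have cont: "continuous_on UNIV (\<lambda>g :: complex \<times> complex. fst g ^ n)"
    by (intro continuous_intros)
  \<comment> \<open>The closed equation of the symmetric part persists in the closure; with \<beta>
    = 0 it gives \<alpha>^n = -1, which \<open>P\<^sub>4\<close> forbids.\<close>
  have c1: "lens_topology p q closure_of S P\<^sub>1 \<inter> S P\<^sub>4 = {}"
  proof -
    let ?Q = "\<lambda>g :: complex \<times> complex. fst g ^ n = - of_real (cmod (fst g) ^ n)"
    have invQ: "?Q (act q \<omega> g)" if "\<omega> powi p = 1" "?Q g" for g \<omega>
      using act_invariants[OF that(1), of g] that(2) unfolding n_def[symmetric] by simp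
    have "lens_topology p q closure_of S P\<^sub>1 \<subseteq> proj p q ` {g \<in> SU2. ?Q g}"
      unfolding S_def
      by (rule closure_of_subset_image)
        (use invQ in \<open>auto simp: P_defs intro!: closed_Collect_eq cont continuous_intros\<close>)
    moreover have "proj p q ` {g \<in> SU2. ?Q g} \<inter> S P\<^sub>4 = {}"
      unfolding S_def
      by (rule proj_image_disjoint) (use invQ norm1 in \<open>auto simp: P_defs\<close>)
    ultimately show ?thesis by blast
  qed
  have c2: "lens_topology p q closure_of S P\<^sub>2 \<subseteq> S P\<^sub>2"
    unfolding S_def
    by (rule closure_of_subset_image) (use inv(2) in \<open>auto simp: P_defs intro!: closed_Collect_eq continuous_intros\<close>)
  have c3: "lens_topology p q closure_of S P\<^sub>3 \<subseteq> S P\<^sub>3"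
    unfolding S_def
  proof (rule closure_of_subset_image)
    show "closed {g. P\<^sub>3 g}"
      unfolding P_defs Collect_conj_eq by (intro closed_Int closed_Collect_eq cont continuous_intros)
  qed (use inv(3) in auto)
  \<comment> \<open>The condition \<beta> = 0 persists in the closure, but \<open>P\<^sub>1\<close>
    demands \<beta> nonzero and \<open>P\<^sub>2\<close> has |\<beta>| = 1.\<close>
  have c4: "lens_topology p q closure_of S P\<^sub>4 \<inter> (S P\<^sub>1 \<union> S P\<^sub>2) = {}"
  proof -
    let ?Q = "\<lambda>g :: complex \<times> complex. snd g = 0"
    have invQ: "?Q (act q \<omega> g)" if "\<omega> powi p = 1" "?Q g" for g \<omega>
      using act_invariants[OF that(1), of g] that(2) by simp
    have "lens_topology p q closure_of S P\<^sub>4 \<subseteq> proj p q ` {g \<in> SU2. ?Q g}"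
      unfolding S_def
      by (rule closure_of_subset_image)
        (use invQ in \<open>auto simp: P_defs intro!: closed_Collect_eq continuous_intros\<close>)
    moreover have "proj p q ` {g \<in> SU2. ?Q g} \<inter> S P\<^sub>1 = {}" "proj p q ` {g \<in> SU2. ?Q g} \<inter> S P\<^sub>2 = {}"
      unfolding S_def
      by (rule proj_image_disjoint; use invQ norm1 in \<open>force simp: P_defs\<close>)+
    ultimately show ?thesis by blast
  qed
  have lens: "S P \<subseteq> lens p q" for P using proj_in_lens by (auto simp: S_def)
  have self: "S P \<subseteq> lens_topology p q closure_of S P" for P
    by (rule closure_of_subset) (simp add: topspace_lens lens)
  let ?\<S> = "{S P\<^sub>1, S P\<^sub>2, S P\<^sub>3, S P\<^sub>4}"
  have "stratification p q (K_sym p q \<union> K_loc p q) ?\<S>"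
    unfolding stratification_def
  proof (intro conjI)
    show "partition_on (K_sym p q \<union> K_loc p q) ?\<S>"
      unfolding partition_on_def K_sym K_loc disjoint_def using disj ne by (auto simp: Int_commute)
    have "lens_submanifold p q 2 (S P\<^sub>1)"
      unfolding S_def by (rule lens_submanifold_image[where P = P\<^sub>1, OF inv(1)])
        (use submanifold_rays[OF n(2)] in \<open>simp_all add: P_defs\<close>)
    moreover have "lens_submanifold p q 1 (S P\<^sub>2)"
      unfolding S_def by (rule lens_submanifold_image[where P = P\<^sub>2, OF inv(2)])
        (use submanifold_fst_eq_0 in \<open>simp_all add: P_defs\<close>)
    moreover have "lens_submanifold p q 0 (S P\<^sub>3)"
      unfolding S_def
    proof (rule lens_submanifold_image[where P = P\<^sub>3, OF inv(3)])
      have "finite {z::complex. z ^ n = - 1}" using n by (intro finite_nth_roots) auto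
      then have "finite ((\<lambda>z. (z, 0::complex)) ` {z::complex. z ^ n = - 1})" by (rule finite_imageI)
      then have "finite {g \<in> SU2. P\<^sub>3 g}"
        by (rule finite_subset[rotated]) (auto simp: P_defs prod_eq_iff image_iff)
      then show "submanifold 0 {g \<in> SU2. P\<^sub>3 g}" by (rule submanifold_finite)
    qed
    moreover have "lens_submanifold p q 1 (S P\<^sub>4)"
      unfolding S_def
    proof (rule lens_submanifold_image[where P = P\<^sub>4, OF inv(4)])
      show "submanifold 1 {g \<in> SU2. P\<^sub>4 g}"
        unfolding P_defs
        by (intro submanifold_snd_eq_0 open_Int open_Collect_neq cont continuous_intros)
    qed
    ultimately show "\<forall>S\<in>?\<S>. \<exists>d. lens_submanifold p q d S" by blast
    show "\<forall>A\<in>?\<S>. \<forall>R\<in>?\<S>. A \<inter> (lens_topology p q closure_of R) \<noteq> {} \<longrightarrow> A \<subseteq> lens_topology p q closure_of R"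
    proof (intro ballI impI)
      fix A R
      assume A: "A \<in> ?\<S>" and R: "R \<in> ?\<S>" and ne: "A \<inter> lens_topology p q closure_of R \<noteq> {}"
      from R consider "R = S P\<^sub>1" | "R = S P\<^sub>2" | "R = S P\<^sub>3" | "R = S P\<^sub>4" by blast
      then show "A \<subseteq> lens_topology p q closure_of R"
      proof cases
        case 1
        then show ?thesis using A ne cl21 cl31 c1 self[of P\<^sub>1] by blast
      next
        case 2
        then show ?thesis using A ne c2 disj self[of P\<^sub>2] by blast
      next
        case 3
        then show ?thesis using A ne c3 disj self[of P\<^sub>3] by blast
      next
        case 4
        then show ?thesis using A ne c4 cl34 self[of P\<^sub>4] by blast
      qed
    qed
  qed simp
  moreover have "\<exists>\<A>\<subseteq>?\<S>. K_sym p q = \<Union>\<A>" by (rule exI[of _ "{S P\<^sub>1, S P\<^sub>2, S P\<^sub>3}"]) (auto simp: K_sym)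
  moreover have "\<exists>\<B>\<subseteq>?\<S>. K_loc p q = \<Union>\<B>" by (rule exI[of _ "{S P\<^sub>3, S P\<^sub>4}"]) (auto simp: K_loc)
  ultimately show ?thesis by - (rule exI[of _ ?\<S>], intro conjI)
qed

end

theorem theorem4:
  fixes p q :: int
  assumes "p \<noteq> 0" and "q \<noteq> 0" and "coprime p q"
  shows "cut_locus p q = K_sym p q \<union> K_loc p q
    \<and> (\<exists>\<S>. stratification p q (K_sym p q \<union> K_loc p q) \<S>
          \<and> (\<exists>\<A> \<subseteq> \<S>. K_sym p q = \<Union>\<A>) \<and> (\<exists>\<B> \<subseteq> \<S>. K_loc p q = \<Union>\<B>))
    \<and> K_sym p q = {proj p q (\<alpha>, \<beta>) | \<alpha> \<beta>. (cmod \<alpha>)\<^sup>2 + (cmod \<beta>)\<^sup>2 = 1 \<and> Re \<alpha> \<ge> 0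
          \<and> sin (pi / of_int p) \<noteq> 0
          \<and> (Im \<alpha>)\<^sup>2 / (sin (pi / of_int p))\<^sup>2 + (cmod \<beta>)\<^sup>2 = 1}
    \<and> K_loc p q = {proj p q (\<alpha>, 0) | \<alpha>. cmod \<alpha> = 1 \<and> \<alpha> powi p \<noteq> 1}"
proof (intro conjI)
  note pq = assms(1,3)
  show "\<exists>\<S>. stratification p q (K_sym p q \<union> K_loc p q) \<S>
      \<and> (\<exists>\<A> \<subseteq> \<S>. K_sym p q = \<Union>\<A>) \<and> (\<exists>\<B> \<subseteq> \<S>. K_loc p q = \<Union>\<B>)"
  proof (cases "nat \<bar>p\<bar> = 1")
    case True
    \<comment> \<open>The symmetric part is empty here, so it is the union of no strata.\<close>
    have "\<exists>\<A>\<subseteq>{K_loc p q}. K_sym p q = \<Union>\<A>"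
      using stratification_trivial_group(2)[OF pq True] by (intro exI[of _ "{}"]) simp
    moreover have "\<exists>\<B>\<subseteq>{K_loc p q}. K_loc p q = \<Union>\<B>"
      by (rule exI[of _ "{K_loc p q}"]) simp
    moreover note stratification_trivial_group(1)[OF pq True]
    ultimately show ?thesis
      by - (rule exI[of _ "{K_loc p q}"], intro conjI)
  next
    case False
    then have "2 \<le> nat \<bar>p\<bar>" using pq(1) by linarith
    then show ?thesis by (rule stratification_nontrivial_group[OF pq])
  qed
  show "cut_locus p q = K_sym p q \<union> K_loc p q" by (rule cut_locus_eq_Un[OF pq])
qed (rule K_sym_eq, rule K_loc_eq[OF assms(1,3)])

end
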